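(* Let $p$ be a prime and let $G$ be a finite non-abelian $p$-group such that $\exp(G)=p$ and $\mathrm{cd}(G)=\{1,p\}$. Then $c(G)\le d(Z(G))\,p^2$. Further, if $p\ge 3$ and $G$ is not a direct product of a nontrivial abelian group and a non-abelian group, then $c(G)=d(Z(G))\,p^2$.
   Context: $\exp(G)$ is the exponent of $G$; $\mathrm{cd}(G)=\{\chi(1)\mid \chi\in\mathrm{Irr}(G)\}$ is the set of degrees of irreducible complex characters of $G$; $d(H)$ is the minimal number of generators of a finite group $H$; $Z(G)$ is the center of $G$. A quasi-permutation matrix is a square matrix over $\mathbb{C}$ with non-negative integral trace. $c(G)$ denotes the minimal degree of a faithful representation of $G$ by complex quasi-permutation matrices, i.e. the least $n$ such that there is an injective homomorphism $G\to \mathrm{GL}_n(\mathbb{C})$ all of whose image elements have non-negative integer trace. *)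

theory Defs
  imports
    "HOL-Computational_Algebra.Primes"
    "HOL-Algebra.Elementary_Groups"
    "Jordan_Normal_Form.VS_Connect"
    Complex_Main
begin

definition mat_trace :: "complex mat \<Rightarrow> complex" where
  "mat_trace A = (\<Sum>i<dim_row A. A $$ (i, i))"

definition quasi_permutation_matrix :: "complex mat \<Rightarrow> bool" where
  "quasi_permutation_matrix A \<longleftrightarrow> square_mat A \<and> mat_trace A \<in> \<nat>"

definition GL :: "nat \<Rightarrow> complex mat monoid" where
  "GL n = units_of (ring_mat TYPE(complex) n ())"

(* A representation of degree n is an element of hom G (GL n). *)
definition irreducible_rep :: "('a, 'b) monoid_scheme \<Rightarrow> nat \<Rightarrow> ('a \<Rightarrow> complex mat) \<Rightarrow> bool" where
  "irreducible_rep G n \<rho> \<longleftrightarrow>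
     \<rho> \<in> hom G (GL n) \<and> n > 0 \<and>
     (\<forall>W. VectorSpace.subspace class_ring W (module_vec TYPE(complex) n) \<and>
          (\<forall>g \<in> carrier G. \<forall>w \<in> W. \<rho> g *\<^sub>v w \<in> W)
        \<longrightarrow> W = {0\<^sub>v n} \<or> W = carrier_vec n)"

(* Characters are restricted to the carrier, so that equal characters are equal functions. *)
definition rep_character :: "('a, 'b) monoid_scheme \<Rightarrow> ('a \<Rightarrow> complex mat) \<Rightarrow> 'a \<Rightarrow> complex" where
  "rep_character G \<rho> = (\<lambda>g \<in> carrier G. mat_trace (\<rho> g))"

definition Irr :: "('a, 'b) monoid_scheme \<Rightarrow> ('a \<Rightarrow> complex) set" where
  "Irr G = {rep_character G \<rho> | n \<rho>. irreducible_rep G n \<rho>}"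

definition cd :: "('a, 'b) monoid_scheme \<Rightarrow> complex set" where
  "cd G = {\<chi> \<one>\<^bsub>G\<^esub> | \<chi>. \<chi> \<in> Irr G}"

definition group_center :: "('a, 'b) monoid_scheme \<Rightarrow> 'a set" where
  "group_center G = {z \<in> carrier G. \<forall>g \<in> carrier G. z \<otimes>\<^bsub>G\<^esub> g = g \<otimes>\<^bsub>G\<^esub> z}"

(* The sets under LEAST in the next three definitions are nonempty for finite groups: they
   contain the order of the group (for the last one, by the regular representation). *)
definition group_exponent :: "('a, 'b) monoid_scheme \<Rightarrow> nat" where
  "group_exponent G = (LEAST n. n > 0 \<and> (\<forall>x \<in> carrier G. x [^]\<^bsub>G\<^esub> n = \<one>\<^bsub>G\<^esub>))"

definition min_generators :: "('a, 'b) monoid_scheme \<Rightarrow> nat" where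
  "min_generators H =
     (LEAST k. \<exists>S. S \<subseteq> carrier H \<and> finite S \<and> card S = k \<and> generate H S = carrier H)"

definition quasi_perm_degree :: "('a, 'b) monoid_scheme \<Rightarrow> nat" where
  "quasi_perm_degree G =
     (LEAST n. \<exists>\<rho> \<in> mon G (GL n). \<forall>g \<in> carrier G. quasi_permutation_matrix (\<rho> g))"

(* Taking both factors over the carrier type of G loses nothing: the factors of any
   decomposition are isomorphic to subgroups of G. *)
definition has_abelian_direct_factor :: "('a, 'b) monoid_scheme \<Rightarrow> bool" where
  "has_abelian_direct_factor G \<longleftrightarrow>
     (\<exists>(A :: 'a monoid) (B :: 'a monoid).
        comm_group A \<and> \<not> trivial_group A \<and> group B \<and> \<not> comm_group B \<and> G \<cong> A \<times>\<times> B)"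

end

theory Submission
  imports "HOL-Algebra.Multiplicative_Group" "HOL-Algebra.Group_Action" Defs
    "Jordan_Normal_Form.Spectral_Radius"
begin

text \<open>
  Let \<open>Z\<close> be the centre of \<open>G\<close> and \<open>d\<close> its minimal number of generators. As \<open>G\<close> is a \<open>p\<close>-group of
  exponent \<open>p\<close>, the centre is elementary abelian and meets every nontrivial normal subgroup, so a
  representation is faithful as soon as its restriction to \<open>Z\<close> is. By the degree hypothesis
  every irreducible representation has degree 1 or \<open>p\<close>.

  \<^bold>\<open>Upper bound.\<close> Permutation matrices have natural traces, so it suffices to let \<open>G\<close> act faithfully on
  at most \<open>d p\<^sup>2\<close> points. In an irreducible representation of degree \<open>p\<close> take \<open>x\<close> that is central
  modulo the scalars but not scalar. Its eigenspaces are \<open>p\<close> lines permuted by \<open>G\<close>, and since all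
  eigenvalues of group elements are \<open>p\<close>-th roots of unity, the orbit of an eigenvector of \<open>x\<close> has at
  most \<open>p\<^sup>2\<close> elements (\<open>small_orbit_degree_prime\<close>). Its stabiliser has index at most \<open>p\<^sup>2\<close>, and in
  degree 1 the index is at most \<open>p\<close>. Choosing the representation suitably, one obtains for \<open>T \<le> Z\<close> and \<open>s \<in> Z - T\<close> such a subgroup containing \<open>T\<close> but
  not \<open>s\<close> (\<open>small_index_separating_subgroup\<close>). Going through a minimal generating set of \<open>Z\<close>, at most
  \<open>d\<close> of these subgroups already intersect \<open>Z\<close> trivially (\<open>separating_family\<close>), and \<open>G\<close> acts
  faithfully on the union of their coset spaces (\<open>faithful_permutation_rep\<close>).

  \<^bold>\<open>Lower bound.\<close> Let \<open>\<rho>\<close> be faithful of degree \<open>n\<close> with natural traces. The characters of \<open>Z\<close> that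
  occur in \<open>\<rho>\<close> have trivial common kernel. A minimal subfamily with this property has a dual family
  of elements which generates \<open>Z\<close>, so it has \<open>k \<ge> d\<close> members, and they all take the same value
  \<open>\<zeta> \<noteq> 1\<close> at the product \<open>z\<close> of the dual elements (\<open>dual_family\<close>). Without an abelian direct factor
  every linear character of \<open>G\<close> is trivial on \<open>Z\<close> (\<open>linear_character_direct_factor\<close>); hence each of the
  \<open>k\<close> characters belongs to irreducible constituents of degree \<open>p\<close> and occurs at least \<open>p\<close> times, so
  \<open>\<zeta>\<close> is an eigenvalue of \<open>\<rho>(z)\<close> with multiplicity at least \<open>k p\<close>. Since the trace of \<open>\<rho>(z)\<close> is a
  natural number, irreducibility of the \<open>p\<close>-th cyclotomic polynomial gives every nontrivial \<open>p\<close>-th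
  root of unity the same multiplicity, and 1 at least that multiplicity
  (\<open>sum_roots_of_unity_nat\<close>). Therefore \<open>n \<ge> p \<cdot> k p \<ge> d p\<^sup>2\<close>.
\<close>

section \<open>Subspaces as ranges of injective matrices\<close>

text \<open>
  Subspaces of \<open>carrier_vec n\<close> are handled as ranges of matrices with injective multiplication; the
  number of columns plays the role of the dimension, which keeps every dimension argument inside
  matrix algebra.
\<close>

definition inj_mat :: "'a::field mat \<Rightarrow> bool" where
  "inj_mat P \<longleftrightarrow> (\<forall>v \<in> carrier_vec (dim_col P). P *\<^sub>v v = 0\<^sub>v (dim_row P) \<longrightarrow> v = 0\<^sub>v (dim_col P))"

definition linear_subset :: "nat \<Rightarrow> 'a::field vec set \<Rightarrow> bool" where
  "linear_subset n W \<longleftrightarrow> W \<subseteq> carrier_vec n \<and> 0\<^sub>v n \<in> W \<and>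
     (\<forall>v \<in> W. \<forall>w \<in> W. v + w \<in> W) \<and> (\<forall>c. \<forall>v \<in> W. c \<cdot>\<^sub>v v \<in> W)"

definition mat_range :: "'a::field mat \<Rightarrow> 'a vec set" where
  "mat_range P = (\<lambda>v. P *\<^sub>v v) ` carrier_vec (dim_col P)"

lemma inj_matD:
  assumes "inj_mat P" "P \<in> carrier_mat n m" "v \<in> carrier_vec m" "P *\<^sub>v v = 0\<^sub>v n"
  shows "v = 0\<^sub>v m"
  using assms unfolding inj_mat_def by auto

lemma inj_matI:
  assumes "P \<in> carrier_mat n m" "\<And>v. v \<in> carrier_vec m \<Longrightarrow> P *\<^sub>v v = 0\<^sub>v n \<Longrightarrow> v = 0\<^sub>v m"
  shows "inj_mat P"
  using assms unfolding inj_mat_def by auto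

lemma vec_minus_eq_0:
  fixes v w :: "'a::field vec"
  assumes "v \<in> carrier_vec n" "w \<in> carrier_vec n" "v - w = 0\<^sub>v n"
  shows "v = w"
proof (rule eq_vecI)
  show "dim_vec v = dim_vec w" using assms by auto
  fix i assume "i < dim_vec w"
  then have "(v - w) $ i = 0" using assms by auto
  then show "v $ i = w $ i" using \<open>i < dim_vec w\<close> by auto
qed

lemma minus_one_mult_vec:
  fixes A :: "'a::field mat"
  assumes "A \<in> carrier_mat n n" "v \<in> carrier_vec n"
  shows "(A - 1\<^sub>m n) *\<^sub>v v = A *\<^sub>v v - v"
  using minus_mult_distrib_mat_vec[OF assms(1) one_carrier_mat assms(2)] assms(2) by simp

lemma inj_mat_cancel:
  assumes "inj_mat P" "P \<in> carrier_mat n m" "v \<in> carrier_vec m" "w \<in> carrier_vec m" "P *\<^sub>v v = P *\<^sub>v w"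
  shows "v = w"
proof -
  have "P *\<^sub>v (v - w) = P *\<^sub>v v - P *\<^sub>v w"
    using assms by (intro mult_minus_distrib_mat_vec)
  also have "\<dots> = 0\<^sub>v n" using assms by (auto intro: minus_cancel_vec)
  finally have "v - w = 0\<^sub>v m" using inj_matD[OF assms(1,2)] assms by auto
  then show ?thesis using vec_minus_eq_0 assms by blast
qed

lemma smult_vec_right_cancel:
  fixes v :: "'a::field vec"
  assumes "v \<in> carrier_vec n" "v \<noteq> 0\<^sub>v n" "a \<cdot>\<^sub>v v = b \<cdot>\<^sub>v v"
  shows "a = b"
proof -
  have "\<exists>i<n. v $ i \<noteq> 0"
  proof (rule ccontr)
    assume "\<not> (\<exists>i<n. v $ i \<noteq> 0)"
    then have "v = 0\<^sub>v n" using assms(1) by (auto intro!: eq_vecI)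
    then show False using assms(2) by blast
  qed
  then obtain i where i: "i < n" "v $ i \<noteq> 0" by blast
  have "(a \<cdot>\<^sub>v v) $ i = (b \<cdot>\<^sub>v v) $ i" using assms(3) by simp
  then show ?thesis using i assms(1) by simp
qed

lemma mult_unit_vec:
  fixes A :: "'a::field mat"
  assumes "A \<in> carrier_mat n m" "j < m"
  shows "A *\<^sub>v unit_vec m j = col A j"
  using assms by (auto intro!: eq_vecI)

lemma mat_eqI_mult_vec:
  fixes A B :: "'a::field mat"
  assumes A: "A \<in> carrier_mat n m" and B: "B \<in> carrier_mat n m"
    and eq: "\<And>v. v \<in> carrier_vec m \<Longrightarrow> A *\<^sub>v v = B *\<^sub>v v"
  shows "A = B"
proof (rule mat_col_eqI)
  fix j assume "j < dim_col B"
  then have j: "j < m" using B by auto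
  have "col A j = A *\<^sub>v unit_vec m j" using A j by (simp add: mult_unit_vec)
  also have "\<dots> = B *\<^sub>v unit_vec m j" by (rule eq) auto
  also have "\<dots> = col B j" using B j by (simp add: mult_unit_vec)
  finally show "col A j = col B j" .
qed (use A B in auto)

lemma inj_mat_cancel_mat:
  assumes "inj_mat P" "P \<in> carrier_mat n m" "A \<in> carrier_mat m k" "B \<in> carrier_mat m k" "P * A = P * B"
  shows "A = B"
proof (rule mat_eqI_mult_vec[OF assms(3,4)])
  fix v :: "'a vec" assume v: "v \<in> carrier_vec k"
  have "P *\<^sub>v (A *\<^sub>v v) = P *\<^sub>v (B *\<^sub>v v)"
    using assoc_mult_mat_vec[OF assms(2,3) v] assoc_mult_mat_vec[OF assms(2,4) v] assms(5) by metis
  then show "A *\<^sub>v v = B *\<^sub>v v"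
    using inj_mat_cancel[OF assms(1,2)] mult_mat_vec_carrier[OF assms(3) v]
      mult_mat_vec_carrier[OF assms(4) v] by blast
qed

lemma inj_mat_mult:
  assumes "inj_mat P" "P \<in> carrier_mat n m" "inj_mat Q" "Q \<in> carrier_mat m k"
  shows "inj_mat (P * Q)"
proof (rule inj_matI[of _ n k])
  fix v :: "'a vec" assume v: "v \<in> carrier_vec k" and "P * Q *\<^sub>v v = 0\<^sub>v n"
  then have "P *\<^sub>v (Q *\<^sub>v v) = 0\<^sub>v n" using assms by auto
  then have "Q *\<^sub>v v = 0\<^sub>v m" using inj_matD[OF assms(1,2)] assms v by auto
  then show "v = 0\<^sub>v k" using inj_matD[OF assms(3,4)] v by auto
qed (use assms in auto)

text \<open>
  Padding with zero rows gives a square matrix with a zero row, so its determinant vanishes.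
\<close>

lemma wide_mat_kernel:
  fixes P :: "'a::field mat"
  assumes P: "P \<in> carrier_mat n m" and "n < m"
  shows "\<exists>v \<in> carrier_vec m. v \<noteq> 0\<^sub>v m \<and> P *\<^sub>v v = 0\<^sub>v n"
proof -
  define B where "B = mat m m (\<lambda>(i,j). if i < n then P $$ (i,j) else 0)"
  have B: "B \<in> carrier_mat m m" by (simp add: B_def)
  have "B\<^sup>T *\<^sub>v unit_vec m n = 0\<^sub>v m"
    using B \<open>n < m\<close> by (subst mult_unit_vec[of _ m m]) (auto simp: B_def intro!: eq_vecI)
  moreover have "unit_vec m n \<noteq> (0\<^sub>v m :: 'a vec)"
    using \<open>n < m\<close> by auto
  ultimately have "det B\<^sup>T = 0"
    using B by (subst det_0_iff_vec_prod_zero_field[of _ m]) (auto intro: exI[of _ "unit_vec m n"])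
  then have "det B = 0" using det_transpose[OF B] by simp
  then obtain v where v: "v \<in> carrier_vec m" "v \<noteq> 0\<^sub>v m" "B *\<^sub>v v = 0\<^sub>v m"
    using B by (auto simp: det_0_iff_vec_prod_zero_field[of _ m])
  have "P *\<^sub>v v = 0\<^sub>v n"
  proof (rule eq_vecI)
    fix i assume "i < dim_vec (0\<^sub>v n :: 'a vec)"
    then have i: "i < n" by simp
    have "row P i = row B i" using P i \<open>n < m\<close> by (auto simp: B_def intro!: eq_vecI)
    then have "(P *\<^sub>v v) $ i = (B *\<^sub>v v) $ i" using P B i \<open>n < m\<close> by auto
    then show "(P *\<^sub>v v) $ i = 0\<^sub>v n $ i" using v i \<open>n < m\<close> by simp
  qed (use P in auto)
  then show ?thesis using v by blast
qed

lemma inj_mat_le: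
  assumes "P \<in> carrier_mat n m" "inj_mat P"
  shows "m \<le> n"
  using wide_mat_kernel[OF assms(1)] inj_matD[OF assms(2,1)] by (meson not_le)

definition hcat :: "'a mat \<Rightarrow> 'a mat \<Rightarrow> 'a mat" where
  "hcat P Q = mat (dim_row P) (dim_col P + dim_col Q)
     (\<lambda>(i,j). if j < dim_col P then P $$ (i,j) else Q $$ (i, j - dim_col P))"

lemma hcat_carrier: "P \<in> carrier_mat n m \<Longrightarrow> Q \<in> carrier_mat n k \<Longrightarrow> hcat P Q \<in> carrier_mat n (m + k)"
  by (auto simp: hcat_def)

lemma hcat_mult_vec:
  fixes P Q :: "'a::field mat"
  assumes P: "P \<in> carrier_mat n m" and Q: "Q \<in> carrier_mat n k"
    and a: "a \<in> carrier_vec m" and b: "b \<in> carrier_vec k"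
  shows "hcat P Q *\<^sub>v (a @\<^sub>v b) = P *\<^sub>v a + Q *\<^sub>v b"
proof (rule eq_vecI)
  fix i assume "i < dim_vec (P *\<^sub>v a + Q *\<^sub>v b)"
  then have i: "i < n" using Q by auto
  have "row (hcat P Q) i = row P i @\<^sub>v row Q i"
    using P Q i by (auto simp: hcat_def intro!: eq_vecI)
  then show "(hcat P Q *\<^sub>v (a @\<^sub>v b)) $ i = (P *\<^sub>v a + Q *\<^sub>v b) $ i"
    using assms i hcat_carrier[OF P Q] scalar_prod_append[of "row P i" m "row Q i" k a b] by auto
qed (use assms in \<open>auto simp: hcat_def\<close>)

lemma inj_mat_hcat:
  fixes P Q :: "'a::field mat"
  assumes P: "P \<in> carrier_mat n m" and Q: "Q \<in> carrier_mat n k"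
    and *: "\<And>a b. a \<in> carrier_vec m \<Longrightarrow> b \<in> carrier_vec k \<Longrightarrow> P *\<^sub>v a + Q *\<^sub>v b = 0\<^sub>v n
            \<Longrightarrow> a = 0\<^sub>v m \<and> b = 0\<^sub>v k"
  shows "inj_mat (hcat P Q)"
proof (rule inj_matI[OF hcat_carrier[OF P Q]])
  fix v :: "'a vec" assume v: "v \<in> carrier_vec (m + k)" "hcat P Q *\<^sub>v v = 0\<^sub>v n"
  define a where "a = vec_first v m"
  define b where "b = vec_last v k"
  have ab: "a @\<^sub>v b = v" "a \<in> carrier_vec m" "b \<in> carrier_vec k"
    using v unfolding a_def b_def by auto
  then have "a = 0\<^sub>v m \<and> b = 0\<^sub>v k"
    using * hcat_mult_vec[OF P Q ab(2,3)] v by simp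
  then show "v = 0\<^sub>v (m + k)" using ab(1) by (auto intro!: eq_vecI)
qed

lemma linear_subset_image:
  fixes D :: "'a::field mat"
  assumes D: "D \<in> carrier_mat n m" and F: "linear_subset m F"
  shows "linear_subset n ((\<lambda>v. D *\<^sub>v v) ` F)"
  unfolding linear_subset_def
proof (intro conjI ballI allI)
  have Fc: "F \<subseteq> carrier_vec m" and F0: "0\<^sub>v m \<in> F" using F by (auto simp: linear_subset_def)
  show "(\<lambda>v. D *\<^sub>v v) ` F \<subseteq> carrier_vec n" using D Fc by auto
  have "D *\<^sub>v 0\<^sub>v m = 0\<^sub>v n" using D by (auto intro!: eq_vecI)
  then show "0\<^sub>v n \<in> (\<lambda>v. D *\<^sub>v v) ` F" by (intro image_eqI[OF _ F0]) (rule sym)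
  fix v assume "v \<in> (\<lambda>v. D *\<^sub>v v) ` F"
  then obtain a where a: "v = D *\<^sub>v a" "a \<in> F" by (rule imageE)
  have ac: "a \<in> carrier_vec m" using a Fc by blast
  show "r \<cdot>\<^sub>v v \<in> (\<lambda>v. D *\<^sub>v v) ` F" for r
    unfolding a(1) mult_mat_vec[OF D ac, symmetric] using F a(2) by (simp add: linear_subset_def)
  fix w assume "w \<in> (\<lambda>v. D *\<^sub>v v) ` F"
  then obtain b where b: "w = D *\<^sub>v b" "b \<in> F" by (rule imageE)
  have bc: "b \<in> carrier_vec m" using b Fc by blast
  show "v + w \<in> (\<lambda>v. D *\<^sub>v v) ` F"
    unfolding a(1) b(1) mult_add_distrib_mat_vec[OF D ac bc, symmetric]
    using F a(2) b(2) by (simp add: linear_subset_def)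
qed

lemma linear_subset_mat_range:
  assumes "P \<in> carrier_mat n m"
  shows "linear_subset n (mat_range P)"
  using linear_subset_image[OF assms, of "carrier_vec m"] assms
  by (simp add: mat_range_def linear_subset_def)

lemma mult_mat_vec_in_range:
  "P \<in> carrier_mat n m \<Longrightarrow> v \<in> carrier_vec m \<Longrightarrow> P *\<^sub>v v \<in> mat_range P"
  by (auto simp: mat_range_def)

text \<open>
  A basis, written as a matrix: an injective matrix with range inside the subspace and the largest
  possible number of columns already has full range, since a vector outside the range could be
  appended as a further column.
\<close>

lemma linear_subset_basis:
  fixes W :: "'a::field vec set"
  assumes W: "linear_subset n W"
  shows "\<exists>k P. k \<le> n \<and> P \<in> carrier_mat n k \<and> inj_mat P \<and> mat_range P = W"
proof -
  define Q where "Q = (\<lambda>k. \<exists>P. P \<in> carrier_mat n k \<and> inj_mat P \<and> mat_range P \<subseteq> W)"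
  have "Q 0" unfolding Q_def
  proof (intro exI conjI)
    show "(0\<^sub>m n 0 :: 'a mat) \<in> carrier_mat n 0" by simp
    show "inj_mat (0\<^sub>m n 0 :: 'a mat)" by (auto simp: inj_mat_def)
    have "0\<^sub>m n 0 *\<^sub>v v = 0\<^sub>v n" if "v \<in> carrier_vec 0" for v :: "'a vec"
      using that by (auto intro!: eq_vecI simp: scalar_prod_def)
    then show "mat_range (0\<^sub>m n 0) \<subseteq> W" using W
      by (auto simp: mat_range_def linear_subset_def)
  qed
  moreover have bound: "\<And>k. Q k \<Longrightarrow> k \<le> n" using inj_mat_le by (auto simp: Q_def)
  ultimately obtain k where k: "Q k" "\<And>l. Q l \<Longrightarrow> l \<le> k"
    using GreatestI_nat[of Q 0 n] Greatest_le_nat[of Q _ n] by blast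
  then obtain P where P: "P \<in> carrier_mat n k" "inj_mat P" "mat_range P \<subseteq> W"
    unfolding Q_def by blast
  have "W \<subseteq> mat_range P"
  proof (rule ccontr)
    assume "\<not> W \<subseteq> mat_range P"
    then obtain w where w: "w \<in> W" "w \<notin> mat_range P" by blast
    then have wc: "w \<in> carrier_vec n" using W by (auto simp: linear_subset_def)
    define B where "B = mat_of_cols n [w]"
    have B: "B \<in> carrier_mat n 1" unfolding B_def by (rule carrier_matI) simp_all
    have Bv: "B *\<^sub>v b = (b $ 0) \<cdot>\<^sub>v w" if "b \<in> carrier_vec 1" for b
      using that wc by (auto simp: B_def scalar_prod_def mat_of_cols_def intro!: eq_vecI)
    have "inj_mat (hcat P B)"
    proof (rule inj_mat_hcat[OF P(1) B])
      fix a b :: "'a vec"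
      assume a: "a \<in> carrier_vec k" and b: "b \<in> carrier_vec 1" and 0: "P *\<^sub>v a + B *\<^sub>v b = 0\<^sub>v n"
      have "b $ 0 = 0"
      proof (rule ccontr)
        assume nz: "b $ 0 \<noteq> 0"
        have "w = P *\<^sub>v ((- (1 / b $ 0)) \<cdot>\<^sub>v a)"
        proof (rule eq_vecI)
          fix i assume "i < dim_vec (P *\<^sub>v ((- (1 / b $ 0)) \<cdot>\<^sub>v a))"
          then have i: "i < n" using P by auto
          have "(P *\<^sub>v a + B *\<^sub>v b) $ i = 0" using 0 i by simp
          then have "(P *\<^sub>v a) $ i + b $ 0 * w $ i = 0" using Bv[OF b] i wc B by auto
          moreover have "(P *\<^sub>v ((- (1 / b $ 0)) \<cdot>\<^sub>v a)) $ i = - (1 / b $ 0) * (P *\<^sub>v a) $ i"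
            using P(1) a i by (simp add: mult_mat_vec)
          moreover have "w $ i = - (1 / b $ 0) * x" if "x + b $ 0 * w $ i = 0" for x
            using nz that by (simp add: field_simps add_eq_0_iff)
          ultimately show "w $ i = (P *\<^sub>v ((- (1 / b $ 0)) \<cdot>\<^sub>v a)) $ i"
            by simp
        qed (use P wc in auto)
        then show False using w a P(1) mult_mat_vec_in_range[OF P(1)] by auto
      qed
      then have b0: "b = 0\<^sub>v 1" using b by (auto intro!: eq_vecI)
      then have "B *\<^sub>v b = 0\<^sub>v n" using Bv[OF b] wc by (auto intro!: eq_vecI)
      then have "P *\<^sub>v a = 0\<^sub>v n" using 0 P(1) a by auto
      then show "a = 0\<^sub>v k \<and> b = 0\<^sub>v 1" using b0 inj_matD[OF P(2,1) a] by auto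
    qed
    moreover have "mat_range (hcat P B) \<subseteq> W"
    proof
      fix x assume "x \<in> mat_range (hcat P B)"
      then obtain v where v: "v \<in> carrier_vec (k + 1)" "x = hcat P B *\<^sub>v v"
        using hcat_carrier[OF P(1) B] by (auto simp: mat_range_def)
      define a where "a = vec_first v k"
      define b where "b = vec_last v 1"
      have ab: "a @\<^sub>v b = v" "a \<in> carrier_vec k" "b \<in> carrier_vec 1"
        using v unfolding a_def b_def by auto
      have "x = P *\<^sub>v a + (b $ 0) \<cdot>\<^sub>v w" using v(2) hcat_mult_vec[OF P(1) B ab(2,3)] ab(1) Bv ab(3) by simp
      moreover have "P *\<^sub>v a \<in> W" using P(3) ab(2) mult_mat_vec_in_range[OF P(1)] by blast
      moreover have "(b $ 0) \<cdot>\<^sub>v w \<in> W" using W w(1) by (simp add: linear_subset_def)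
      ultimately show "x \<in> W" using W by (simp add: linear_subset_def)
    qed
    ultimately have "Q (k + 1)" using hcat_carrier[OF P(1) B] unfolding Q_def by blast
    then show False using k(2) by fastforce
  qed
  then show ?thesis using P bound[OF k(1)] by blast
qed

lemma inj_square_mat_range:
  assumes P: "P \<in> carrier_mat n n" "inj_mat P"
  shows "mat_range P = carrier_vec n"
proof -
  have "det P \<noteq> 0" using P inj_matD by (auto simp: det_0_iff_vec_prod_zero_field[of _ n])
  then obtain R where R: "R \<in> carrier_mat n n" "P * R = 1\<^sub>m n"
    using P(1) det_non_zero_imp_unit[OF P(1)] unfolding Units_def ring_mat_def by auto
  have "v \<in> mat_range P" if "v \<in> carrier_vec n" for v
  proof -
    have "P *\<^sub>v (R *\<^sub>v v) = v" using assoc_mult_mat_vec[OF P(1) R(1) that] R(2) that by simp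
    then show ?thesis using mult_mat_vec_in_range[OF P(1), of "R *\<^sub>v v"] R that by auto
  qed
  then show ?thesis using P by (auto simp: mat_range_def)
qed

text \<open>
  The eigenspace of an upper triangular matrix for \<open>c\<close> is at most as large as the number of diagonal
  entries \<open>c\<close>. Otherwise some nonzero eigenvector would vanish at all positions with diagonal entry
  \<open>c\<close>; but at its last nonzero position the eigenvalue equation forces the diagonal entry \<open>c\<close>.
\<close>

lemma upper_triangular_eigen_count:
  fixes B :: "'a::field mat"
  assumes B: "B \<in> carrier_mat n n" "upper_triangular B"
    and Q: "Q \<in> carrier_mat n m" "inj_mat Q"
    and BQ: "\<And>v. v \<in> carrier_vec m \<Longrightarrow> B *\<^sub>v (Q *\<^sub>v v) = c \<cdot>\<^sub>v (Q *\<^sub>v v)"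
  shows "m \<le> card {i. i < n \<and> B $$ (i,i) = c}"
proof (rule ccontr)
  define D where "D = {i. i < n \<and> B $$ (i,i) = c}"
  assume "\<not> m \<le> card {i. i < n \<and> B $$ (i,i) = c}"
  then have less: "card D < m" by (simp add: D_def)
  have "finite D" by (simp add: D_def)
  then obtain e where e: "bij_betw e {0..<card D} D" using ex_bij_betw_nat_finite by blast
  define R where "R = mat (card D) m (\<lambda>(i,j). Q $$ (e i, j))"
  have R: "R \<in> carrier_mat (card D) m" by (simp add: R_def)
  obtain v where v: "v \<in> carrier_vec m" "v \<noteq> 0\<^sub>v m" "R *\<^sub>v v = 0\<^sub>v (card D)"
    using wide_mat_kernel[OF R less] by blast
  \<comment> \<open>an eigenvector that vanishes on \<open>D\<close>\<close>
  define y where "y = Q *\<^sub>v v"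
  have y: "y \<in> carrier_vec n" "y \<noteq> 0\<^sub>v n" "B *\<^sub>v y = c \<cdot>\<^sub>v y"
    using Q v BQ inj_matD[OF Q(2,1)] by (auto simp: y_def)
  have yD: "y $ i = 0" if "i \<in> D" for i
  proof -
    have "i \<in> e ` {0..<card D}" using e that by (simp add: bij_betw_def)
    then obtain k where k: "k < card D" "e k = i" by auto
    have "i < n" using that D_def by auto
    then have "row R k = row Q i" using k Q by (auto simp: R_def intro!: eq_vecI)
    then have "y $ i = (R *\<^sub>v v) $ k" using k R Q \<open>i < n\<close> by (simp add: y_def)
    then show ?thesis using v k by simp
  qed
  have "\<exists>i<n. y $ i \<noteq> 0"
  proof (rule ccontr)
    assume "\<not> (\<exists>i<n. y $ i \<noteq> 0)"
    then have "y = 0\<^sub>v n" using y(1) by (auto intro!: eq_vecI)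
    then show False using y(2) by blast
  qed
  then obtain i0 where i0: "i0 < n \<and> y $ i0 \<noteq> 0" by blast
  define i where "i = (GREATEST i. i < n \<and> y $ i \<noteq> 0)"
  have i: "i < n" "y $ i \<noteq> 0"
    using GreatestI_nat[of "\<lambda>i. i < n \<and> y $ i \<noteq> 0", OF i0, of n] by (auto simp: i_def)
  have i_max: "j \<le> i" if "j < n" "y $ j \<noteq> 0" for j
    unfolding i_def using that by (intro Greatest_le_nat[of _ _ n]) auto
  have "c * y $ i = (B *\<^sub>v y) $ i" unfolding y(3) using y(1) i by simp
  also have "\<dots> = (\<Sum>j\<in>{0..<n}. B $$ (i,j) * y $ j)"
    using B(1) y(1) i(1) by (auto simp: scalar_prod_def intro!: sum.cong)
  also have "\<dots> = (\<Sum>j\<in>{i}. B $$ (i,j) * y $ j)"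
  proof (rule sum.mono_neutral_right)
    show "\<forall>j\<in>{0..<n} - {i}. B $$ (i, j) * y $ j = 0"
    proof
      fix j assume j: "j \<in> {0..<n} - {i}"
      show "B $$ (i, j) * y $ j = 0"
      proof (cases "j < i")
        case True
        then show ?thesis using B i by auto
      next
        case False
        then have "y $ j = 0" using i_max[of j] j by auto
        then show ?thesis by simp
      qed
    qed
  qed (use i in auto)
  finally have "c = B $$ (i,i)" using i by simp
  then have "i \<in> D" using i by (simp add: D_def)
  then show False using yD i by blast
qed

lemma trace_mult_commute:
  assumes A: "A \<in> carrier_mat n m" and B: "B \<in> carrier_mat m n"
  shows "mat_trace (A * B) = mat_trace (B * A)"
proof -
  have "mat_trace (A * B) = (\<Sum>i<n. \<Sum>j<m. A $$ (i,j) * B $$ (j,i))"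
    using A B by (auto simp: mat_trace_def scalar_prod_def lessThan_atLeast0 intro!: sum.cong)
  also have "\<dots> = (\<Sum>j<m. \<Sum>i<n. B $$ (j,i) * A $$ (i,j))"
    by (subst sum.swap) (simp add: mult.commute)
  also have "\<dots> = mat_trace (B * A)"
    using A B by (auto simp: mat_trace_def scalar_prod_def lessThan_atLeast0 intro!: sum.cong)
  finally show ?thesis .
qed

section \<open>Eigenvalues of matrices of finite order\<close>

lemma finite_order_eigenvalue:
  fixes A :: "'a::field mat"
  assumes A: "A \<in> carrier_mat n n" "A ^\<^sub>m k = 1\<^sub>m n"
    and v: "v \<in> carrier_vec n" "v \<noteq> 0\<^sub>v n" "A *\<^sub>v v = c \<cdot>\<^sub>v v"
  shows "c ^ k = 1"
proof -
  have "eigenvector A v c" using A(1) v by (auto simp: eigenvector_def)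
  then have "1 \<cdot>\<^sub>v v = c ^ k \<cdot>\<^sub>v v" using eigenvector_pow[OF A(1), of v c k] v(1) unfolding A(2) by simp
  then show ?thesis by (rule smult_vec_right_cancel[OF v(1,2), symmetric])
qed

text \<open>
  Triangularisation turns the trace into a sum of roots of unity in which each eigenvalue is listed
  at least as often as the size of its eigenspace. The last clause states this for an arbitrary
  injective matrix with columns in the eigenspace.
\<close>

lemma finite_order_eigenvalues:
  fixes A :: "complex mat"
  assumes A: "A \<in> carrier_mat n n" and pow: "A ^\<^sub>m k = 1\<^sub>m n"
  shows "\<exists>\<mu>. mat_trace A = (\<Sum>i<n. \<mu> i) \<and> (\<forall>i<n. \<mu> i ^ k = 1) \<and>
     (\<forall>c m Q. Q \<in> carrier_mat n m \<and> inj_mat Q \<and>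
        (\<forall>v\<in>carrier_vec m. A *\<^sub>v (Q *\<^sub>v v) = c \<cdot>\<^sub>v (Q *\<^sub>v v)) \<longrightarrow> m \<le> card {i. i < n \<and> \<mu> i = c})"
proof -
  obtain es where "char_poly A = (\<Prod>a\<leftarrow>es. [:- a, 1:])" using char_poly_factorized[OF A] by blast
  then obtain B where B: "B \<in> carrier_mat n n" "upper_triangular B" "similar_mat A B"
    using schur_decomposition_exists[OF A] by blast
  then obtain P R where w: "similar_mat_wit A B P R" unfolding similar_mat_def by blast
  note sw = similar_mat_witD2[OF A w]
  have tr: "mat_trace A = (\<Sum>i<n. B $$ (i,i))"
  proof -
    have "mat_trace A = mat_trace (P * (B * R))" using sw by (simp add: assoc_mult_mat[of _ n n _ n _ n])
    also have "\<dots> = mat_trace (B * R * P)" using sw trace_mult_commute[of P n n "B * R"] by simp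
    also have "B * R * P = B" using sw by (simp add: assoc_mult_mat[of _ n n _ n _ n])
    finally show ?thesis using B by (simp add: mat_trace_def)
  qed
  have roots: "B $$ (i,i) ^ k = 1" if i: "i < n" for i
  proof -
    have "B $$ (i,i) \<in> set (diag_mat B)" using i B(1) by (auto simp: diag_mat_def)
    moreover have "char_poly A = (\<Prod>a\<leftarrow>diag_mat B. [:- a, 1:])"
      using char_poly_upper_triangular[OF B(1,2)] char_poly_similar[OF B(3)] by simp
    ultimately have "poly (char_poly A) (B $$ (i,i)) = 0" by (auto simp: poly_prod_list prod_list_zero_iff)
    then obtain v where ev: "eigenvector A v (B $$ (i,i))"
      using eigenvalue_root_char_poly[OF A] by (auto simp: eigenvalue_def)
    then show ?thesis using A by (intro finite_order_eigenvalue[OF A pow, of v]) (auto simp: eigenvector_def)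
  qed
  have cnt: "m \<le> card {i. i < n \<and> B $$ (i,i) = c}"
    if Q: "Q \<in> carrier_mat n m" "inj_mat Q"
      and AQ: "\<forall>v\<in>carrier_vec m. A *\<^sub>v (Q *\<^sub>v v) = c \<cdot>\<^sub>v (Q *\<^sub>v v)" for c m Q
  proof (rule upper_triangular_eigen_count[OF B(1,2), where Q = "R * Q"])
    show "R * Q \<in> carrier_mat n m" using sw Q by auto
    have "inj_mat R"
    proof (rule inj_matI[of _ n n])
      fix v :: "complex vec" assume v: "v \<in> carrier_vec n" "R *\<^sub>v v = 0\<^sub>v n"
      have "v = P *\<^sub>v (R *\<^sub>v v)" using assoc_mult_mat_vec[OF sw(6,7) v(1)] sw(1) v(1) by simp
      then show "v = 0\<^sub>v n" using v sw by auto
    qed (use sw in auto)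
    then show "inj_mat (R * Q)" using inj_mat_mult sw Q by blast
    fix v :: "complex vec" assume v: "v \<in> carrier_vec m"
    define x where "x = Q *\<^sub>v v"
    have x: "x \<in> carrier_vec n" using Q v by (auto simp: x_def)
    have Rx: "R * Q *\<^sub>v v = R *\<^sub>v x" using sw Q v by (auto simp: x_def)
    have "B *\<^sub>v (R *\<^sub>v x) = (B * R) *\<^sub>v x" using sw x by simp
    also have "B * R = R * A"
    proof -
      have "R * A = R * (P * (B * R))" using arg_cong[OF sw(3), of "(*) R"] assoc_mult_mat[OF sw(6,5,7)] by simp
      also have "\<dots> = (R * P) * (B * R)" using assoc_mult_mat[OF sw(7,6), of "B * R" n] sw(5,7) by simp
      finally show ?thesis using sw(2,5,7) left_mult_one_mat[of "B * R" n n] by simp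
    qed
    also have "(R * A) *\<^sub>v x = R *\<^sub>v (A *\<^sub>v x)" using sw(4-7) x by simp
    also have "A *\<^sub>v x = c \<cdot>\<^sub>v x" using AQ v by (simp add: x_def)
    also have "R *\<^sub>v (c \<cdot>\<^sub>v x) = c \<cdot>\<^sub>v (R *\<^sub>v x)" using sw x by (simp add: mult_mat_vec)
    finally show "B *\<^sub>v (R * Q *\<^sub>v v) = c \<cdot>\<^sub>v (R * Q *\<^sub>v v)" using Rx by simp
  qed
  show ?thesis
    using tr roots cnt by (intro exI[of _ "\<lambda>i. B $$ (i,i)"]) blast
qed

section \<open>Sums of roots of unity of prime order\<close>

text \<open>
  The coefficients of the factor whose constant term is divisible by \<open>q\<close> are inspected up to the
  first one not divisible by \<open>q\<close>; its index is at least the degree of the product, so the other factor is constant.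
\<close>

lemma eisenstein:
  fixes F G H :: "int poly" and q :: int
  assumes q: "prime q" and F: "F = G * H"
    and lead: "\<not> q dvd lead_coeff F"
    and div: "\<And>i. i < degree F \<Longrightarrow> q dvd coeff F i"
    and const: "\<not> q\<^sup>2 dvd coeff F 0"
  shows "degree G = 0 \<or> degree H = 0"
proof -
  have main: "degree B = 0" if AB: "F = A * B" "q dvd coeff A 0" "\<not> q dvd coeff B 0" for A B
  proof -
    have nz: "A \<noteq> 0" "B \<noteq> 0" using lead AB(1) by auto
    have "\<not> q dvd lead_coeff A" using lead AB(1) by (auto simp: lead_coeff_mult)
    then have ex: "\<exists>i. \<not> q dvd coeff A i" by blast
    define i where "i = (LEAST i. \<not> q dvd coeff A i)"
    have i: "\<not> q dvd coeff A i" using LeastI_ex[OF ex] by (simp add: i_def)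
    have less: "q dvd coeff A j" if "j < i" for j
      using not_less_Least[of j "\<lambda>i. \<not> q dvd coeff A i"] that by (auto simp: i_def)
    have "i \<le> degree A" using i by (intro le_degree) auto
    have "\<not> q dvd coeff F i"
    proof
      assume "q dvd coeff F i"
      moreover have "coeff F i = coeff A i * coeff B 0 + (\<Sum>j<i. coeff A j * coeff B (i - j))"
        by (simp add: AB(1) coeff_mult flip: lessThan_Suc_atMost)
      moreover have "q dvd (\<Sum>j<i. coeff A j * coeff B (i - j))"
        using less by (intro dvd_sum) auto
      ultimately have "q dvd coeff A i * coeff B 0" by (simp add: dvd_add_left_iff)
      then show False using q i AB(3) by (simp add: prime_dvd_mult_iff)
    qed
    then have "degree F \<le> i" using div[of i] by (meson not_le)
    then show "degree B = 0" using \<open>i \<le> degree A\<close> nz by (simp add: AB(1) degree_mult_eq)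
  qed
  show ?thesis
  proof (cases "degree F = 0")
    case True
    moreover have "G \<noteq> 0" "H \<noteq> 0" using lead F by auto
    ultimately show ?thesis by (simp add: F degree_mult_eq)
  next
    case False
    have "q dvd coeff G 0 * coeff H 0" using div[of 0] False by (simp add: F coeff_mult)
    moreover have "\<not> (q dvd coeff G 0 \<and> q dvd coeff H 0)"
      using const by (auto simp: F coeff_mult power2_eq_square intro: mult_dvd_mono)
    ultimately show ?thesis
      using q main[of G H] main[of H G] by (auto simp: prime_dvd_mult_iff F mult.commute)
  qed
qed

text \<open>
  Irreducibility of the \<open>p\<close>-th cyclotomic polynomial \<open>F\<close>, in the form that is used later. A primitive
  integer polynomial of least degree vanishing at \<open>\<zeta>\<close> divides \<open>F\<close> over the integers by Gauss's lemma,
  and Eisenstein's criterion applies to \<open>F\<close> after the shift \<open>x \<mapsto> x + 1\<close>.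
\<close>

lemma root_of_unity_relation_degree:
  fixes \<zeta> :: complex and f :: "int poly"
  assumes p: "prime p" and \<zeta>: "\<zeta> ^ p = 1" "\<zeta> \<noteq> 1"
    and f: "poly (of_int_poly f) \<zeta> = 0" "degree f < p - 1"
  shows "f = 0"
proof (rule ccontr)
  assume "f \<noteq> 0"
  define bad where "bad = (\<lambda>d. \<exists>g :: int poly. g \<noteq> 0 \<and> degree g = d \<and> poly (of_int_poly g) \<zeta> = 0)"
  define d where "d = (LEAST d. bad d)"
  have "bad (degree f)" using f \<open>f \<noteq> 0\<close> by (auto simp: bad_def)
  then have "bad d" and d_less: "d < p - 1"
    using LeastI[of bad] Least_le[of bad "degree f"] f(2) by (auto simp: d_def)
  have min: "g = 0" if "degree g < d" "poly (of_int_poly g) \<zeta> = 0" for g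
    using not_less_Least[of "degree g" bad] that by (auto simp: d_def bad_def)
  obtain g0 where g0: "g0 \<noteq> 0" "degree g0 = d" "poly (of_int_poly g0) \<zeta> = 0"
    using \<open>bad d\<close> by (auto simp: bad_def)
  define g where "g = primitive_part g0"
  have g: "g \<noteq> 0" "degree g = d" "content g = 1" using g0 by (auto simp: g_def)
  have "of_int_poly g0 = smult (of_int (content g0)) (of_int_poly g :: complex poly)"
    using arg_cong[OF content_times_primitive_part[of g0], of "of_int_poly :: int poly \<Rightarrow> complex poly"]
    by (simp add: g_def of_int_hom.map_poly_hom_smult del: content_times_primitive_part)
  then have g_root: "poly (of_int_poly g) \<zeta> = 0" using g0 by simp
  have "d > 0"
  proof (rule ccontr)
    assume "\<not> d > 0"
    then obtain c where "g = [:c:]" using g(2) degree_eq_zeroE by auto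
    then show False using g_root g(1) by simp
  qed
  define F :: "int poly" where "F = (\<Sum>i<p. monom 1 i)"
  have p2: "p \<ge> 2" using p by (rule prime_ge_2_nat)
  have coeff_F: "coeff F i = (if i < p then 1 else 0)" for i
    by (auto simp: F_def coeff_sum)
  have deg_F: "degree F = p - 1"
  proof (rule antisym)
    show "degree F \<le> p - 1" by (rule degree_le) (auto simp: coeff_F)
    show "p - 1 \<le> degree F" using p2 by (intro le_degree) (auto simp: coeff_F)
  qed
  have F_geom: "[:-1, 1:] * F = monom 1 p - 1"
  proof -
    have "monom 1 i = ([:0, 1:] ^ i :: int poly)" for i by (simp add: monom_altdef)
    then have "[:-1, 1:] * F = ([:0,1:] - 1) * (\<Sum>i<p. [:0,1:] ^ i)" by (simp add: F_def one_pCons)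
    then show ?thesis by (simp add: power_diff_1_eq monom_altdef)
  qed
  have F_root: "poly (of_int_poly F) \<zeta> = 0"
  proof -
    have "poly (of_int_poly ([:-1, 1:] * F)) \<zeta> = poly (of_int_poly (monom 1 p - 1)) \<zeta>"
      by (simp only: F_geom)
    then have "(\<zeta> - 1) * poly (of_int_poly F) \<zeta> = \<zeta> ^ p - 1"
      by (simp add: of_int_poly_hom.hom_mult of_int_poly_hom.hom_minus poly_monom hom_distribs algebra_simps)
    then show ?thesis using \<zeta> by simp
  qed
  define r where "r = pseudo_mod F g"
  obtain c h where c: "c \<noteq> 0" and h: "smult c F = g * h + r" and r: "r = 0 \<or> degree r < d"
    using pseudo_mod[OF g(1), of F] g(2) unfolding r_def by blast
  have "poly (of_int_poly (smult c F)) \<zeta> = poly (of_int_poly (g * h + r)) \<zeta>" by (simp only: h)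
  then have "poly (of_int_poly r) \<zeta> = 0" using F_root g_root by (simp add: hom_distribs)
  then have "r = 0" using r min by auto
  \<comment> \<open>Gauss: the multiplier \<open>c\<close> from pseudo-division can be cancelled, as \<open>g\<close> is primitive\<close>
  have "content (smult c F) = content h" using h \<open>r = 0\<close> g by (simp add: content_mult)
  then have "normalize c * content F = content h" by simp
  then have "c dvd content h" using dvd_triv_left[of "normalize c" "content F"] by simp
  then have "[:c:] dvd h" by (simp add: const_poly_dvd_iff_dvd_content)
  then obtain h' where "h = smult c h'" by (auto simp: dvd_def)
  then have "smult c F = smult c (g * h')" using h \<open>r = 0\<close> by simp
  then have F_gh: "F = g * h'" using c smult_cancel[of c F "g * h'"] by blast
  have "F \<noteq> 0" using coeff_F[of 0] p2 by auto
  then have nz: "g \<noteq> 0" "h' \<noteq> 0" using F_gh by auto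
  \<comment> \<open>the shifted polynomial has the binomial coefficients \<open>p choose (i + 1)\<close>\<close>
  define S where "S = pcompose F [:1, 1:]"
  have S: "S = pcompose g [:1,1:] * pcompose h' [:1,1:]" by (simp add: S_def F_gh pcompose_mult)
  have "pcompose [:-1, 1:] [:1,1:] = ([:0, 1:] :: int poly)" by (simp add: pcompose_pCons)
  then have "pcompose ([:-1, 1:] * F) [:1,1:] = [:0, 1:] * S"
    unfolding pcompose_mult S_def by simp
  moreover have "pcompose (monom 1 p - 1) [:1,1:] = ([:1, 1:] ^ p - 1 :: int poly)"
    by (simp add: pcompose_diff monom_altdef pcompose_hom.hom_power pcompose_pCons)
  ultimately have shift: "pCons 0 S = [:1, 1:] ^ p - 1" unfolding F_geom by simp
  have S_binom: "coeff S i = int (p choose Suc i)" for i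
  proof -
    have "coeff S i = coeff ([:1, 1:] ^ p) (Suc i)"
      using arg_cong[OF shift, of "\<lambda>q. coeff q (Suc i)"] by simp
    then show ?thesis
    proof (cases "Suc i \<le> p")
      case False
      then have "coeff ([:1, 1:] ^ p :: int poly) (Suc i) = 0"
        by (intro coeff_eq_0) (simp add: degree_linear_power)
      then show ?thesis using \<open>coeff S i = _\<close> False by (simp add: binomial_eq_0)
    qed (simp add: coeff_linear_poly_power)
  qed
  have deg_S: "degree S = p - 1" by (simp add: S_def degree_pcompose deg_F)
  have "degree (pcompose g [:1,1:]) = 0 \<or> degree (pcompose h' [:1,1:]) = 0"
  proof (rule eisenstein[OF _ S])
    show "prime (int p)" using p by simp
    show "\<not> int p dvd lead_coeff S" using p2 by (simp add: deg_S S_binom)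
    show "\<not> (int p)\<^sup>2 dvd coeff S 0"
      using p2 by (auto simp: S_binom power2_eq_square dvd_mult_cancel_left)
    fix i assume "i < degree S"
    then show "int p dvd coeff S i" 
      using dvd_choose_prime[of "Suc i" p] p by (simp add: S_binom deg_S)
  qed
  then have "d = 0 \<or> degree h' = 0" using g by (simp add: degree_pcompose)
  then have "degree h' = 0" using \<open>d > 0\<close> by simp
  then have "degree F = d" using F_gh nz g by (simp add: degree_mult_eq)
  then show False using deg_F d_less by simp
qed

lemma root_of_unity_relation:
  fixes \<zeta> :: complex and a :: "nat \<Rightarrow> int"
  assumes p: "prime p" and \<zeta>: "\<zeta> ^ p = 1" "\<zeta> \<noteq> 1"
    and 0: "(\<Sum>j<p. of_int (a j) * \<zeta> ^ j) = 0" and j: "j < p"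
  shows "a j = a (p - 1)"
proof -
  have p2: "p \<ge> 2" using p by (rule prime_ge_2_nat)
  define f where "f = (\<Sum>j<p. monom (a j - a (p - 1)) j)"
  have coeff_f: "coeff f i = (if i < p then a i - a (p - 1) else 0)" for i
    by (auto simp: f_def coeff_sum)
  have geom: "(\<Sum>j<p. \<zeta> ^ j) = 0"
    using power_diff_1_eq[of \<zeta> p] \<zeta> by simp
  have "poly (of_int_poly f) \<zeta> = (\<Sum>j<p. of_int (a j - a (p - 1)) * \<zeta> ^ j)"
    by (simp add: f_def of_int_poly_hom.hom_sum poly_sum poly_monom)
  also have "\<dots> = (\<Sum>j<p. of_int (a j) * \<zeta> ^ j) - of_int (a (p - 1)) * (\<Sum>j<p. \<zeta> ^ j)"
    by (simp add: left_diff_distrib sum_subtractf sum_distrib_left)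
  finally have "poly (of_int_poly f) \<zeta> = 0" using 0 geom by simp
  moreover have "degree f \<le> p - 2"
  proof (rule degree_le, intro allI impI)
    fix i assume "p - 2 < i"
    then have "i = p - 1 \<or> \<not> i < p" using p2 by auto
    then show "coeff f i = 0" by (auto simp: coeff_f)
  qed
  ultimately have "f = 0" using root_of_unity_relation_degree[OF p \<zeta>, of f] p2 by simp
  then show ?thesis using coeff_f[of j] j by simp
qed

lemma prime_bezout_nat:
  fixes p a :: nat
  assumes "prime p" "\<not> p dvd a"
  shows "\<exists>x y. a * x = p * y + 1"
proof -
  have "coprime a p" using assms by (metis prime_imp_coprime coprime_commute)
  moreover have "a \<noteq> 0" using assms(2) by (cases "a = 0") auto
  ultimately show ?thesis using bezout_nat[of a p] by (simp add: coprime_iff_gcd_eq_1)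
qed

lemma root_of_unity_powers:
  fixes \<zeta> :: complex
  assumes p: "prime p" and \<zeta>: "\<zeta> ^ p = 1" "\<zeta> \<noteq> 1"
  shows "bij_betw (\<lambda>j. \<zeta> ^ j) {..<p} {z. z ^ p = 1}"
proof -
  have p0: "p > 0" using p by (simp add: prime_gt_0_nat)
  have aux: False if ij: "i < j" "j < p" "\<zeta> ^ i = \<zeta> ^ j" for i j
  proof -
    have "\<zeta> \<noteq> 0" using \<zeta>(1) p0 by (auto simp: power_0_left)
    then have 1: "\<zeta> ^ (j - i) = 1" using that by (simp add: power_diff)
    have "\<not> p dvd j - i" using that by (auto dest: dvd_imp_le)
    then obtain x y where "(j - i) * x = p * y + 1" using prime_bezout_nat[OF p] by blast
    then have "\<zeta> ^ ((j - i) * x) = \<zeta> ^ (p * y + 1)" by simp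
    then show False using 1 \<zeta> by (simp add: power_mult power_add)
  qed
  have inj: "inj_on (\<lambda>j. \<zeta> ^ j) {..<p}"
  proof (rule inj_onI, rule ccontr)
    fix i j assume "i \<in> {..<p}" "j \<in> {..<p}" "\<zeta> ^ i = \<zeta> ^ j" "i \<noteq> j"
    then show False using aux[of i j] aux[of j i] by (cases "i < j") auto
  qed
  have "(\<lambda>j. \<zeta> ^ j) ` {..<p} = {z. z ^ p = 1}"
  proof (rule card_subset_eq)
    show "finite {z::complex. z ^ p = 1}" using p0 by (intro finite_roots_unity) simp
    show "(\<lambda>j. \<zeta> ^ j) ` {..<p} \<subseteq> {z. z ^ p = 1}"
    proof clarify
      fix j show "(\<zeta> ^ j) ^ p = 1" 
        using \<zeta>(1) power_mult[of \<zeta> j p] power_mult[of \<zeta> p j] by (simp add: mult.commute)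
    qed
    show "card ((\<lambda>j. \<zeta> ^ j) ` {..<p}) = card {z::complex. z ^ p = 1}"
      using card_image[OF inj] card_roots_unity_eq[OF p0] by simp
  qed
  then show ?thesis using inj by (simp add: bij_betw_def)
qed

text \<open>
  If \<open>a\<^sub>j\<close> terms equal \<open>\<zeta>\<^sup>j\<close> and the sum is the natural number \<open>t\<close>, the linear relation between
  the powers of \<open>\<zeta>\<close> yields \<open>a\<^sub>0 - t = a\<^sub>1 = \<dots> = a\<^sub>p\<^sub>-\<^sub>1\<close>, whence \<open>n = p a\<^sub>1 + t\<close>.
\<close>

lemma sum_roots_of_unity_nat:
  fixes \<mu> :: "nat \<Rightarrow> complex"
  assumes p: "prime p" and \<mu>: "\<And>i. i < n \<Longrightarrow> \<mu> i ^ p = 1"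
    and nat: "(\<Sum>i<n. \<mu> i) \<in> \<nat>" and \<zeta>: "\<zeta> ^ p = 1" "\<zeta> \<noteq> 1"
  shows "p * card {i. i < n \<and> \<mu> i = \<zeta>} \<le> n"
proof -
  have p2: "p \<ge> 2" using p by (rule prime_ge_2_nat)
  define a where "a = (\<lambda>j. card {i. i < n \<and> \<mu> i = \<zeta> ^ j})"
  note bij = root_of_unity_powers[OF p \<zeta>]
  have part: "{..<n} = (\<Union>j<p. {i. i < n \<and> \<mu> i = \<zeta> ^ j})"
  proof -
    have "\<exists>j<p. \<mu> i = \<zeta> ^ j" if "i < n" for i
    proof -
      have "\<mu> i \<in> (\<lambda>j. \<zeta> ^ j) ` {..<p}" using bij \<mu>[OF that] by (simp add: bij_betw_def)
      then show ?thesis by auto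
    qed
    then show ?thesis by auto
  qed
  have disj: "\<forall>j\<in>{..<p}. \<forall>k\<in>{..<p}. j \<noteq> k \<longrightarrow>
      {i. i < n \<and> \<mu> i = \<zeta> ^ j} \<inter> {i. i < n \<and> \<mu> i = \<zeta> ^ k} = {}"
    using bij by (auto simp: bij_betw_def inj_on_def)
  have "n = card {..<n}" by simp
  also have "\<dots> = (\<Sum>j<p. a j)"
    unfolding a_def by (subst part, rule card_UN_disjoint) (use disj in auto)
  finally have n: "n = (\<Sum>j<p. a j)" .
  have "(\<Sum>i<n. \<mu> i) = (\<Sum>j<p. \<Sum>i\<in>{i. i < n \<and> \<mu> i = \<zeta> ^ j}. \<mu> i)"
    by (subst part, rule sum.UNION_disjoint) (use disj in auto)
  also have "\<dots> = (\<Sum>j<p. of_nat (a j) * \<zeta> ^ j)" by (simp add: a_def)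
  finally have sum: "(\<Sum>i<n. \<mu> i) = (\<Sum>j<p. of_nat (a j) * \<zeta> ^ j)" .
  obtain t where t: "(\<Sum>i<n. \<mu> i) = of_nat t" using nat by (auto elim: Nats_cases)
  define b where "b = (\<lambda>j. int (a j) - (if j = 0 then int t else 0))"
  have "(\<Sum>j<p. of_int (b j) * \<zeta> ^ j) = (\<Sum>j<p. of_nat (a j) * \<zeta> ^ j) - (\<Sum>j<p. if j = 0 then of_nat t else 0)"
    unfolding b_def sum_subtractf[symmetric] by (rule sum.cong) (auto simp: algebra_simps)
  also have "\<dots> = 0" using sum t p2 by simp
  finally have b: "b j = b (p - 1)" if "j < p" for j
    using root_of_unity_relation[OF p \<zeta> _ that, of b] by simp
  have "int n = (\<Sum>j<p. b j) + (\<Sum>j<p. if j = 0 then int t else 0)"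
    unfolding n of_nat_sum sum.distrib[symmetric] by (rule sum.cong) (auto simp: b_def)
  also have "(\<Sum>j<p. b j) = (\<Sum>j<p. b (p - 1))"
    by (intro sum.cong refl b) simp
  also have "\<dots> = int p * b 1" using b[of 1] p2 by simp
  also have "b 1 = int (a 1)" by (simp add: b_def)
  finally have "int n = int (p * a 1 + t)" using p2 by simp
  then have "n = p * a 1 + t" by (rule int_int_eq[THEN iffD1])
  then show ?thesis by (simp add: a_def)
qed

section \<open>Finite p-groups\<close>

text \<open>
  Class equation: if 1 were the only central element of \<open>N\<close>, all other conjugacy classes in \<open>N\<close> would
  have size divisible by \<open>p\<close>, so \<open>card N\<close> would be 1 modulo \<open>p\<close>.
\<close>

lemma (in group) p_group_normal_meets_center:
  fixes p n :: nat
  assumes p: "prime p" and ord: "Coset.order G = p ^ n" and N: "N \<lhd> G" and nt: "N \<noteq> {\<one>}"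
  shows "\<exists>z \<in> N. z \<noteq> \<one> \<and> z \<in> group_center G"
proof (rule ccontr)
  assume neg: "\<not> ?thesis"
  define \<phi> where "\<phi> = (\<lambda>g. (\<lambda>h \<in> carrier G. g \<otimes> h \<otimes> inv g))"
  interpret act: group_action G "carrier G" \<phi>
    unfolding \<phi>_def by (rule action_by_conjugation)
  have fin: "finite (carrier G)"
    using ord prime_gt_0_nat[OF p] by (intro card_ge_0_finite) (simp add: Coset.order_def)
  have subN: "subgroup N G" using N by (rule normal_imp_subgroup)
  have NG: "N \<subseteq> carrier G" using subN by (rule subgroup.subset)
  have one_N: "\<one> \<in> N" using subN by (rule subgroup.one_closed)
  have orbit: "orbit G \<phi> x = {g \<otimes> x \<otimes> inv g | g. g \<in> carrier G}" if "x \<in> carrier G" for x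
    using that by (auto simp: orbit_def \<phi>_def)
  have orbit_one: "orbit G \<phi> \<one> = {\<one>}" by (auto simp: orbit intro!: exI[of _ \<one>])
  define C where "C = orbit G \<phi> ` N"
  have C_orbits: "C \<subseteq> orbits G (carrier G) \<phi>" using NG by (auto simp: C_def orbits_def)
  have sub: "orbit G \<phi> x \<subseteq> N" if "x \<in> N" for x
    using that NG normal.inv_op_closed2[OF N] orbit[OF subsetD[OF NG that]] by auto
  have self: "x \<in> orbit G \<phi> x" if "x \<in> N" for x using act.orbit_refl that NG by blast
  have UN: "\<Union>C = N" unfolding C_def using sub self by blast
  have disj: "A \<inter> B = {}" if "A \<in> C" "B \<in> C" "A \<noteq> B" for A B
    using act.disjoint_union[of A B] that C_orbits by blast
  have p_dvd: "p dvd card A" if A: "A \<in> C" "A \<noteq> {\<one>}" for A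
  proof -
    obtain x where x: "x \<in> N" "A = orbit G \<phi> x" using A(1) by (auto simp: C_def)
    then have xG: "x \<in> carrier G" using NG by auto
    have "p ^ n = card A * card (stabilizer G \<phi> x)"
      using act.orbit_stabilizer_theorem[OF xG] ord x by simp
    then have "card A dvd p ^ n" by (rule dvdI)
    then obtain i where i: "card A = p ^ i" using p by (auto simp: divides_primepow_nat)
    have "i \<noteq> 0"
    proof
      assume "i = 0"
      then have "card A = 1" using i by simp
      moreover have "x \<in> A" using act.orbit_refl[OF xG] x by simp
      ultimately have Ax: "A = {x}" by (auto simp: card_1_singleton_iff)
      have "x \<otimes> g = g \<otimes> x" if g: "g \<in> carrier G" for g
      proof -
        have "g \<otimes> x \<otimes> inv g = x" using Ax x(2) orbit[OF xG] g by auto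
        then show ?thesis using g xG inv_solve_right[of x "g \<otimes> x" g] by simp
      qed
      then have "x \<in> group_center G" using xG by (simp add: group_center_def)
      then have "x = \<one>" using neg x(1) by blast
      then show False using A(2) Ax by simp
    qed
    then show ?thesis using i by simp
  qed
  have finN: "finite N" using fin NG finite_subset by blast
  have one_C: "{\<one>} \<in> C" unfolding C_def using one_N orbit_one by (metis imageI)
  have finC: "finite C" using finN by (simp add: C_def)
  have "card (\<Union>C) = (\<Sum>A\<in>C. card A)"
  proof (rule card_Union_disjoint)
    show "pairwise disjnt C" using disj by (simp add: pairwise_def disjnt_def)
    show "finite A" if "A \<in> C" for A
      using that UN finN finite_subset[of A N] by blast
  qed
  then have "card N = (\<Sum>A\<in>C. card A)" unfolding UN .
  also have "\<dots> = 1 + (\<Sum>A\<in>C - {{\<one>}}. card A)"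
    using sum.remove[OF finC one_C, of card] by simp
  finally have eq: "card N = 1 + (\<Sum>A\<in>C - {{\<one>}}. card A)" .
  have "p ^ n = card N * card (rcosets N)" using lagrange[OF subN] ord by (simp add: mult.commute)
  then have "card N dvd p ^ n" by (rule dvdI)
  then obtain i where i: "card N = p ^ i" using p by (auto simp: divides_primepow_nat)
  moreover have "card N \<noteq> 1" using nt one_N by (auto simp: card_1_singleton_iff)
  ultimately have "p dvd card N" by (cases i) auto
  moreover have "p dvd (\<Sum>A\<in>C - {{\<one>}}. card A)" using p_dvd by (intro dvd_sum) auto
  ultimately have "p dvd 1" using eq dvd_add_left_iff[of p "\<Sum>A\<in>C - {{\<one>}}. card A" 1] by simp
  then show False using p by simp
qed

text \<open>
  The quotient by \<open>K\<close> is a nontrivial \<open>p\<close>-group, so it has a nontrivial centre.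
\<close>

lemma (in group) p_group_central_mod_normal:
  fixes p n :: nat
  assumes p: "prime p" and ord: "Coset.order G = p ^ n" and K: "K \<lhd> G" and nt: "K \<noteq> carrier G"
  shows "\<exists>x \<in> carrier G - K. \<forall>g \<in> carrier G. \<exists>k \<in> K. g \<otimes> x = k \<otimes> (x \<otimes> g)"
proof -
  interpret K: normal K G by fact
  interpret Q: group "G Mod K" by (rule K.factorgroup_is_group)
  have KG: "K \<subseteq> carrier G" by (rule K.subset)
  have "Coset.order (G Mod K) * card K = p ^ n"
    using lagrange[OF normal_imp_subgroup[OF K]] ord by (simp add: Coset.order_def FactGroup_def)
  then have "Coset.order (G Mod K) dvd p ^ n" by (intro dvdI) (rule sym)
  then obtain i where ordQ: "Coset.order (G Mod K) = p ^ i" using p by (auto simp: divides_primepow_nat)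
  have "carrier (G Mod K) \<noteq> {\<one>\<^bsub>G Mod K\<^esub>}"
  proof
    assume "carrier (G Mod K) = {\<one>\<^bsub>G Mod K\<^esub>}"
    then have "\<forall>x\<in>carrier G. K #> x = K" by (auto simp: FactGroup_def RCOSETS_def)
    then have "x \<in> K" if "x \<in> carrier G" for x
      using that rcos_self[OF that normal_imp_subgroup[OF K]] by simp
    then show False using nt KG by blast
  qed
  then obtain X where X: "X \<in> carrier (G Mod K)" "X \<noteq> \<one>\<^bsub>G Mod K\<^esub>" "X \<in> group_center (G Mod K)"
    using Q.p_group_normal_meets_center[OF p ordQ Q.normal_self] by blast
  then obtain x where x: "x \<in> carrier G" "X = K #> x" by (auto simp: FactGroup_def RCOSETS_def)
  have "x \<notin> K"
  proof
    assume "x \<in> K"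
    then have "X = K" using x K.rcos_const[OF is_group] by simp
    then show False using X by (simp add: FactGroup_def)
  qed
  moreover have "\<exists>k \<in> K. g \<otimes> x = k \<otimes> (x \<otimes> g)" if g: "g \<in> carrier G" for g
  proof -
    have gQ: "K #> g \<in> carrier (G Mod K)" using g by (auto simp: FactGroup_def RCOSETS_def)
    then have "X \<otimes>\<^bsub>G Mod K\<^esub> (K #> g) = (K #> g) \<otimes>\<^bsub>G Mod K\<^esub> X"
      using X(3) by (simp add: group_center_def)
    then have "K #> (x \<otimes> g) = K #> (g \<otimes> x)"
      using g x by (simp add: FactGroup_def K.rcos_sum)
    moreover have "g \<otimes> x \<in> K #> (g \<otimes> x)" using g x by (intro rcos_self normal_imp_subgroup[OF K]) auto
    ultimately have "g \<otimes> x \<in> K #> (x \<otimes> g)" by simp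
    then show ?thesis by (auto simp: r_coset_def)
  qed
  ultimately show ?thesis using x by blast
qed

lemma (in group) subgroup_pow:
  assumes "subgroup H G" "x \<in> H"
  shows "x [^] (k::nat) \<in> H"
  using assms by (induction k) (auto intro: subgroup.one_closed subgroup.m_closed)

lemma (in group) generate_insert_central:
  assumes T: "subgroup T G" and s: "s \<in> group_center G" and y: "y \<in> generate G (insert s T)"
    and per: "s [^] p = \<one>" "0 < (p::nat)"
  shows "\<exists>t \<in> T. \<exists>a::nat. y = t \<otimes> s [^] a"
proof -
  have sG: "s \<in> carrier G" and comm: "\<And>g. g \<in> carrier G \<Longrightarrow> s \<otimes> g = g \<otimes> s"
    using s by (auto simp: group_center_def)
  have TG: "T \<subseteq> carrier G" using T by (rule subgroup.subset)
  have pow_comm: "s [^] (a::nat) \<otimes> g = g \<otimes> s [^] a" if "g \<in> carrier G" for g a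
    using that comm sG group_commutes_pow[of s g a] by simp
  from y show ?thesis
  proof (induction rule: generate.induct)
    case one
    then show ?case using subgroup.one_closed[OF T] by (intro bexI[of _ \<one>] exI[of _ 0]) auto
  next
    case (incl h)
    then show ?case
    proof
      assume "h = s"
      then show ?thesis using subgroup.one_closed[OF T] sG by (intro bexI[of _ \<one>] exI[of _ 1]) auto
    next
      assume "h \<in> T"
      then show ?thesis using TG by (intro bexI[of _ h] exI[of _ 0]) auto
    qed
  next
    case (inv h)
    then show ?case
    proof
      assume h: "h = s"
      have "s [^] (p - 1) \<otimes> s = \<one>" using per nat_pow_Suc[of s "p - 1"] by simp
      then have "inv s = s [^] (p - 1)" using sG by (intro inv_equality) auto
      then have "inv h = \<one> \<otimes> s [^] (p - 1)" unfolding h using sG by simp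
      then show ?thesis using subgroup.one_closed[OF T] by blast
    next
      assume "h \<in> T"
      then show ?thesis using TG subgroup.m_inv_closed[OF T]
        by (intro bexI[of _ "inv h"] exI[of _ 0]) auto
    qed
  next
    case (eng h1 h2)
    then obtain t1 a1 t2 a2 where t: "t1 \<in> T" "t2 \<in> T" and h: "h1 = t1 \<otimes> s [^] (a1::nat)" "h2 = t2 \<otimes> s [^] (a2::nat)"
      by blast
    have tG: "t1 \<in> carrier G" "t2 \<in> carrier G" using t TG by auto
    have "h1 \<otimes> h2 = t1 \<otimes> (s [^] a1 \<otimes> t2) \<otimes> s [^] a2" using h tG sG by (simp add: m_assoc)
    also have "\<dots> = t1 \<otimes> t2 \<otimes> s [^] (a1 + a2)"
      unfolding pow_comm[OF tG(2)] using tG sG by (simp add: m_assoc nat_pow_mult)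
    finally show ?case using subgroup.m_closed[OF T t] by blast
  qed
qed

lemma (in group) subgroup_group_center: "subgroup (group_center G) G"
proof (rule subgroupI)
  show "group_center G \<subseteq> carrier G" by (auto simp: group_center_def)
  have "\<one> \<in> group_center G" by (auto simp: group_center_def)
  then show "group_center G \<noteq> {}" by blast
next
  fix a assume "a \<in> group_center G"
  then have a: "a \<in> carrier G" "\<And>g. g \<in> carrier G \<Longrightarrow> a \<otimes> g = g \<otimes> a" by (auto simp: group_center_def)
  have "inv a \<otimes> g = g \<otimes> inv a" if "g \<in> carrier G" for g
  proof -
    have "inv (a \<otimes> inv g) = inv (inv g \<otimes> a)" using a(2)[of "inv g"] that by simp
    then show ?thesis using a(1) that by (simp add: inv_mult_group)
  qed
  then show "inv a \<in> group_center G" using a by (auto simp: group_center_def)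
next
  fix a b assume "a \<in> group_center G" "b \<in> group_center G"
  then have ab: "a \<in> carrier G" "b \<in> carrier G" "\<And>g. g \<in> carrier G \<Longrightarrow> a \<otimes> g = g \<otimes> a"
    "\<And>g. g \<in> carrier G \<Longrightarrow> b \<otimes> g = g \<otimes> b" by (auto simp: group_center_def)
  have "a \<otimes> b \<otimes> g = g \<otimes> (a \<otimes> b)" if g: "g \<in> carrier G" for g
  proof -
    have "a \<otimes> b \<otimes> g = a \<otimes> (g \<otimes> b)" using ab(1,2) ab(4)[OF g] g by (simp add: m_assoc)
    also have "\<dots> = g \<otimes> a \<otimes> b" using ab(1,2) ab(3)[OF g] g by (simp add: m_assoc[symmetric])
    finally show ?thesis using ab(1,2) g by (simp add: m_assoc)
  qed
  with ab(1,2) show "a \<otimes> b \<in> group_center G" by (simp add: group_center_def)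
qed

text \<open>
  Induction on \<open>S\<close>. When \<open>s\<close> is new, one subgroup \<open>H\<close> that contains the subgroup \<open>T\<close> generated so far
  but not \<open>s\<close> is enough: an element \<open>t s\<^sup>a\<close> of \<open>H\<close> has \<open>s\<^sup>a \<in> H\<close>, and as \<open>s\<close> has prime order this
  forces \<open>s\<^sup>a = 1\<close>. Hence the number of subgroups does not exceed the number of generators.
\<close>

lemma (in group) separating_family:
  fixes p :: nat
  assumes p: "prime p" and per: "\<And>s. s \<in> group_center G \<Longrightarrow> s [^] p = \<one>"
    and sep: "\<And>T s. subgroup T G \<Longrightarrow> T \<subseteq> group_center G \<Longrightarrow> s \<in> group_center G - T \<Longrightarrow>
                \<exists>H \<in> \<H>. subgroup H G \<and> T \<subseteq> H \<and> s \<notin> H"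
    and S: "finite S" "S \<subseteq> group_center G"
  shows "\<exists>Hs. finite Hs \<and> Hs \<subseteq> \<H> \<and> (\<forall>H\<in>Hs. subgroup H G) \<and> card Hs \<le> card S \<and> generate G S \<inter> \<Inter>Hs \<subseteq> {\<one>}"
  using S
proof (induction S rule: finite_induct)
  case empty
  then show ?case by (intro exI[of _ "{}"]) (auto simp: generate_empty)
next
  case (insert s S)
  have s: "s \<in> group_center G" and SZ: "S \<subseteq> group_center G" using insert by auto
  have ZG: "group_center G \<subseteq> carrier G" by (auto simp: group_center_def)
  define T where "T = generate G S"
  have T: "subgroup T G" unfolding T_def using SZ ZG by (intro generate_is_subgroup) auto
  have TZ: "T \<subseteq> group_center G" unfolding T_def using generate_subgroup_incl[OF SZ subgroup_group_center] .
  have ST: "S \<subseteq> T" unfolding T_def by (auto intro: generate.incl)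
  have gen: "generate G (insert s S) \<subseteq> generate G (insert s T)"
    using ST by (intro mono_generate) auto
  obtain Hs where Hs: "finite Hs" "Hs \<subseteq> \<H>" "\<forall>H\<in>Hs. subgroup H G" "card Hs \<le> card S" "T \<inter> \<Inter>Hs \<subseteq> {\<one>}"
    using insert.IH[OF SZ, folded T_def] by (elim exE conjE) (rule that)
  show ?case
  proof (cases "s \<in> T")
    case True
    then have "generate G (insert s S) \<subseteq> T" using ST T by (intro generate_subgroup_incl) auto
    then show ?thesis using Hs insert.hyps by (intro exI[of _ Hs]) auto
  next
    case False
    then obtain H where H: "H \<in> \<H>" "subgroup H G" "T \<subseteq> H" "s \<notin> H" using sep[OF T TZ, of s] s False by blast
    have "y \<in> T" if y: "y \<in> generate G (insert s S)" "y \<in> H" for y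
    proof -
      have sG: "s \<in> carrier G" using s ZG by auto
      obtain t a where t: "t \<in> T" "y = t \<otimes> s [^] (a::nat)"
        using generate_insert_central[OF T s _ per[OF s] prime_gt_0_nat[OF p], of y] y gen by blast
      have tG: "t \<in> carrier G" using t TZ ZG by auto
      have "s [^] a = inv t \<otimes> y" using t tG sG by (simp add: m_assoc[symmetric])
      then have saH: "s [^] a \<in> H"
        using H(3) t(1) y(2) subgroup.m_closed[OF H(2)] subgroup.m_inv_closed[OF H(2)] by auto
      have "p dvd a"
      proof (rule ccontr)
        assume "\<not> p dvd a"
        then obtain x y where xy: "a * x = p * y + 1" using prime_bezout_nat[OF p] by blast
        have "(s [^] a) [^] x = s [^] (p * y + 1)" using sG xy by (simp add: nat_pow_pow)
        also have "\<dots> = (s [^] p) [^] y \<otimes> s" using sG by (simp add: nat_pow_pow nat_pow_mult[symmetric])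
        also have "\<dots> = s" using per[OF s] sG by simp
        finally have "s \<in> H" using subgroup_pow[OF H(2) saH, of x] by simp
        then show False using H(4) by blast
      qed
      then obtain k where "a = p * k" by (auto simp: dvd_def)
      then have "s [^] a = \<one>" using per[OF s] sG by (simp add: nat_pow_pow[symmetric])
      then show ?thesis using t tG by simp
    qed
    then have "generate G (insert s S) \<inter> \<Inter>(insert H Hs) \<subseteq> {\<one>}" using Hs(5) by auto
    moreover have "card (insert H Hs) \<le> card (insert s S)"
      using Hs(1,4) insert.hyps card_insert_le_m1[of "card (insert s S)" Hs H] by (simp add: card_insert_if)
    ultimately show ?thesis using Hs H by (intro exI[of _ "insert H Hs"]) auto
  qed
qed

section \<open>Linear characters and direct factors\<close>

text \<open>
  The factors of a direct decomposition are demanded as plain monoid records, whereas \<open>G\<close> may carry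
  further record fields.
\<close>

lemma (in group) subgroup_as_monoid:
  assumes "subgroup H G"
  shows "group \<lparr>carrier = H, monoid.mult = (\<otimes>), one = \<one>\<rparr>"
proof (rule groupI)
  fix x assume "x \<in> carrier \<lparr>carrier = H, monoid.mult = (\<otimes>), one = \<one>\<rparr>"
  then show "\<exists>y\<in>carrier \<lparr>carrier = H, monoid.mult = (\<otimes>), one = \<one>\<rparr>.
      y \<otimes>\<^bsub>\<lparr>carrier = H, monoid.mult = (\<otimes>), one = \<one>\<rparr>\<^esub> x = \<one>\<^bsub>\<lparr>carrier = H, monoid.mult = (\<otimes>), one = \<one>\<rparr>\<^esub>"
    using assms subgroup.m_inv_closed[OF assms] subgroup.mem_carrier[OF assms]
    by (intro bexI[of _ "inv x"]) auto
qed (use subgroup.m_closed[OF assms] subgroup.one_closed[OF assms] subgroup.mem_carrier[OF assms]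
     in \<open>auto simp: m_assoc\<close>)

text \<open>
  A linear character that is nontrivial at a central element \<open>z\<close> maps the cyclic group \<open>A\<close> generated by
  \<open>z\<close> isomorphically onto the \<open>p\<close>-th roots of unity. So \<open>A\<close> and the kernel \<open>B\<close> of the character
  intersect trivially and generate \<open>G\<close>; as \<open>A\<close> is central, \<open>G\<close> is their direct product, and \<open>B\<close> is
  not abelian because \<open>G\<close> is not.
\<close>

lemma (in group) linear_character_direct_factor:
  fixes lam :: "'a \<Rightarrow> complex" and p :: nat
  assumes p: "prime p" and per: "\<And>x. x \<in> carrier G \<Longrightarrow> x [^] p = \<one>"
    and mult: "\<And>x y. x \<in> carrier G \<Longrightarrow> y \<in> carrier G \<Longrightarrow> lam (x \<otimes> y) = lam x * lam y"
    and one: "lam \<one> = 1"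
    and z: "z \<in> group_center G" "lam z \<noteq> 1" and nc: "\<not> comm_group G"
  shows "has_abelian_direct_factor G"
proof -
  have zG: "z \<in> carrier G" and zc: "\<And>g. g \<in> carrier G \<Longrightarrow> z \<otimes> g = g \<otimes> z"
    using z(1) by (auto simp: group_center_def)
  have lam_pow: "lam (x [^] (k::nat)) = lam x ^ k" if "x \<in> carrier G" for x k
    using that by (induction k) (auto simp: one mult mult.commute)
  have lam_root: "lam x ^ p = 1" if "x \<in> carrier G" for x
    using lam_pow[OF that, of p] per[OF that] one by simp
  have lam_inv: "lam x * lam (inv x) = 1" if "x \<in> carrier G" for x
    using mult[OF that inv_closed[OF that]] that one by simp
  define A where "A = range (\<lambda>i::nat. z [^] i)"
  define B where "B = {x \<in> carrier G. lam x = 1}"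
  have A_center: "A \<subseteq> group_center G"
    using subgroup_pow[OF subgroup_group_center z(1)] by (auto simp: A_def)
  have AG: "A \<subseteq> carrier G" using A_center by (auto simp: group_center_def)
  have A_comm: "a \<otimes> g = g \<otimes> a" if "a \<in> A" "g \<in> carrier G" for a g
    using A_center that by (auto simp: group_center_def)
  have BG: "B \<subseteq> carrier G" by (auto simp: B_def)
  have inv_z: "inv z = z [^] (p - 1)"
  proof (rule inv_equality)
    show "z [^] (p - 1) \<otimes> z = \<one>"
      using per[OF zG] nat_pow_Suc[of z "p - 1"] prime_gt_0_nat[OF p] by simp
  qed (use zG in auto)
  have subA: "subgroup A G"
  proof (rule subgroupI)
    fix a b assume "a \<in> A" "b \<in> A"
    then show "a \<otimes> b \<in> A" using zG by (auto simp: A_def nat_pow_mult)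
  next
    fix a assume "a \<in> A"
    then obtain i :: nat where i: "a = z [^] i" by (auto simp: A_def)
    have "inv a = (z [^] (p - 1)) [^] i" using i zG nat_pow_inv[OF zG, of i] inv_z by simp
    then show "inv a \<in> A" using zG by (auto simp: A_def nat_pow_pow)
  qed (use AG in \<open>auto simp: A_def\<close>)
  have subB: "subgroup B G"
  proof (rule subgroupI)
    show "B \<noteq> {}" using one by (auto simp: B_def)
    fix a assume a: "a \<in> B"
    then show "inv a \<in> B" using lam_inv[of a] by (auto simp: B_def)
  qed (auto simp: B_def mult)
  have AB: "a = \<one>" if a: "a \<in> A" "a \<in> B" for a
  proof -
    obtain i :: nat where i: "a = z [^] i" using a(1) by (auto simp: A_def)
    have "p dvd i"
    proof (rule ccontr)
      assume "\<not> p dvd i"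
      then obtain x y where xy: "i * x = p * y + 1" using prime_bezout_nat[OF p] by blast
      have "1 = (lam z ^ i) ^ x" using a(2) i lam_pow[OF zG] by (simp add: B_def)
      also have "\<dots> = lam z ^ (p * y + 1)" by (simp only: power_mult[symmetric] xy)
      also have "\<dots> = lam z" using lam_root[OF zG] by (simp add: power_add power_mult)
      finally show False using z(2) by simp
    qed
    then obtain k where "i = p * k" by (auto simp: dvd_def)
    then show ?thesis using i per[OF zG] zG by (simp add: nat_pow_pow[symmetric])
  qed
  have decomp: "\<exists>a\<in>A. \<exists>b\<in>B. x = a \<otimes> b" if x: "x \<in> carrier G" for x
  proof -
    have "lam x \<in> (\<lambda>j. lam z ^ j) ` {..<p}"
      using root_of_unity_powers[OF p lam_root[OF zG] z(2)] lam_root[OF x] by (simp add: bij_betw_def)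
    then obtain j where j: "lam x = lam z ^ j" by blast
    define a where "a = z [^] j"
    have a: "a \<in> A" by (auto simp: a_def A_def)
    then have aG: "a \<in> carrier G" using AG by auto
    have "lam a = lam x" using j lam_pow[OF zG] by (simp add: a_def)
    then have "lam (inv a \<otimes> x) = 1" using aG x lam_inv[OF aG] by (simp add: mult mult.commute)
    then have "inv a \<otimes> x \<in> B" using aG x by (simp add: B_def)
    moreover have "x = a \<otimes> (inv a \<otimes> x)" using aG x by (simp add: m_assoc[symmetric])
    ultimately show ?thesis using a by blast
  qed
  define A' where "A' = \<lparr>carrier = A, monoid.mult = (\<otimes>), one = \<one>\<rparr>"
  define B' where "B' = \<lparr>carrier = B, monoid.mult = (\<otimes>), one = \<one>\<rparr>"
  have grpA: "group A'" unfolding A'_def by (rule subgroup_as_monoid[OF subA])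
  have grpB: "group B'" unfolding B'_def by (rule subgroup_as_monoid[OF subB])
  have "comm_group A'"
    by (rule group.group_comm_groupI[OF grpA]) (use A_comm AG in \<open>auto simp: A'_def\<close>)
  moreover have "\<not> trivial_group A'"
  proof
    assume "trivial_group A'"
    then have "A = {\<one>}" by (simp add: trivial_group_def A'_def)
    moreover have "z \<in> A" unfolding A_def using zG by (intro range_eqI[of _ _ 1]) simp
    ultimately show False using z(2) one by simp
  qed
  moreover have swap: "a \<otimes> b \<otimes> (a' \<otimes> b') = a \<otimes> a' \<otimes> (b \<otimes> b')"
    if "a \<in> A" "a' \<in> A" "b \<in> B" "b' \<in> B" for a b a' b'
  proof -
    have G: "a \<in> carrier G" "a' \<in> carrier G" "b \<in> carrier G" "b' \<in> carrier G" using that AG BG by auto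
    have "a \<otimes> b \<otimes> (a' \<otimes> b') = a \<otimes> (b \<otimes> a') \<otimes> b'" using G by (simp add: m_assoc)
    also have "b \<otimes> a' = a' \<otimes> b" using A_comm[OF that(2) G(3)] by simp
    finally show ?thesis using G by (simp add: m_assoc)
  qed
  moreover have "\<not> comm_group B'"
  proof
    assume "comm_group B'"
    then have B_comm: "b \<otimes> b' = b' \<otimes> b" if "b \<in> B" "b' \<in> B" for b b'
      using that comm_groupE(4)[of B' b b'] by (simp add: B'_def)
    have "comm_group G"
    proof (rule group_comm_groupI)
      fix x y assume "x \<in> carrier G" "y \<in> carrier G"
      then obtain a b a' b' where ab: "a \<in> A" "b \<in> B" "x = a \<otimes> b" "a' \<in> A" "b' \<in> B" "y = a' \<otimes> b'"
        using decomp[of x] decomp[of y] by blast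
      have "x \<otimes> y = a \<otimes> a' \<otimes> (b \<otimes> b')"
        unfolding ab(3,6) by (rule swap[OF ab(1,4,2,5)])
      also have "a \<otimes> a' = a' \<otimes> a" using A_comm[OF ab(1)] AG ab(4) by blast
      also have "b \<otimes> b' = b' \<otimes> b" by (rule B_comm[OF ab(2,5)])
      also have "a' \<otimes> a \<otimes> (b' \<otimes> b) = y \<otimes> x"
        unfolding ab(3,6) by (rule swap[OF ab(4,1,5,2), symmetric])
      finally show "x \<otimes> y = y \<otimes> x" .
    qed
    then show False using nc by blast
  qed
  moreover have "G \<cong> A' \<times>\<times> B'"
  proof -
    interpret S: group_disjoint_sum G A B by (intro group_disjoint_sum.intro is_group subA subB)
    have "A \<inter> B = {\<one>}" using AB subgroup.one_closed[OF subA] subgroup.one_closed[OF subB] by blast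
    moreover have "A <#> B = carrier G"
    proof
      show "A <#> B \<subseteq> carrier G" using AG BG by (auto simp: set_mult_def)
      show "carrier G \<subseteq> A <#> B" using decomp unfolding set_mult_def by blast
    qed
    moreover have "\<forall>x\<in>A. \<forall>y\<in>B. x \<otimes> y = y \<otimes> x"
    proof (intro ballI)
      fix x y assume "x \<in> A" "y \<in> B"
      then show "x \<otimes> y = y \<otimes> x" using BG by (intro A_comm) auto
    qed
    ultimately have "(\<lambda>(x, y). x \<otimes> y) \<in> iso (subgroup_generated G A \<times>\<times> subgroup_generated G B) G"
      unfolding S.iso_group_mul_alt by blast
    then have "(\<lambda>(x, y). x \<otimes> y) \<in> iso (A' \<times>\<times> B') G"
      using subgroup.carrier_subgroup_generated_subgroup[OF subA] subgroup.carrier_subgroup_generated_subgroup[OF subB]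
      by (simp add: iso_def hom_def DirProd_def A'_def B'_def)
    then show ?thesis using group.iso_sym[OF DirProd_group[OF grpA grpB]] is_isoI by blast
  qed
  ultimately show ?thesis
    unfolding has_abelian_direct_factor_def using grpB by (intro exI[of _ A'] exI[of _ B']) blast
qed

section \<open>Dual families of characters\<close>

lemma (in comm_group) multiplicative_finprod:
  fixes \<chi> :: "'a \<Rightarrow> complex"
  assumes mult: "\<And>x y. x \<in> carrier G \<Longrightarrow> y \<in> carrier G \<Longrightarrow> \<chi> (x \<otimes> y) = \<chi> x * \<chi> y"
    and one: "\<chi> \<one> = 1" and S: "finite S" "f \<in> S \<rightarrow> carrier G"
  shows "\<chi> (finprod G f S) = (\<Prod>s\<in>S. \<chi> (f s))"
  using S
proof (induction S rule: finite_induct)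
  case (insert s S)
  have f: "f \<in> S \<rightarrow> carrier G" "f s \<in> carrier G" using insert.prems by auto
  have "\<chi> (finprod G f (insert s S)) = \<chi> (f s) * \<chi> (finprod G f S)"
    using finprod_insert[OF insert.hyps f] mult f finprod_closed[OF f(1)] by simp
  then show ?case using insert.IH[OF f(1)] insert.hyps by simp
qed (simp add: one)

lemma (in comm_group) finprod_in_subgroup:
  assumes H: "subgroup H G" and S: "finite S" "f \<in> S \<rightarrow> H"
  shows "finprod G f S \<in> H"
  using S
proof (induction S rule: finite_induct)
  case (insert s S)
  have f: "f \<in> S \<rightarrow> H" "f s \<in> H" using insert.prems by auto
  have fG: "f \<in> S \<rightarrow> carrier G" "f s \<in> carrier G" using f subgroup.mem_carrier[OF H] by auto
  show ?case
    using finprod_insert[OF insert.hyps fG] subgroup.m_closed[OF H f(2) insert.IH[OF f(1)]] by simp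
qed (simp add: subgroup.one_closed[OF H])

text \<open>
  Take a separating subfamily with the fewest members. Dropping one member \<open>\<psi>\<close> destroys separation, so
  there is an element killed by all others but not by \<open>\<psi>\<close>; a power of it has \<open>\<psi>\<close>-value \<open>\<zeta>\<close>. These dual
  elements generate the group, because every element agrees under all members with a product of
  powers of dual elements.
\<close>

lemma (in comm_group) dual_family:
  fixes \<Lambda> :: "('a \<Rightarrow> complex) set" and \<zeta> :: complex and p :: nat
  assumes p: "prime p" and fin: "finite (carrier G)"
    and per: "\<And>x. x \<in> carrier G \<Longrightarrow> x [^] p = \<one>"
    and mult: "\<And>\<chi> x y. \<chi> \<in> \<Lambda> \<Longrightarrow> x \<in> carrier G \<Longrightarrow> y \<in> carrier G \<Longrightarrow> \<chi> (x \<otimes> y) = \<chi> x * \<chi> y"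
    and one: "\<And>\<chi>. \<chi> \<in> \<Lambda> \<Longrightarrow> \<chi> \<one> = 1"
    and sep: "\<And>z. z \<in> carrier G \<Longrightarrow> z \<noteq> \<one> \<Longrightarrow> \<exists>\<chi>\<in>\<Lambda>. \<chi> z \<noteq> 1"
    and \<zeta>: "\<zeta> ^ p = 1" "\<zeta> \<noteq> 1"
  shows "\<exists>\<Lambda>' d z. \<Lambda>' \<subseteq> \<Lambda> \<and> finite \<Lambda>' \<and> min_generators G \<le> card \<Lambda>' \<and>
     (\<forall>\<chi>\<in>\<Lambda>'. d \<chi> \<in> carrier G) \<and> (\<forall>\<chi>\<in>\<Lambda>'. \<forall>\<psi>\<in>\<Lambda>'. \<chi> (d \<psi>) = (if \<chi> = \<psi> then \<zeta> else 1)) \<and>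
     z \<in> carrier G \<and> (\<forall>\<chi>\<in>\<Lambda>'. \<chi> z = \<zeta>)"
proof -
  define Sep where "Sep = (\<lambda>L. finite L \<and> L \<subseteq> \<Lambda> \<and> (\<forall>z\<in>carrier G. z \<noteq> \<one> \<longrightarrow> (\<exists>\<chi>\<in>L. \<chi> z \<noteq> 1)))"
  obtain c where c: "\<And>z. z \<in> carrier G \<Longrightarrow> z \<noteq> \<one> \<Longrightarrow> c z \<in> \<Lambda> \<and> c z z \<noteq> 1"
    using sep by metis
  have "Sep (c ` (carrier G - {\<one>}))" using c fin by (auto simp: Sep_def)
  then obtain L where L: "Sep L" and min: "\<And>L'. Sep L' \<Longrightarrow> card L \<le> card L'"
    using ex_has_least_nat[of Sep _ card] by blast
  have finL: "finite L" and LL: "L \<subseteq> \<Lambda>" using L by (auto simp: Sep_def)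
  have chi_pow: "\<chi> (x [^] (k::nat)) = \<chi> x ^ k" if "\<chi> \<in> L" "x \<in> carrier G" for \<chi> x k
    using that LL by (induction k) (auto simp: one mult mult.commute)
  have chi_root: "\<chi> x ^ p = 1" if "\<chi> \<in> L" "x \<in> carrier G" for \<chi> x
    using chi_pow[OF that, of p] per[OF that(2)] one[of \<chi>] that(1) LL by auto
  have "\<exists>d\<in>carrier G. \<psi> d = \<zeta> \<and> (\<forall>\<chi>\<in>L - {\<psi>}. \<chi> d = 1)" if \<psi>: "\<psi> \<in> L" for \<psi>
  proof -
    have "\<not> Sep (L - {\<psi>})" using min[of "L - {\<psi>}"] card_Diff1_less[OF finL \<psi>] by auto
    then obtain y where y: "y \<in> carrier G" "y \<noteq> \<one>" "\<forall>\<chi>\<in>L - {\<psi>}. \<chi> y = 1"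
      using finL LL by (auto simp: Sep_def)
    then have "\<psi> y \<noteq> 1" using L by (auto simp: Sep_def)
    then have "\<zeta> \<in> (\<lambda>j. \<psi> y ^ j) ` {..<p}"
      using root_of_unity_powers[OF p chi_root[OF \<psi> y(1)]] \<zeta>(1) by (simp add: bij_betw_def)
    then obtain j where j: "\<zeta> = \<psi> y ^ j" by blast
    have "\<forall>\<chi>\<in>L - {\<psi>}. \<chi> (y [^] j) = 1"
    proof
      fix \<chi> assume \<chi>: "\<chi> \<in> L - {\<psi>}"
      then have "\<chi> (y [^] j) = \<chi> y ^ j" by (intro chi_pow y(1)) simp
      also have "\<chi> y = 1" using bspec[OF y(3) \<chi>] .
      finally show "\<chi> (y [^] j) = 1" by simp
    qed
    moreover have "\<psi> (y [^] j) = \<zeta>" unfolding j by (rule chi_pow[OF \<psi> y(1)])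
    ultimately show ?thesis using nat_pow_closed[OF y(1)] by (intro bexI[of _ "y [^] j"]) blast+
  qed
  then have "\<forall>\<psi>\<in>L. \<exists>d. d \<in> carrier G \<and> \<psi> d = \<zeta> \<and> (\<forall>\<chi>\<in>L - {\<psi>}. \<chi> d = 1)" by blast
  then obtain d where d': "\<forall>\<psi>\<in>L. d \<psi> \<in> carrier G \<and> \<psi> (d \<psi>) = \<zeta> \<and> (\<forall>\<chi>\<in>L - {\<psi>}. \<chi> (d \<psi>) = 1)"
    by (rule bchoice[THEN exE])
  have d: "d \<psi> \<in> carrier G \<and> \<psi> (d \<psi>) = \<zeta> \<and> (\<forall>\<chi>\<in>L - {\<psi>}. \<chi> (d \<psi>) = 1)"
    if "\<psi> \<in> L" for \<psi> using bspec[OF d' that] .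
  have dual: "\<chi> (d \<psi>) = (if \<chi> = \<psi> then \<zeta> else 1)" if "\<chi> \<in> L" "\<psi> \<in> L" for \<chi> \<psi>
    using d[OF that(2)] that by auto
  have dG: "d \<in> L \<rightarrow> carrier G" using d by auto
  have prod: "\<chi> (finprod G (\<lambda>\<psi>. d \<psi> [^] (a \<psi> :: nat)) L) = \<zeta> ^ a \<chi>" if \<chi>: "\<chi> \<in> L" for \<chi> a
  proof -
    have "\<chi> (finprod G (\<lambda>\<psi>. d \<psi> [^] a \<psi>) L) = (\<Prod>\<psi>\<in>L. \<chi> (d \<psi> [^] a \<psi>))"
      using \<chi> LL dG by (intro multiplicative_finprod mult one finL) auto
    also have "\<dots> = (\<Prod>\<psi>\<in>L. if \<psi> = \<chi> then \<zeta> ^ a \<chi> else 1)"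
    proof (rule prod.cong)
      fix \<psi> assume \<psi>: "\<psi> \<in> L"
      show "\<chi> (d \<psi> [^] a \<psi>) = (if \<psi> = \<chi> then \<zeta> ^ a \<chi> else 1)"
        using dual[OF \<chi> \<psi>] chi_pow[OF \<chi>, of "d \<psi>" "a \<psi>"] d[OF \<psi>] by auto
    qed simp
    finally show ?thesis using finL \<chi> by simp
  qed
  have gen: "generate G (d ` L) = carrier G"
  proof
    show sub: "generate G (d ` L) \<subseteq> carrier G" using dG by (intro generate_incl) auto
    have sg: "subgroup (generate G (d ` L)) G" using dG by (intro generate_is_subgroup) auto
    show "carrier G \<subseteq> generate G (d ` L)"
    proof
      fix y assume y: "y \<in> carrier G"
      have "\<exists>a. \<chi> y = \<zeta> ^ a" if "\<chi> \<in> L" for \<chi>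
      proof -
        have "\<chi> y \<in> (\<lambda>j. \<zeta> ^ j) ` {..<p}"
          using root_of_unity_powers[OF p \<zeta>] chi_root[OF that y] by (simp add: bij_betw_def)
        then show ?thesis by blast
      qed
      then obtain a where a: "\<And>\<chi>. \<chi> \<in> L \<Longrightarrow> \<chi> y = \<zeta> ^ (a \<chi>)" by metis
      define w where "w = finprod G (\<lambda>\<psi>. d \<psi> [^] (a \<psi> :: nat)) L"
      have wG: "w \<in> generate G (d ` L)" unfolding w_def
        by (intro finprod_in_subgroup[OF sg finL] Pi_I subgroup_pow[OF sg] generate.incl) auto
      then have wc: "w \<in> carrier G" using sub by blast
      have "y \<otimes> inv w = \<one>"
      proof (rule ccontr)
        assume "y \<otimes> inv w \<noteq> \<one>"
        then obtain \<chi> where \<chi>: "\<chi> \<in> L" "\<chi> (y \<otimes> inv w) \<noteq> 1"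
          using L y wc by (auto simp: Sep_def)
        have "\<chi> (y \<otimes> inv w) = \<chi> w * \<chi> (inv w)"
          using \<chi>(1) LL y wc a[OF \<chi>(1)] prod[OF \<chi>(1), of a] by (auto simp: mult w_def)
        also have "\<dots> = \<chi> (w \<otimes> inv w)" using \<chi>(1) LL wc mult[of \<chi> w "inv w"] by auto
        also have "\<dots> = 1" using \<chi>(1) LL wc one by auto
        finally show False using \<chi>(2) by simp
      qed
      moreover have "y = y \<otimes> inv w \<otimes> w" using y wc by (simp add: m_assoc)
      ultimately have "y = w" using wc by simp
      then show "y \<in> generate G (d ` L)" using wG by simp
    qed
  qed
  have "min_generators G \<le> card (d ` L)"
    unfolding min_generators_def using dG finL gen
    by (intro Least_le exI[of _ "d ` L"]) auto
  also have "\<dots> \<le> card L" using finL by (rule card_image_le)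
  finally have "min_generators G \<le> card L" .
  moreover have "finprod G d L \<in> carrier G" using dG by (rule finprod_closed)
  moreover have "\<forall>\<chi>\<in>L. \<chi> (finprod G d L) = \<zeta>"
  proof
    fix \<chi> assume \<chi>: "\<chi> \<in> L"
    have "finprod G d L = finprod G (\<lambda>\<psi>. d \<psi> [^] (1::nat)) L"
      by (intro finprod_cong') (auto simp: d)
    then show "\<chi> (finprod G d L) = \<zeta>" using prod[OF \<chi>, of "\<lambda>_. 1"] by simp
  qed
  ultimately show ?thesis using finL LL d dual by (intro exI[of _ L] exI[of _ d] exI[of _ "finprod G d L"]) auto
qed

section \<open>Matrix representations and irreducible constituents\<close>

lemma (in group) hom_GL_I:
  assumes "\<And>g. g \<in> carrier G \<Longrightarrow> \<rho> g \<in> carrier_mat n n"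
    and mult: "\<And>g h. g \<in> carrier G \<Longrightarrow> h \<in> carrier G \<Longrightarrow> \<rho> (g \<otimes> h) = \<rho> g * \<rho> h"
    and one: "\<rho> \<one> = 1\<^sub>m n"
  shows "\<rho> \<in> hom G (GL n)"
proof (rule homI)
  fix g assume g: "g \<in> carrier G"
  have "\<rho> g * \<rho> (inv g) = 1\<^sub>m n" "\<rho> (inv g) * \<rho> g = 1\<^sub>m n"
    using mult[of g "inv g"] mult[of "inv g" g] g one by auto
  then show "\<rho> g \<in> carrier (GL n)"
    using assms(1)[OF g] assms(1)[of "inv g"] g
    by (auto simp: GL_def units_of_def Units_def ring_mat_def)
next
  fix g h assume "g \<in> carrier G" "h \<in> carrier G"
  then show "\<rho> (g \<otimes> h) = \<rho> g \<otimes>\<^bsub>GL n\<^esub> \<rho> h"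
    by (simp add: mult GL_def units_of_def ring_mat_def)
qed

lemma hom_GL_D:
  assumes "\<rho> \<in> hom G (GL n)"
  shows "g \<in> carrier G \<Longrightarrow> \<rho> g \<in> carrier_mat n n"
    and "g \<in> carrier G \<Longrightarrow> h \<in> carrier G \<Longrightarrow> \<rho> (g \<otimes>\<^bsub>G\<^esub> h) = \<rho> g * \<rho> h"
proof -
  show "\<rho> g \<in> carrier_mat n n" if "g \<in> carrier G" 
    using hom_in_carrier[OF assms that] by (auto simp: GL_def units_of_def Units_def ring_mat_def)
  show "\<rho> (g \<otimes>\<^bsub>G\<^esub> h) = \<rho> g * \<rho> h" if "g \<in> carrier G" "h \<in> carrier G"
    using hom_mult[OF assms that] by (simp add: GL_def units_of_def ring_mat_def)
qed

lemma (in group) hom_GL_one: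
  assumes "\<rho> \<in> hom G (GL n)"
  shows "\<rho> \<one> = 1\<^sub>m n"
proof -
  have "group (GL n)" unfolding GL_def
    by (rule monoid.units_group[OF ring.axioms(2)[OF ring_mat]])
  then have "\<rho> \<one> = \<one>\<^bsub>GL n\<^esub>" using hom_one[OF assms is_group] by blast
  then show ?thesis by (simp add: GL_def units_of_def ring_mat_def)
qed

lemma (in group) hom_GL_pow:
  assumes \<rho>: "\<rho> \<in> hom G (GL n)" and g: "g \<in> carrier G"
  shows "\<rho> (g [^] (k::nat)) = \<rho> g ^\<^sub>m k"
proof (induction k)
  case 0
  then show ?case using hom_GL_one[OF \<rho>] hom_GL_D(1)[OF \<rho> g] by simp
next
  case (Suc k)
  then show ?case using hom_GL_D(2)[OF \<rho>, of "g [^] k" g] g by simp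
qed

lemma subspace_iff_linear_subset:
  "VectorSpace.subspace class_ring W (module_vec TYPE(complex) n) \<longleftrightarrow> linear_subset n W"
proof
  assume "VectorSpace.subspace class_ring W (module_vec TYPE(complex) n)"
  then have "submodule class_ring W (module_vec TYPE(complex) n)"
    by (simp add: VectorSpace.subspace_def)
  then show "linear_subset n W"
    by (auto simp: linear_subset_def submodule_def module_vec_simps)
next
  assume W: "linear_subset n W"
  interpret vec_space "TYPE(complex)" n .
  have "submodule class_ring W (module_vec TYPE(complex) n)"
    using W module_axioms by (auto simp: linear_subset_def submodule_def module_vec_simps)
  then show "VectorSpace.subspace class_ring W (module_vec TYPE(complex) n)"
    using vectorspace_axioms by (simp add: VectorSpace.subspace_def)
qed

lemma irreducible_rep_linear_subset:
  assumes "irreducible_rep G n \<rho>" "linear_subset n W"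
    and "\<And>g w. g \<in> carrier G \<Longrightarrow> w \<in> W \<Longrightarrow> \<rho> g *\<^sub>v w \<in> W"
  shows "W = {0\<^sub>v n} \<or> W = carrier_vec n"
  using assms unfolding irreducible_rep_def subspace_iff_linear_subset by blast

text \<open>
  This gives the matrix, in coordinates, of the restriction of an operator to an invariant subspace.
\<close>

lemma factor_through_inj_mat:
  fixes P :: "'a::field mat"
  assumes P: "P \<in> carrier_mat n m" and A: "A \<in> carrier_mat n k"
    and range: "\<And>v. v \<in> carrier_vec k \<Longrightarrow> A *\<^sub>v v \<in> mat_range P"
  shows "\<exists>S \<in> carrier_mat m k. A = P * S"
proof -
  have "\<forall>j. \<exists>s. j < k \<longrightarrow> s \<in> carrier_vec m \<and> P *\<^sub>v s = col A j"
  proof (intro allI)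
    fix j
    show "\<exists>s. j < k \<longrightarrow> s \<in> carrier_vec m \<and> P *\<^sub>v s = col A j"
    proof (cases "j < k")
      case True
      then have "col A j \<in> mat_range P" using range[of "unit_vec k j"] mult_unit_vec[OF A True] by simp
      then obtain s where "s \<in> carrier_vec m" "col A j = P *\<^sub>v s" using P by (auto simp: mat_range_def)
      then show ?thesis by auto
    qed simp
  qed
  then obtain s where s: "\<forall>j. j < k \<longrightarrow> s j \<in> carrier_vec m \<and> P *\<^sub>v s j = col A j"
    by (rule choice[THEN exE])
  define S where "S = mat m k (\<lambda>(i,j). s j $ i)"
  have S: "S \<in> carrier_mat m k" by (simp add: S_def)
  have "A = P * S"
  proof (rule mat_col_eqI)
    fix j assume "j < dim_col (P * S)"
    then have j: "j < k" using S by simp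
    have "s j \<in> carrier_vec m" using s j by blast
    then have "col S j = s j" using j by (auto simp: S_def intro!: eq_vecI)
    then show "col A j = col (P * S) j" using s j P S col_mult2[OF P S j] by simp
  qed (use P A S in auto)
  then show ?thesis using S by blast
qed

lemma mat_range_mult:
  fixes P :: "'a::field mat"
  assumes "P \<in> carrier_mat n m" "Q \<in> carrier_mat m k"
  shows "mat_range (P * Q) = (\<lambda>v. P *\<^sub>v v) ` mat_range Q"
  using assms assoc_mult_mat_vec[OF assms] by (auto simp: mat_range_def image_image intro!: image_cong)

text \<open>
  Every nonzero invariant subspace contains an irreducible one: choose a nonzero invariant range with
  the fewest columns. A proper nonzero invariant subspace of the resulting representation on the
  coordinates would give a range with fewer columns.
\<close>

lemma (in group) irreducible_subrep:
  assumes \<rho>: "\<rho> \<in> hom G (GL n)" and U: "linear_subset n U" "U \<noteq> {0\<^sub>v n}"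
    and inv: "\<And>g v. g \<in> carrier G \<Longrightarrow> v \<in> U \<Longrightarrow> \<rho> g *\<^sub>v v \<in> U"
  shows "\<exists>m P \<sigma>. irreducible_rep G m \<sigma> \<and> P \<in> carrier_mat n m \<and> inj_mat P \<and> mat_range P \<subseteq> U \<and>
           (\<forall>g\<in>carrier G. \<rho> g * P = P * \<sigma> g)"
proof -
  define R where "R = (\<lambda>m. \<exists>P. 0 < m \<and> P \<in> carrier_mat n m \<and> inj_mat P \<and> mat_range P \<subseteq> U \<and>
     (\<forall>g\<in>carrier G. \<forall>v\<in>mat_range P. \<rho> g *\<^sub>v v \<in> mat_range P))"
  obtain k P0 where P0: "P0 \<in> carrier_mat n k" "inj_mat P0" "mat_range P0 = U"
    using linear_subset_basis[OF U(1)] by blast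
  have "k \<noteq> 0"
  proof
    assume "k = 0"
    then have "U \<subseteq> {0\<^sub>v n}" using P0 
      by (auto simp: mat_range_def scalar_prod_def intro!: eq_vecI)
    moreover have "0\<^sub>v n \<in> U" using U(1) by (simp add: linear_subset_def)
    ultimately show False using U(2) by blast
  qed
  then have "R k" unfolding R_def using P0 inv by (intro exI[of _ P0]) simp
  then obtain m where m: "R m" and min: "\<And>l. R l \<Longrightarrow> m \<le> l"
    using ex_has_least_nat[of R k "\<lambda>x. x"] by blast
  obtain P where m0: "0 < m" and P: "P \<in> carrier_mat n m" "inj_mat P" and PU: "mat_range P \<subseteq> U"
    and Pinv: "\<And>g v. g \<in> carrier G \<Longrightarrow> v \<in> mat_range P \<Longrightarrow> \<rho> g *\<^sub>v v \<in> mat_range P"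
    using m unfolding R_def by blast
  note \<rho>c = hom_GL_D(1)[OF \<rho>] and \<rho>m = hom_GL_D(2)[OF \<rho>]
  have "\<forall>g\<in>carrier G. \<exists>S. S \<in> carrier_mat m m \<and> \<rho> g * P = P * S"
  proof
    fix g assume g: "g \<in> carrier G"
    have "\<exists>S\<in>carrier_mat m m. \<rho> g * P = P * S"
    proof (rule factor_through_inj_mat[OF P(1)])
      show "\<rho> g * P \<in> carrier_mat n m" using \<rho>c[OF g] P by simp
      fix v :: "complex vec" assume v: "v \<in> carrier_vec m"
      show "\<rho> g * P *\<^sub>v v \<in> mat_range P"
        using assoc_mult_mat_vec[OF \<rho>c[OF g] P(1) v] Pinv[OF g mult_mat_vec_in_range[OF P(1) v]] by simp
    qed
    then show "\<exists>S. S \<in> carrier_mat m m \<and> \<rho> g * P = P * S" by blast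
  qed
  then obtain \<sigma> where \<sigma>: "\<forall>g\<in>carrier G. \<sigma> g \<in> carrier_mat m m \<and> \<rho> g * P = P * \<sigma> g"
    by (rule bchoice[THEN exE])
  have \<sigma>c: "\<sigma> g \<in> carrier_mat m m" if "g \<in> carrier G" for g using bspec[OF \<sigma> that] ..
  have \<sigma>P: "\<rho> g * P = P * \<sigma> g" if "g \<in> carrier G" for g using bspec[OF \<sigma> that] ..
  have hom: "\<sigma> \<in> hom G (GL m)"
  proof (rule hom_GL_I)
    show "\<sigma> g \<in> carrier_mat m m" if "g \<in> carrier G" for g using \<sigma>c[OF that] .
    fix g h assume g: "g \<in> carrier G" and h: "h \<in> carrier G"
    have "P * \<sigma> (g \<otimes> h) = (\<rho> g * \<rho> h) * P" using \<sigma>P[of "g \<otimes> h"] \<rho>m[OF g h] g h by simp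
    also have "\<dots> = \<rho> g * (P * \<sigma> h)"
      unfolding \<sigma>P[OF h, symmetric] by (rule assoc_mult_mat[OF \<rho>c[OF g] \<rho>c[OF h] P(1)])
    also have "\<dots> = (P * \<sigma> g) * \<sigma> h"
      unfolding \<sigma>P[OF g, symmetric] by (rule assoc_mult_mat[OF \<rho>c[OF g] P(1) \<sigma>c[OF h], symmetric])
    also have "\<dots> = P * (\<sigma> g * \<sigma> h)" by (rule assoc_mult_mat[OF P(1) \<sigma>c[OF g] \<sigma>c[OF h]])
    finally show "\<sigma> (g \<otimes> h) = \<sigma> g * \<sigma> h"
      by (rule inj_mat_cancel_mat[OF P(2,1) \<sigma>c[OF m_closed[OF g h]] mult_carrier_mat[OF \<sigma>c[OF g] \<sigma>c[OF h]]])
  next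
    have "P * \<sigma> \<one> = P * 1\<^sub>m m" using \<sigma>P[of \<one>] hom_GL_one[OF \<rho>] P(1) by simp
    then show "\<sigma> \<one> = 1\<^sub>m m"
      by (rule inj_mat_cancel_mat[OF P(2,1) \<sigma>c[OF one_closed] one_carrier_mat])
  qed
  have "irreducible_rep G m \<sigma>"
    unfolding irreducible_rep_def subspace_iff_linear_subset
  proof (intro conjI allI impI hom m0)
    fix W assume W: "linear_subset m W \<and> (\<forall>g\<in>carrier G. \<forall>w\<in>W. \<sigma> g *\<^sub>v w \<in> W)"
    then obtain l Q where l: "l \<le> m" and Q: "Q \<in> carrier_mat m l" "inj_mat Q" "mat_range Q = W"
      using linear_subset_basis by blast
    have Wc: "W \<subseteq> carrier_vec m" "0\<^sub>v m \<in> W" using W by (auto simp: linear_subset_def)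
    show "W = {0\<^sub>v m} \<or> W = carrier_vec m"
    proof (cases "l = 0 \<or> l = m")
      case True
      then show ?thesis
      proof
        assume "l = 0"
        then have "W \<subseteq> {0\<^sub>v m}" using Q 
          by (auto simp: mat_range_def scalar_prod_def intro!: eq_vecI)
        then show ?thesis using Wc by blast
      next
        assume "l = m"
        then show ?thesis using inj_square_mat_range[of Q m] Q by simp
      qed
    next
      case False
      have PQ: "mat_range (P * Q) = (\<lambda>v. P *\<^sub>v v) ` W" using mat_range_mult[OF P(1) Q(1)] Q(3) by simp
      have "R l" unfolding R_def
      proof (intro exI[of _ "P * Q"] conjI ballI)
        show "0 < l" using False by simp
        show "P * Q \<in> carrier_mat n l" using P Q by simp
        show "inj_mat (P * Q)" by (rule inj_mat_mult[OF P(2,1) Q(2,1)])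
        show "mat_range (P * Q) \<subseteq> U"
        proof
          fix v assume "v \<in> mat_range (P * Q)"
          then obtain w where "w \<in> W" "v = P *\<^sub>v w" using PQ by blast
          then have "v \<in> mat_range P" using Wc(1) mult_mat_vec_in_range[OF P(1), of w] by blast
          then show "v \<in> U" using PU by blast
        qed
        fix g v assume g: "g \<in> carrier G" and "v \<in> mat_range (P * Q)"
        then obtain w where w: "w \<in> W" "v = P *\<^sub>v w" using PQ by blast
        have wc: "w \<in> carrier_vec m" using w Wc by blast
        have "\<rho> g *\<^sub>v v = (\<rho> g * P) *\<^sub>v w"
          unfolding w(2) by (rule assoc_mult_mat_vec[OF \<rho>c[OF g] P(1) wc, symmetric])
        also have "\<dots> = P *\<^sub>v (\<sigma> g *\<^sub>v w)"
          unfolding \<sigma>P[OF g] by (rule assoc_mult_mat_vec[OF P(1) \<sigma>c[OF g] wc])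
        finally show "\<rho> g *\<^sub>v v \<in> mat_range (P * Q)" using W g w PQ by blast
      qed
      then have "m \<le> l" by (rule min)
      then show ?thesis using l False by simp
    qed
  qed
  then show ?thesis using P PU \<sigma>P by blast
qed

lemma linear_subset_joint_eigenspace:
  fixes A :: "'i \<Rightarrow> 'a::field mat"
  assumes A: "\<And>i. i \<in> I \<Longrightarrow> A i \<in> carrier_mat n n"
  shows "linear_subset n {v \<in> carrier_vec n. \<forall>i\<in>I. A i *\<^sub>v v = c i \<cdot>\<^sub>v v}"
proof -
  have "A i *\<^sub>v 0\<^sub>v n = c i \<cdot>\<^sub>v 0\<^sub>v n" if "i \<in> I" for i
    using A[OF that] by (auto intro!: eq_vecI)
  moreover have "A i *\<^sub>v (v + w) = c i \<cdot>\<^sub>v (v + w)"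
    if "i \<in> I" "v \<in> carrier_vec n" "w \<in> carrier_vec n" "A i *\<^sub>v v = c i \<cdot>\<^sub>v v" "A i *\<^sub>v w = c i \<cdot>\<^sub>v w" for i v w
    using mult_add_distrib_mat_vec[OF A[OF that(1)] that(2,3)] smult_add_distrib_vec[OF that(2,3)] that(4,5) by simp
  moreover have "A i *\<^sub>v (a \<cdot>\<^sub>v v) = c i \<cdot>\<^sub>v (a \<cdot>\<^sub>v v)"
    if "i \<in> I" "v \<in> carrier_vec n" "A i *\<^sub>v v = c i \<cdot>\<^sub>v v" for i a v
    using mult_mat_vec[OF A[OF that(1)] that(2), of a] that(3) by (simp add: smult_smult_assoc mult.commute)
  ultimately show ?thesis unfolding linear_subset_def by simp
qed

lemma joint_eigenspace_commuting:
  fixes A :: "'i \<Rightarrow> 'a::field mat"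
  assumes A: "\<And>i. i \<in> I \<Longrightarrow> A i \<in> carrier_mat n n" and B: "B \<in> carrier_mat n n"
    and comm: "\<And>i. i \<in> I \<Longrightarrow> A i * B = B * A i"
    and v: "v \<in> {v \<in> carrier_vec n. \<forall>i\<in>I. A i *\<^sub>v v = c i \<cdot>\<^sub>v v}"
  shows "B *\<^sub>v v \<in> {v \<in> carrier_vec n. \<forall>i\<in>I. A i *\<^sub>v v = c i \<cdot>\<^sub>v v}"
proof (intro CollectI conjI ballI)
  have vc: "v \<in> carrier_vec n" using v by simp
  show "B *\<^sub>v v \<in> carrier_vec n" using B vc by simp
  fix i assume i: "i \<in> I"
  have "A i *\<^sub>v (B *\<^sub>v v) = (B * A i) *\<^sub>v v"
    unfolding comm[OF i, symmetric] by (rule assoc_mult_mat_vec[OF A[OF i] B vc, symmetric])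
  also have "\<dots> = B *\<^sub>v (A i *\<^sub>v v)" by (rule assoc_mult_mat_vec[OF B A[OF i] vc])
  also have "A i *\<^sub>v v = c i \<cdot>\<^sub>v v" using v i by blast
  also have "B *\<^sub>v (c i \<cdot>\<^sub>v v) = c i \<cdot>\<^sub>v (B *\<^sub>v v)" by (rule mult_mat_vec[OF B vc])
  finally show "A i *\<^sub>v (B *\<^sub>v v) = c i \<cdot>\<^sub>v (B *\<^sub>v v)" .
qed

text \<open>
  Schur's lemma: an eigenspace of \<open>A\<close> is invariant and nonzero, hence everything.
\<close>

lemma schur_scalar:
  fixes A :: "complex mat"
  assumes irr: "irreducible_rep G m \<sigma>" and A: "A \<in> carrier_mat m m"
    and comm: "\<And>g. g \<in> carrier G \<Longrightarrow> A * \<sigma> g = \<sigma> g * A"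
  shows "\<exists>c. \<forall>v \<in> carrier_vec m. A *\<^sub>v v = c \<cdot>\<^sub>v v"
proof -
  have \<sigma>: "\<sigma> \<in> hom G (GL m)" and m0: "m > 0" using irr by (auto simp: irreducible_rep_def)
  note \<sigma>c = hom_GL_D(1)[OF \<sigma>]
  obtain c v0 where c: "eigenvector A v0 c"
    using spectrum_non_empty[OF A m0] by (auto simp: spectrum_def eigenvalue_def)
  then have v0: "v0 \<in> carrier_vec m" "v0 \<noteq> 0\<^sub>v m" "A *\<^sub>v v0 = c \<cdot>\<^sub>v v0"
    using A by (auto simp: eigenvector_def)
  define E where "E = {v \<in> carrier_vec m. \<forall>i\<in>{()}. A *\<^sub>v v = c \<cdot>\<^sub>v v}"
  have "E = {0\<^sub>v m} \<or> E = carrier_vec m"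
  proof (rule irreducible_rep_linear_subset[OF irr])
    show "linear_subset m E" unfolding E_def by (rule linear_subset_joint_eigenspace) (rule A)
    show "\<sigma> g *\<^sub>v w \<in> E" if "g \<in> carrier G" "w \<in> E" for g w
      using joint_eigenspace_commuting[OF A \<sigma>c[OF that(1)] comm[OF that(1)] that(2)[unfolded E_def]]
      unfolding E_def .
  qed
  then have "E = carrier_vec m" using v0 by (auto simp: E_def)
  then show ?thesis by (auto simp: E_def)
qed

lemma (in group) irreducible_rep_degree:
  assumes "irreducible_rep G m \<sigma>" 
  shows "of_nat m \<in> cd G"
proof -
  have \<sigma>: "\<sigma> \<in> hom G (GL m)" using assms by (simp add: irreducible_rep_def)
  have "rep_character G \<sigma> \<one> = of_nat m"
    using hom_GL_one[OF \<sigma>] by (simp add: rep_character_def mat_trace_def)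
  then show ?thesis using assms unfolding cd_def Irr_def by (auto intro!: exI[of _ "rep_character G \<sigma>"])
qed

lemma (in group) hom_GL_act:
  assumes \<rho>: "\<rho> \<in> hom G (GL n)" and v: "v \<in> carrier_vec n"
  shows "g \<in> carrier G \<Longrightarrow> \<rho> g *\<^sub>v v \<in> carrier_vec n"
    and "g \<in> carrier G \<Longrightarrow> h \<in> carrier G \<Longrightarrow> \<rho> (g \<otimes> h) *\<^sub>v v = \<rho> g *\<^sub>v (\<rho> h *\<^sub>v v)"
    and "\<rho> \<one> *\<^sub>v v = v"
    and "g \<in> carrier G \<Longrightarrow> \<rho> g *\<^sub>v (c \<cdot>\<^sub>v v) = c \<cdot>\<^sub>v (\<rho> g *\<^sub>v v)"
    and "g \<in> carrier G \<Longrightarrow> \<rho> (inv g) *\<^sub>v (\<rho> g *\<^sub>v v) = v"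
proof -
  note c = hom_GL_D(1)[OF \<rho>] and m = hom_GL_D(2)[OF \<rho>]
  show "\<rho> g *\<^sub>v v \<in> carrier_vec n" if "g \<in> carrier G" using c[OF that] v by simp
  show mv: "\<rho> (g \<otimes> h) *\<^sub>v v = \<rho> g *\<^sub>v (\<rho> h *\<^sub>v v)" if "g \<in> carrier G" "h \<in> carrier G" for g h
    unfolding m[OF that] by (rule assoc_mult_mat_vec[OF c[OF that(1)] c[OF that(2)] v])
  show one: "\<rho> \<one> *\<^sub>v v = v" unfolding hom_GL_one[OF \<rho>] using v by simp
  show "\<rho> g *\<^sub>v (a \<cdot>\<^sub>v v) = a \<cdot>\<^sub>v (\<rho> g *\<^sub>v v)" if "g \<in> carrier G" for a
    by (rule mult_mat_vec[OF c[OF that] v])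
  show "\<rho> (inv g) *\<^sub>v (\<rho> g *\<^sub>v v) = v" if "g \<in> carrier G"
    using mv[of "inv g" g] that one by simp
qed

lemma intertwiner_mult_vec:
  assumes \<rho>: "\<rho> \<in> hom G (GL n)" and \<sigma>: "\<sigma> \<in> hom G (GL m)" and P: "P \<in> carrier_mat n m"
    and eq: "\<forall>g\<in>carrier G. \<rho> g * P = P * \<sigma> g" and g: "g \<in> carrier G" and v: "v \<in> carrier_vec m"
  shows "P *\<^sub>v (\<sigma> g *\<^sub>v v) = \<rho> g *\<^sub>v (P *\<^sub>v v)"
  using assoc_mult_mat_vec[OF hom_GL_D(1)[OF \<rho> g] P v] assoc_mult_mat_vec[OF P hom_GL_D(1)[OF \<sigma> g] v]
    bspec[OF eq g] by simp

lemma center_commutes: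
  assumes \<rho>: "\<rho> \<in> hom G (GL n)" and z: "z \<in> group_center G" and g: "g \<in> carrier G"
  shows "\<rho> z * \<rho> g = \<rho> g * \<rho> z"
  using hom_GL_D(2)[OF \<rho>, of z g] hom_GL_D(2)[OF \<rho>, of g z] z g by (simp add: group_center_def)

lemma center_difference_equivariant:
  assumes \<rho>: "\<rho> \<in> hom G (GL n)" and z: "z \<in> group_center G" and g: "g \<in> carrier G"
    and v: "v \<in> carrier_vec n"
  shows "\<rho> g *\<^sub>v ((\<rho> z - 1\<^sub>m n) *\<^sub>v v) = (\<rho> z - 1\<^sub>m n) *\<^sub>v (\<rho> g *\<^sub>v v)"
proof -
  have gc: "\<rho> g \<in> carrier_mat n n" by (rule hom_GL_D(1)[OF \<rho> g])
  have zc: "\<rho> z \<in> carrier_mat n n" using hom_GL_D(1)[OF \<rho>] z by (simp add: group_center_def)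
  have D: "\<rho> z - 1\<^sub>m n \<in> carrier_mat n n" by (rule minus_carrier_mat) simp
  have "\<rho> g * (\<rho> z - 1\<^sub>m n) = (\<rho> z - 1\<^sub>m n) * \<rho> g"
    unfolding mult_minus_distrib_mat[OF gc zc one_carrier_mat] minus_mult_distrib_mat[OF zc one_carrier_mat gc]
    using center_commutes[OF \<rho> z g] gc by simp
  then show ?thesis using assoc_mult_mat_vec[OF gc D v] assoc_mult_mat_vec[OF D gc v] by simp
qed

section \<open>Small orbits in irreducible representations\<close>

lemma (in group) rep_eigenvalue_root:
  assumes \<rho>: "\<rho> \<in> hom G (GL n)" and g: "g \<in> carrier G" "g [^] (p::nat) = \<one>"
    and v: "v \<in> carrier_vec n" "v \<noteq> 0\<^sub>v n" "\<rho> g *\<^sub>v v = c \<cdot>\<^sub>v v"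
  shows "c ^ p = 1"
proof (rule finite_order_eigenvalue[OF hom_GL_D(1)[OF \<rho> g(1)] _ v])
  show "\<rho> g ^\<^sub>m p = 1\<^sub>m n"
    unfolding hom_GL_pow[OF \<rho> g(1), symmetric] g(2) by (rule hom_GL_one[OF \<rho>])
qed

text \<open>
  If all complex \<open>p\<close>-th roots of unity are eigenvalues of a \<open>p \<times> p\<close> matrix of order
  dividing \<open>p\<close>, each of them fills exactly one diagonal position, so the eigenspaces are lines.
\<close>

lemma simple_spectrum_eigenspace:
  fixes A :: "complex mat"
  assumes p: "prime p" and A: "A \<in> carrier_mat p p" "A ^\<^sub>m p = 1\<^sub>m p"
    and all: "\<And>\<nu>. \<nu> ^ p = 1 \<Longrightarrow> \<exists>v \<in> carrier_vec p. v \<noteq> 0\<^sub>v p \<and> A *\<^sub>v v = \<nu> \<cdot>\<^sub>v v"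
    and w: "w \<in> carrier_vec p" "w \<noteq> 0\<^sub>v p" "A *\<^sub>v w = \<nu> \<cdot>\<^sub>v w"
    and w': "w' \<in> carrier_vec p" "A *\<^sub>v w' = \<nu> \<cdot>\<^sub>v w'" and \<nu>: "\<nu> ^ p = 1"
  shows "\<exists>b. w' = b \<cdot>\<^sub>v w"
proof -
  obtain \<mu> where cnt: "\<And>c m Q. Q \<in> carrier_mat p m \<Longrightarrow> inj_mat Q \<Longrightarrow>
        (\<forall>v\<in>carrier_vec m. A *\<^sub>v (Q *\<^sub>v v) = c \<cdot>\<^sub>v (Q *\<^sub>v v)) \<Longrightarrow> m \<le> card {i. i < p \<and> \<mu> i = c}"
    using finite_order_eigenvalues[OF A] by blast
  define E where "E = (\<lambda>c. {v \<in> carrier_vec p. \<forall>i\<in>{()}. A *\<^sub>v v = c \<cdot>\<^sub>v v})"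
  have E_iff: "v \<in> E c \<longleftrightarrow> v \<in> carrier_vec p \<and> A *\<^sub>v v = c \<cdot>\<^sub>v v" for v c by (simp add: E_def)
  have basis: "\<exists>k Q. k \<le> card {i. i < p \<and> \<mu> i = c} \<and> Q \<in> carrier_mat p k \<and> inj_mat Q \<and> mat_range Q = E c" for c
  proof -
    have "linear_subset p (E c)" unfolding E_def by (rule linear_subset_joint_eigenspace) (rule A)
    then obtain k Q where Q: "Q \<in> carrier_mat p k" "inj_mat Q" "mat_range Q = E c"
      using linear_subset_basis by blast
    have "\<forall>v\<in>carrier_vec k. A *\<^sub>v (Q *\<^sub>v v) = c \<cdot>\<^sub>v (Q *\<^sub>v v)"
    proof
      fix v :: "complex vec" assume "v \<in> carrier_vec k"
      then have "Q *\<^sub>v v \<in> E c" using mult_mat_vec_in_range[OF Q(1)] Q(3) by blast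
      then show "A *\<^sub>v (Q *\<^sub>v v) = c \<cdot>\<^sub>v (Q *\<^sub>v v)" by (simp add: E_iff)
    qed
    then show ?thesis using cnt[OF Q(1,2)] Q by blast
  qed
  have ge1: "1 \<le> card {i. i < p \<and> \<mu> i = c}" if c: "c ^ p = 1" for c
  proof (rule ccontr)
    assume "\<not> 1 \<le> card {i. i < p \<and> \<mu> i = c}"
    then have 0: "card {i. i < p \<and> \<mu> i = c} = 0" by linarith
    obtain k Q where "k \<le> 0" "Q \<in> carrier_mat p k" "mat_range Q = E c"
      using basis[of c] unfolding 0 by blast
    then have Q: "Q \<in> carrier_mat p 0" "mat_range Q = E c" by auto
    obtain v where v: "v \<in> carrier_vec p" "v \<noteq> 0\<^sub>v p" "A *\<^sub>v v = c \<cdot>\<^sub>v v"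
      using all[OF c] by (elim bexE conjE)
    then have "v \<in> mat_range Q" using Q(2) by (simp add: E_iff)
    then obtain a where "a \<in> carrier_vec 0" "v = Q *\<^sub>v a" using Q(1) by (auto simp: mat_range_def)
    then have "v = 0\<^sub>v p" using Q(1) by (auto simp: scalar_prod_def intro!: eq_vecI)
    then show False using v(2) by blast
  qed
  define R where "R = {z::complex. z ^ p = 1}"
  have p0: "p > 0" using p by (rule prime_gt_0_nat)
  have R: "finite R" "card R = p"
    unfolding R_def using p0 card_roots_unity_eq[OF p0] by (auto intro!: finite_roots_unity)
  have \<nu>R: "\<nu> \<in> R" using \<nu> by (simp add: R_def)
  have "(\<Sum>c\<in>R. card {i. i < p \<and> \<mu> i = c}) = card (\<Union>c\<in>R. {i. i < p \<and> \<mu> i = c})"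
    by (rule card_UN_disjoint[symmetric]) (use R in auto)
  also have "\<dots> \<le> card {..<p}" by (rule card_mono) auto
  finally have "(\<Sum>c\<in>R. card {i. i < p \<and> \<mu> i = c}) \<le> p" by simp
  moreover have "(\<Sum>c\<in>R. card {i. i < p \<and> \<mu> i = c})
      = card {i. i < p \<and> \<mu> i = \<nu>} + (\<Sum>c\<in>R - {\<nu>}. card {i. i < p \<and> \<mu> i = c})"
    by (rule sum.remove[OF R(1) \<nu>R])
  moreover have "(\<Sum>c\<in>R - {\<nu>}. 1) \<le> (\<Sum>c\<in>R - {\<nu>}. card {i. i < p \<and> \<mu> i = c})"
    by (rule sum_mono) (use ge1 in \<open>simp add: R_def\<close>)
  moreover have "(\<Sum>c\<in>R - {\<nu>}. 1) = p - 1" using R \<nu>R by simp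
  ultimately have "card {i. i < p \<and> \<mu> i = \<nu>} \<le> 1" using p0 by linarith
  then obtain k Q where kQ: "k \<le> 1" "Q \<in> carrier_mat p k" "mat_range Q = E \<nu>"
    using basis[of \<nu>] by (meson le_trans)
  have "w \<in> mat_range Q" "w' \<in> mat_range Q" using w w' kQ(3) by (simp_all add: E_iff)
  then obtain a a' where a: "a \<in> carrier_vec k" "w = Q *\<^sub>v a" "a' \<in> carrier_vec k" "w' = Q *\<^sub>v a'"
    using kQ(2) by (auto simp: mat_range_def)
  have a0: "k = 1 \<and> a $ 0 \<noteq> 0"
  proof (rule ccontr)
    assume "\<not> (k = 1 \<and> a $ 0 \<noteq> 0)"
    then have "a $ i = 0" if "i < k" for i using that kQ(1) by (cases i) auto
    then have "a = 0\<^sub>v k" using a(1) by (intro eq_vecI) auto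
    then have "w = 0\<^sub>v p" using a(2) kQ(2) by (auto intro!: eq_vecI)
    then show False using w(2) by blast
  qed
  have "a' = (a' $ 0 / a $ 0) \<cdot>\<^sub>v a"
  proof (rule eq_vecI)
    fix i assume "i < dim_vec ((a' $ 0 / a $ 0) \<cdot>\<^sub>v a)"
    then have "i = 0" using a(1) a0 by auto
    then show "a' $ i = ((a' $ 0 / a $ 0) \<cdot>\<^sub>v a) $ i" using a(1) a0 by simp
  qed (use a(1,3) in simp)
  then have "w' = Q *\<^sub>v ((a' $ 0 / a $ 0) \<cdot>\<^sub>v a)" using a(4) by simp
  also have "\<dots> = (a' $ 0 / a $ 0) \<cdot>\<^sub>v w" unfolding a(2) by (rule mult_mat_vec[OF kQ(2) a(1)])
  finally show ?thesis by blast
qed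

lemma (in group) scalar_subgroup_normal:
  assumes \<sigma>: "\<sigma> \<in> hom G (GL m)" and m: "m > 0"
    and per: "\<And>x. x \<in> carrier G \<Longrightarrow> x [^] p = \<one>" and p: "(p::nat) > 0"
  shows "{g \<in> carrier G. \<exists>c. \<forall>v\<in>carrier_vec m. \<sigma> g *\<^sub>v v = c \<cdot>\<^sub>v v} \<lhd> G" (is "?K \<lhd> G")
proof -
  note act = hom_GL_act[OF \<sigma>]
  have "subgroup ?K G"
  proof (rule subgroupI)
    have "\<forall>v\<in>carrier_vec m. \<sigma> \<one> *\<^sub>v v = 1 \<cdot>\<^sub>v v" using act(3) by simp
    then show "?K \<noteq> {}" by blast
  next
    fix a assume "a \<in> ?K"
    then obtain c where a: "a \<in> carrier G" and c: "\<And>v. v \<in> carrier_vec m \<Longrightarrow> \<sigma> a *\<^sub>v v = c \<cdot>\<^sub>v v" by blast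
    have "unit_vec m 0 \<noteq> (0\<^sub>v m :: complex vec)" using m by auto
    then have "c ^ p = 1"
      using rep_eigenvalue_root[OF \<sigma> a per[OF a], of "unit_vec m 0" c] c by auto
    then have c0: "c \<noteq> 0" using p by (auto simp: power_0_left)
    have "\<sigma> (inv a) *\<^sub>v v = (1 / c) \<cdot>\<^sub>v v" if v: "v \<in> carrier_vec m" for v
    proof -
      have vc: "(1 / c) \<cdot>\<^sub>v v \<in> carrier_vec m" using v by simp
      have "\<sigma> a *\<^sub>v ((1 / c) \<cdot>\<^sub>v v) = v" using c[OF vc] c0 by (simp add: smult_smult_assoc)
      then show ?thesis using act(5)[OF vc a] by simp
    qed
    then show "inv a \<in> ?K" using a by blast
  next
    fix a b assume "a \<in> ?K" "b \<in> ?K"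
    then obtain c d where a: "a \<in> carrier G" "b \<in> carrier G"
      and c: "\<And>v. v \<in> carrier_vec m \<Longrightarrow> \<sigma> a *\<^sub>v v = c \<cdot>\<^sub>v v" 
      and d: "\<And>v. v \<in> carrier_vec m \<Longrightarrow> \<sigma> b *\<^sub>v v = d \<cdot>\<^sub>v v" by blast
    have "\<sigma> (a \<otimes> b) *\<^sub>v v = (c * d) \<cdot>\<^sub>v v" if v: "v \<in> carrier_vec m" for v
      using act(2)[OF v a] d[OF v] c[of "d \<cdot>\<^sub>v v"] v by (simp add: smult_smult_assoc)
    then show "a \<otimes> b \<in> ?K" using a by blast
  qed auto
  moreover have "h \<otimes> g \<otimes> inv h \<in> ?K" if h: "h \<in> carrier G" and "g \<in> ?K" for g h
  proof -
    obtain c where g: "g \<in> carrier G" and c: "\<And>v. v \<in> carrier_vec m \<Longrightarrow> \<sigma> g *\<^sub>v v = c \<cdot>\<^sub>v v"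
      using \<open>g \<in> ?K\<close> by blast
    have "\<sigma> (h \<otimes> g \<otimes> inv h) *\<^sub>v v = c \<cdot>\<^sub>v v" if v: "v \<in> carrier_vec m" for v
    proof -
      define w where "w = \<sigma> (inv h) *\<^sub>v v"
      have w: "w \<in> carrier_vec m" unfolding w_def by (rule act(1)[OF v inv_closed[OF h]])
      have hw: "\<sigma> h *\<^sub>v w = v" using act(5)[OF v inv_closed[OF h]] h by (simp add: w_def)
      have "\<sigma> (h \<otimes> g \<otimes> inv h) *\<^sub>v v = \<sigma> (h \<otimes> g) *\<^sub>v w"
        unfolding w_def by (rule act(2)[OF v]) (use g h in auto)
      also have "\<dots> = \<sigma> h *\<^sub>v (c \<cdot>\<^sub>v w)" unfolding c[OF w, symmetric] by (rule act(2)[OF w h g])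
      also have "\<dots> = c \<cdot>\<^sub>v v" using act(4)[OF w h] hw by simp
      finally show ?thesis .
    qed
    then have "\<forall>v\<in>carrier_vec m. \<sigma> (h \<otimes> g \<otimes> inv h) *\<^sub>v v = c \<cdot>\<^sub>v v" by (rule ballI)
    moreover have "h \<otimes> g \<otimes> inv h \<in> carrier G" using g h by simp
    ultimately show ?thesis by (intro CollectI conjI exI)
  qed
  ultimately show ?thesis by (rule normal_invI)
qed

lemma (in group) hom_GL_cancel_zero:
  assumes \<rho>: "\<rho> \<in> hom G (GL n)" and g: "g \<in> carrier G" and v: "v \<in> carrier_vec n" "\<rho> g *\<^sub>v v = 0\<^sub>v n"
  shows "v = 0\<^sub>v n"
proof -
  have "\<rho> (inv g) *\<^sub>v 0\<^sub>v n = v" using hom_GL_act(5)[OF \<rho> v(1) g] v(2) by simp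
  moreover have "\<rho> (inv g) *\<^sub>v 0\<^sub>v n = 0\<^sub>v n"
    using hom_GL_D(1)[OF \<rho> inv_closed[OF g]] by (auto intro!: eq_vecI)
  ultimately show ?thesis by simp
qed

lemma (in group) small_orbit_degree_one:
  assumes \<sigma>: "\<sigma> \<in> hom G (GL 1)" and fin: "finite (carrier G)" and p: "prime p"
    and per: "\<And>x. x \<in> carrier G \<Longrightarrow> x [^] p = \<one>"
  shows "card ((\<lambda>g. \<sigma> g *\<^sub>v unit_vec 1 0) ` carrier G) \<le> p"
proof -
  define v :: "complex vec" where "v = unit_vec 1 0"
  have v: "v \<in> carrier_vec 1" "v \<noteq> 0\<^sub>v 1" by (auto simp: v_def)
  define R where "R = {z::complex. z ^ p = 1}"
  have p0: "p > 0" using p by (rule prime_gt_0_nat)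
  have R: "finite R" "card R = p"
    unfolding R_def using p0 card_roots_unity_eq[OF p0] by (auto intro!: finite_roots_unity)
  have "(\<lambda>g. \<sigma> g *\<^sub>v v) ` carrier G \<subseteq> (\<lambda>c. c \<cdot>\<^sub>v v) ` R"
  proof
    fix w assume "w \<in> (\<lambda>g. \<sigma> g *\<^sub>v v) ` carrier G"
    then obtain g where g: "g \<in> carrier G" "w = \<sigma> g *\<^sub>v v" by blast
    have wc: "w \<in> carrier_vec 1" unfolding g(2) by (rule hom_GL_act(1)[OF \<sigma> v(1) g(1)])
    have w: "w = (w $ 0) \<cdot>\<^sub>v v" using wc by (auto simp: v_def intro!: eq_vecI)
    then have "(w $ 0) ^ p = 1"
      using rep_eigenvalue_root[OF \<sigma> g(1) per[OF g(1)] v, of "w $ 0"] g(2) by metis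
    then show "w \<in> (\<lambda>c. c \<cdot>\<^sub>v v) ` R" using w by (auto simp: R_def)
  qed
  then have "card ((\<lambda>g. \<sigma> g *\<^sub>v v) ` carrier G) \<le> card R"
    using R(1) by (meson card_image_le card_mono finite_imageI le_trans)
  then show ?thesis using R by (simp add: v_def)
qed

text \<open>
  The scalar matrices come from a proper normal subgroup \<open>K\<close>; let \<open>x\<close> be central modulo \<open>K\<close> but not in
  \<open>K\<close>. Conjugation multiplies \<open>\<sigma> x\<close> by \<open>p\<close>-th roots of unity, not always by 1 since \<open>x\<close> is not scalar.
  Hence \<open>G\<close> permutes the eigenspaces transitively, all \<open>p\<close>-th roots of unity are eigenvalues, and the
  eigenspaces are lines. The orbit of an eigenvector meets each of these \<open>p\<close> lines in at most \<open>p\<close> vectors.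
\<close>

lemma (in group) small_orbit_degree_prime:
  assumes p: "prime p" and ord: "Coset.order G = p ^ n"
    and per: "\<And>x. x \<in> carrier G \<Longrightarrow> x [^] p = \<one>"
    and irr: "irreducible_rep G p \<sigma>"
  shows "\<exists>v \<in> carrier_vec p. v \<noteq> 0\<^sub>v p \<and> card ((\<lambda>g. \<sigma> g *\<^sub>v v) ` carrier G) \<le> p\<^sup>2"
proof -
  have \<sigma>: "\<sigma> \<in> hom G (GL p)" using irr by (simp add: irreducible_rep_def)
  note act = hom_GL_act[OF \<sigma>] and \<sigma>c = hom_GL_D(1)[OF \<sigma>]
  have p2: "p \<ge> 2" using p by (rule prime_ge_2_nat)
  then have p0: "p > 0" by simp
  define K where "K = {g \<in> carrier G. \<exists>c. \<forall>v\<in>carrier_vec p. \<sigma> g *\<^sub>v v = c \<cdot>\<^sub>v v}"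
  have K: "K \<lhd> G" unfolding K_def by (rule scalar_subgroup_normal[OF \<sigma> p0 per p0])
  have K_ne: "K \<noteq> carrier G"
  proof
    assume KG: "K = carrier G"
    \<comment> \<open>for a scalar action every coordinate hyperplane is invariant\<close>
    define W where "W = {v \<in> carrier_vec p. v $ 0 = (0::complex)}"
    have "W = {0\<^sub>v p} \<or> W = carrier_vec p"
    proof (rule irreducible_rep_linear_subset[OF irr])
      show "linear_subset p W" using p0 by (auto simp: linear_subset_def W_def)
      fix g w assume "g \<in> carrier G" and w: "w \<in> W"
      then have "g \<in> K" using KG by simp
      then obtain c where "\<And>v. v \<in> carrier_vec p \<Longrightarrow> \<sigma> g *\<^sub>v v = c \<cdot>\<^sub>v v" unfolding K_def by blast
      then have "\<sigma> g *\<^sub>v w = c \<cdot>\<^sub>v w" using w by (simp add: W_def)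
      then show "\<sigma> g *\<^sub>v w \<in> W" using w p0 by (auto simp: W_def)
    qed
    moreover have "unit_vec p 1 \<in> W" "unit_vec p 1 \<noteq> (0\<^sub>v p :: complex vec)" using p2 by (auto simp: W_def)
    moreover have "unit_vec p 0 \<notin> W" "unit_vec p 0 \<in> carrier_vec p" using p0 by (auto simp: W_def)
    ultimately show False by blast
  qed
  obtain x where x: "x \<in> carrier G" "x \<notin> K"
    and xK': "\<forall>g\<in>carrier G. \<exists>k\<in>K. g \<otimes> x = k \<otimes> (x \<otimes> g)"
    using p_group_central_mod_normal[OF p ord K K_ne] by (elim bexE DiffE) (rule that)
  have xK: "\<exists>k \<in> K. g \<otimes> x = k \<otimes> (x \<otimes> g)" if "g \<in> carrier G" for g
    by (rule bspec[OF xK' that])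
  define A where "A = \<sigma> x"
  have A: "A \<in> carrier_mat p p" unfolding A_def by (rule \<sigma>c[OF x(1)])
  have A_pow: "A ^\<^sub>m p = 1\<^sub>m p"
    unfolding A_def hom_GL_pow[OF \<sigma> x(1), symmetric] per[OF x(1)] by (rule hom_GL_one[OF \<sigma>])
  have "\<forall>g\<in>carrier G. \<exists>c. c ^ p = 1 \<and> (\<forall>v\<in>carrier_vec p. \<sigma> g *\<^sub>v (A *\<^sub>v v) = c \<cdot>\<^sub>v (A *\<^sub>v (\<sigma> g *\<^sub>v v)))"
  proof
    fix g assume g: "g \<in> carrier G"
    obtain k where k: "k \<in> K" "g \<otimes> x = k \<otimes> (x \<otimes> g)" using xK[OF g] by blast
    then obtain c where kG: "k \<in> carrier G" and c: "\<And>v. v \<in> carrier_vec p \<Longrightarrow> \<sigma> k *\<^sub>v v = c \<cdot>\<^sub>v v"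
      unfolding K_def by blast
    have "unit_vec p 0 \<noteq> (0\<^sub>v p :: complex vec)" using p0 by auto
    then have "c ^ p = 1"
      using rep_eigenvalue_root[OF \<sigma> kG per[OF kG], of "unit_vec p 0" c] c by auto
    moreover have "\<sigma> g *\<^sub>v (A *\<^sub>v v) = c \<cdot>\<^sub>v (A *\<^sub>v (\<sigma> g *\<^sub>v v))" if v: "v \<in> carrier_vec p" for v
    proof -
      have xg: "x \<otimes> g \<in> carrier G" using x g by simp
      have "\<sigma> g *\<^sub>v (A *\<^sub>v v) = \<sigma> (g \<otimes> x) *\<^sub>v v" unfolding A_def by (rule act(2)[OF v g x(1), symmetric])
      also have "\<dots> = \<sigma> k *\<^sub>v (\<sigma> (x \<otimes> g) *\<^sub>v v)" unfolding k(2) by (rule act(2)[OF v kG xg])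
      also have "\<dots> = c \<cdot>\<^sub>v (\<sigma> (x \<otimes> g) *\<^sub>v v)" by (rule c[OF act(1)[OF v xg]])
      also have "\<sigma> (x \<otimes> g) *\<^sub>v v = A *\<^sub>v (\<sigma> g *\<^sub>v v)" unfolding A_def by (rule act(2)[OF v x(1) g])
      finally show ?thesis .
    qed
    ultimately show "\<exists>c. c ^ p = 1 \<and> (\<forall>v\<in>carrier_vec p. \<sigma> g *\<^sub>v (A *\<^sub>v v) = c \<cdot>\<^sub>v (A *\<^sub>v (\<sigma> g *\<^sub>v v)))"
      by blast
  qed
  then obtain c where c: "\<forall>g\<in>carrier G. c g ^ p = 1 \<and> (\<forall>v\<in>carrier_vec p. \<sigma> g *\<^sub>v (A *\<^sub>v v) = c g \<cdot>\<^sub>v (A *\<^sub>v (\<sigma> g *\<^sub>v v)))"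
    by (rule bchoice[THEN exE])
  have c_root: "c g ^ p = 1" if "g \<in> carrier G" for g using bspec[OF c that] ..
  have c0: "c g \<noteq> 0" if "g \<in> carrier G" for g using c_root[OF that] p0 by (auto simp: power_0_left)
  have shift: "A *\<^sub>v (\<sigma> g *\<^sub>v w) = (\<nu> / c g) \<cdot>\<^sub>v (\<sigma> g *\<^sub>v w)"
    if g: "g \<in> carrier G" and w: "w \<in> carrier_vec p" "A *\<^sub>v w = \<nu> \<cdot>\<^sub>v w" for g w \<nu>
  proof -
    have gw: "\<sigma> g *\<^sub>v w \<in> carrier_vec p" by (rule act(1)[OF w(1) g])
    have "c g \<cdot>\<^sub>v (A *\<^sub>v (\<sigma> g *\<^sub>v w)) = \<sigma> g *\<^sub>v (A *\<^sub>v w)"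
      by (rule bspec[OF conjunct2[OF bspec[OF c g]] w(1), symmetric])
    also have "\<dots> = \<sigma> g *\<^sub>v (\<nu> \<cdot>\<^sub>v w)" unfolding w(2) ..
    also have "\<dots> = \<nu> \<cdot>\<^sub>v (\<sigma> g *\<^sub>v w)" by (rule act(4)[OF w(1) g])
    finally have "(1 / c g) \<cdot>\<^sub>v (c g \<cdot>\<^sub>v (A *\<^sub>v (\<sigma> g *\<^sub>v w))) = (1 / c g) \<cdot>\<^sub>v (\<nu> \<cdot>\<^sub>v (\<sigma> g *\<^sub>v w))" by simp
    then show ?thesis using c0[OF g] by (simp add: smult_smult_assoc)
  qed
  obtain \<mu> v0 where "eigenvector A v0 \<mu>"
    using spectrum_non_empty[OF A p0] by (auto simp: spectrum_def eigenvalue_def)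
  then have v0: "v0 \<in> carrier_vec p" "v0 \<noteq> 0\<^sub>v p" "A *\<^sub>v v0 = \<mu> \<cdot>\<^sub>v v0"
    using A by (auto simp: eigenvector_def)
  have \<mu>: "\<mu> ^ p = 1"
    using rep_eigenvalue_root[OF \<sigma> x(1) per[OF x(1)] v0(1,2)] v0(3) by (simp add: A_def)
  then have \<mu>0: "\<mu> \<noteq> 0" using p0 by (auto simp: power_0_left)
  \<comment> \<open>otherwise an eigenspace of \<open>A\<close> is invariant, and \<open>x\<close> acts as a scalar\<close>
  have "\<exists>u\<in>carrier G. c u \<noteq> 1"
  proof (rule ccontr)
    assume "\<not> (\<exists>u\<in>carrier G. c u \<noteq> 1)"
    then have c1': "\<forall>g\<in>carrier G. c g = 1" by simp
    have c1: "c g = 1" if "g \<in> carrier G" for g by (rule bspec[OF c1' that])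
    define E where "E = {v \<in> carrier_vec p. \<forall>i\<in>{()}. A *\<^sub>v v = \<mu> \<cdot>\<^sub>v v}"
    have "E = {0\<^sub>v p} \<or> E = carrier_vec p"
    proof (rule irreducible_rep_linear_subset[OF irr])
      show "linear_subset p E" unfolding E_def by (rule linear_subset_joint_eigenspace) (rule A)
      fix g w assume g: "g \<in> carrier G" and "w \<in> E"
      then have w: "w \<in> carrier_vec p" "A *\<^sub>v w = \<mu> \<cdot>\<^sub>v w" by (auto simp: E_def)
      show "\<sigma> g *\<^sub>v w \<in> E" using shift[OF g w] c1[OF g] act(1)[OF w(1) g] by (simp add: E_def)
    qed
    then have "E = carrier_vec p" using v0 by (auto simp: E_def)
    then have "\<forall>v\<in>carrier_vec p. \<sigma> x *\<^sub>v v = \<mu> \<cdot>\<^sub>v v" by (auto simp: E_def A_def)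
    then have "x \<in> K" using x(1) unfolding K_def by blast
    then show False using x(2) by blast
  qed
  then obtain u where u: "u \<in> carrier G" "c u \<noteq> 1" by blast
  define \<zeta> where "\<zeta> = 1 / c u"
  have \<zeta>: "\<zeta> ^ p = 1" "\<zeta> \<noteq> 1" using c_root[OF u(1)] u(2) c0[OF u(1)] by (auto simp: \<zeta>_def power_divide)
  define vj where "vj = (\<lambda>j::nat. \<sigma> (u [^] j) *\<^sub>v v0)"
  have uj: "u [^] j \<in> carrier G" for j :: nat using u(1) by simp
  have vj: "vj j \<in> carrier_vec p" for j unfolding vj_def by (rule act(1)[OF v0(1) uj])
  have vj0: "vj j \<noteq> 0\<^sub>v p" for j
  proof
    assume "vj j = 0\<^sub>v p"
    then have "v0 = 0\<^sub>v p" unfolding vj_def by (rule hom_GL_cancel_zero[OF \<sigma> uj v0(1)])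
    then show False using v0(2) by blast
  qed
  have vj_eig: "A *\<^sub>v vj j = (\<mu> * \<zeta> ^ j) \<cdot>\<^sub>v vj j" for j
  proof (induction j)
    case 0
    then show ?case using v0 act(3)[OF v0(1)] by (simp add: vj_def)
  next
    case (Suc j)
    have "vj (Suc j) = \<sigma> u *\<^sub>v vj j"
      unfolding vj_def nat_pow_Suc2[OF u(1)] by (rule act(2)[OF v0(1) u(1) uj])
    then show ?case using shift[OF u(1) vj Suc] by (simp add: \<zeta>_def)
  qed
  have root_j: "\<exists>j<p. \<nu> = \<mu> * \<zeta> ^ j" if "\<nu> ^ p = 1" for \<nu>
  proof -
    have "\<nu> / \<mu> \<in> (\<lambda>j. \<zeta> ^ j) ` {..<p}"
      using root_of_unity_powers[OF p \<zeta>] that \<mu> by (simp add: bij_betw_def power_divide)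
    then obtain j where "j < p" "\<nu> / \<mu> = \<zeta> ^ j" by blast
    then show ?thesis using \<mu>0 by (intro exI[of _ j]) (simp add: field_simps)
  qed
  have all: "\<exists>v \<in> carrier_vec p. v \<noteq> 0\<^sub>v p \<and> A *\<^sub>v v = \<nu> \<cdot>\<^sub>v v" if nu: "\<nu> ^ p = 1" for \<nu>
  proof -
    obtain j where j: "\<nu> = \<mu> * \<zeta> ^ j" using root_j[OF nu] by blast
    show ?thesis unfolding j by (intro bexI[of _ "vj j"] conjI vj vj0 vj_eig)
  qed
  define R where "R = {z::complex. z ^ p = 1}"
  have R: "finite R" "card R = p"
    unfolding R_def using p0 card_roots_unity_eq[OF p0] by (auto intro!: finite_roots_unity)
  have "(\<lambda>g. \<sigma> g *\<^sub>v v0) ` carrier G \<subseteq> (\<lambda>(b, j). b \<cdot>\<^sub>v vj j) ` (R \<times> {..<p})"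
  proof
    fix w assume "w \<in> (\<lambda>g. \<sigma> g *\<^sub>v v0) ` carrier G"
    then obtain g where g: "g \<in> carrier G" "w = \<sigma> g *\<^sub>v v0" by blast
    have w: "w \<in> carrier_vec p" unfolding g(2) by (rule act(1)[OF v0(1) g(1)])
    have w_eig: "A *\<^sub>v w = (\<mu> / c g) \<cdot>\<^sub>v w" unfolding g(2) by (rule shift[OF g(1) v0(1,3)])
    have root: "(\<mu> / c g) ^ p = 1" using \<mu> c_root[OF g(1)] by (simp add: power_divide)
    obtain j where j: "j < p" "\<mu> / c g = \<mu> * \<zeta> ^ j" using root_j[OF root] by blast
    have vje: "A *\<^sub>v vj j = (\<mu> / c g) \<cdot>\<^sub>v vj j" unfolding j(2) by (rule vj_eig)
    obtain b where b: "w = b \<cdot>\<^sub>v vj j"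
      using simple_spectrum_eigenspace[OF p A A_pow all vj vj0 vje w w_eig root] by blast
    \<comment> \<open>the factor \<open>b\<close> is an eigenvalue of the group element \<open>h\<close>, hence a \<open>p\<close>-th root of unity\<close>
    define h where "h = inv (u [^] j) \<otimes> g"
    have h: "h \<in> carrier G" unfolding h_def using uj g(1) by simp
    have "\<sigma> h *\<^sub>v v0 = \<sigma> (inv (u [^] j)) *\<^sub>v w"
      unfolding h_def g(2) by (rule act(2)[OF v0(1) inv_closed[OF uj] g(1)])
    also have "\<dots> = b \<cdot>\<^sub>v (\<sigma> (inv (u [^] j)) *\<^sub>v vj j)"
      unfolding b by (rule act(4)[OF vj inv_closed[OF uj]])
    also have "\<dots> = b \<cdot>\<^sub>v v0" unfolding vj_def act(5)[OF v0(1) uj] ..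
    finally have "b ^ p = 1" by (rule rep_eigenvalue_root[OF \<sigma> h per[OF h] v0(1,2)])
    then have "(b, j) \<in> R \<times> {..<p}" using j(1) by (simp add: R_def)
    then show "w \<in> (\<lambda>(b, j). b \<cdot>\<^sub>v vj j) ` (R \<times> {..<p})" unfolding b by (intro image_eqI[of _ _ "(b, j)"]) auto
  qed
  then have "card ((\<lambda>g. \<sigma> g *\<^sub>v v0) ` carrier G) \<le> card ((\<lambda>(b, j). b \<cdot>\<^sub>v vj j) ` (R \<times> {..<p}))"
    using R(1) by (intro card_mono) auto
  also have "\<dots> \<le> card (R \<times> {..<p})" using R(1) by (intro card_image_le) auto
  also have "\<dots> = p\<^sup>2" using R by (simp add: power2_eq_square)
  finally show ?thesis using v0 by blast
qed

section \<open>Permutation representations and the upper bound\<close>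

definition perm_rep :: "nat \<Rightarrow> (nat \<Rightarrow> 'x) \<Rightarrow> ('a \<Rightarrow> 'x \<Rightarrow> 'x) \<Rightarrow> 'a \<Rightarrow> complex mat" where
  "perm_rep n e act g = mat n n (\<lambda>(i, j). if e i = act g (e j) then 1 else 0)"

lemma perm_rep_sum:
  fixes f :: "nat \<Rightarrow> complex"
  assumes e: "bij_betw e {..<n} X" and x: "x \<in> X"
  shows "(\<Sum>j\<in>{0..<n}. if e j = x then f j else 0) = f (the_inv_into {..<n} e x)"
proof -
  have inj: "inj_on e {..<n}" and im: "e ` {..<n} = X" using e by (auto simp: bij_betw_def)
  define j0 where "j0 = the_inv_into {..<n} e x"
  have j0: "j0 < n" "e j0 = x"
    using the_inv_into_into[OF inj _ order_refl, of x] f_the_inv_into_f[OF inj, of x] x im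
    by (auto simp: j0_def)
  have "(\<Sum>j\<in>{0..<n}. if e j = x then f j else 0) = (\<Sum>j\<in>{0..<n}. if j = j0 then f j else 0)"
  proof (rule sum.cong)
    fix j assume "j \<in> {0..<n}"
    then have "e j = x \<longleftrightarrow> j = j0" using inj j0 by (auto simp: inj_on_def)
    then show "(if e j = x then f j else 0) = (if j = j0 then f j else 0)" by simp
  qed simp
  also have "\<dots> = f j0" using j0 by simp
  finally show ?thesis by (simp add: j0_def)
qed

lemma (in group) perm_rep_hom:
  assumes e: "bij_betw e {..<n} X"
    and closed: "\<And>g x. g \<in> carrier G \<Longrightarrow> x \<in> X \<Longrightarrow> act g x \<in> X"
    and one: "\<And>x. x \<in> X \<Longrightarrow> act \<one> x = x"
    and mult: "\<And>g h x. g \<in> carrier G \<Longrightarrow> h \<in> carrier G \<Longrightarrow> x \<in> X \<Longrightarrow> act (g \<otimes> h) x = act g (act h x)"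
  shows "perm_rep n e act \<in> hom G (GL n)"
proof (rule hom_GL_I)
  have eX: "e i \<in> X" if "i < n" for i using e that by (auto simp: bij_betw_def)
  have inj: "inj_on e {..<n}" using e by (simp add: bij_betw_def)
  show "perm_rep n e act g \<in> carrier_mat n n" for g by (simp add: perm_rep_def)
  show "perm_rep n e act \<one> = 1\<^sub>m n"
    using one[OF eX] inj by (auto simp: perm_rep_def inj_on_def intro!: eq_matI)
  fix g h assume g: "g \<in> carrier G" and h: "h \<in> carrier G"
  show "perm_rep n e act (g \<otimes> h) = perm_rep n e act g * perm_rep n e act h"
  proof (rule eq_matI)
    fix i k assume "i < dim_row (perm_rep n e act g * perm_rep n e act h)"
      "k < dim_col (perm_rep n e act g * perm_rep n e act h)"
    then have ik: "i < n" "k < n" by (auto simp: perm_rep_def)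
    have hk: "act h (e k) \<in> X" by (rule closed[OF h eX[OF ik(2)]])
    define j0 where "j0 = the_inv_into {..<n} e (act h (e k))"
    have ej0: "e j0 = act h (e k)"
      unfolding j0_def using f_the_inv_into_f[OF inj] hk e by (simp add: bij_betw_def)
    have "(perm_rep n e act g * perm_rep n e act h) $$ (i, k)
        = (\<Sum>j\<in>{0..<n}. (if e i = act g (e j) then 1 else 0) * (if e j = act h (e k) then 1 else 0))"
      using ik by (simp add: perm_rep_def scalar_prod_def)
    also have "\<dots> = (\<Sum>j\<in>{0..<n}. if e j = act h (e k) then (if e i = act g (e j) then 1 else 0) else 0)"
      by (rule sum.cong) auto
    also have "\<dots> = (if e i = act g (e j0) then 1 else 0)"
      unfolding j0_def by (rule perm_rep_sum[OF e hk])
    also have "act g (e j0) = act (g \<otimes> h) (e k)" unfolding ej0 by (rule mult[OF g h eX[OF ik(2)], symmetric])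
    finally show "perm_rep n e act (g \<otimes> h) $$ (i, k) = (perm_rep n e act g * perm_rep n e act h) $$ (i, k)"
      using ik by (simp add: perm_rep_def)
  qed (auto simp: perm_rep_def)
qed

lemma perm_rep_quasi_permutation: "quasi_permutation_matrix (perm_rep n e act g)"
proof -
  have "(\<Sum>i<m. if Q i then 1 else 0 :: complex) \<in> \<nat>" for m and Q :: "nat \<Rightarrow> bool"
    by (induction m) auto
  then show ?thesis by (simp add: quasi_permutation_matrix_def mat_trace_def perm_rep_def)
qed

lemma perm_rep_eq_one:
  assumes "perm_rep n e act g = 1\<^sub>m n" and j: "j < n"
  shows "act g (e j) = e j"
proof -
  have "perm_rep n e act g $$ (j, j) = 1" using assms by simp
  then show ?thesis using j by (simp add: perm_rep_def split: if_splits)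
qed

lemma (in group) regular_rep_apply:
  assumes e: "bij_betw e {..<n} (carrier G)" and g: "g \<in> carrier G"
  shows "perm_rep n e (\<otimes>) g *\<^sub>v vec n (\<lambda>i. f (e i)) = vec n (\<lambda>i. f (inv g \<otimes> e i))"
proof (rule eq_vecI)
  have eX: "e i \<in> carrier G" if "i < n" for i using e that by (auto simp: bij_betw_def)
  have inj: "inj_on e {..<n}" using e by (simp add: bij_betw_def)
  fix i assume "i < dim_vec (vec n (\<lambda>i. f (inv g \<otimes> e i)))"
  then have i: "i < n" by simp
  have x: "inv g \<otimes> e i \<in> carrier G" using g eX[OF i] by simp
  have "(perm_rep n e (\<otimes>) g *\<^sub>v vec n (\<lambda>i. f (e i))) $ i
      = (\<Sum>j\<in>{0..<n}. (if e i = g \<otimes> e j then 1 else 0) * f (e j))"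
    using i by (simp add: perm_rep_def scalar_prod_def)
  also have "\<dots> = (\<Sum>j\<in>{0..<n}. if e j = inv g \<otimes> e i then f (e j) else 0)"
  proof (rule sum.cong)
    fix j assume "j \<in> {0..<n}"
    then have j: "e j \<in> carrier G" using eX by simp
    have "e i = g \<otimes> e j \<longleftrightarrow> e j = inv g \<otimes> e i" using inv_solve_left[OF j g eX[OF i]] by blast
    then show "(if e i = g \<otimes> e j then 1 else 0) * f (e j) = (if e j = inv g \<otimes> e i then f (e j) else 0)" by simp
  qed simp
  also have "\<dots> = f (e (the_inv_into {..<n} e (inv g \<otimes> e i)))" by (rule perm_rep_sum[OF e x])
  also have "e (the_inv_into {..<n} e (inv g \<otimes> e i)) = inv g \<otimes> e i"
    using f_the_inv_into_f[OF inj] x e by (simp add: bij_betw_def)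
  finally show "(perm_rep n e (\<otimes>) g *\<^sub>v vec n (\<lambda>i. f (e i))) $ i = vec n (\<lambda>i. f (inv g \<otimes> e i)) $ i"
    using i by simp
qed (simp add: perm_rep_def)

text \<open>
  If \<open>w = \<rho> s v - v\<close> is fixed by \<open>s\<close>, then \<open>\<rho> (s\<^sup>k) v = v + k w\<close> for all \<open>k\<close>, and \<open>k = p\<close> gives
  \<open>p w = 0\<close>. So the range of \<open>\<rho> s - 1\<close> contains no nonzero vector fixed by \<open>s\<close>.
\<close>

lemma (in group) no_fixed_difference:
  assumes \<rho>: "\<rho> \<in> hom G (GL n)" and s: "s \<in> carrier G" "s [^] (p::nat) = \<one>" and p: "p > 0"
    and v: "v \<in> carrier_vec n" and fixed: "\<rho> s *\<^sub>v ((\<rho> s - 1\<^sub>m n) *\<^sub>v v) = (\<rho> s - 1\<^sub>m n) *\<^sub>v v"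
  shows "(\<rho> s - 1\<^sub>m n) *\<^sub>v v = 0\<^sub>v n"
proof -
  define w where "w = (\<rho> s - 1\<^sub>m n) *\<^sub>v v"
  have sc: "\<rho> s \<in> carrier_mat n n" by (rule hom_GL_D(1)[OF \<rho> s(1)])
  have w: "w = \<rho> s *\<^sub>v v - v" unfolding w_def by (rule minus_one_mult_vec[OF sc v])
  have sv: "\<rho> s *\<^sub>v v \<in> carrier_vec n" using sc v by simp
  have wc: "w \<in> carrier_vec n" unfolding w using sv v by simp
  have sw: "\<rho> s *\<^sub>v w = w" using fixed by (simp add: w_def)
  have step: "\<rho> (s [^] k) *\<^sub>v v = v + of_nat k \<cdot>\<^sub>v w" for k :: nat
  proof (induction k)
    case 0
    then show ?case using hom_GL_act(3)[OF \<rho> v] v wc by (auto intro!: eq_vecI)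
  next
    case (Suc k)
    have kw: "of_nat k \<cdot>\<^sub>v w \<in> carrier_vec n" using wc by simp
    have "\<rho> (s [^] Suc k) *\<^sub>v v = \<rho> s *\<^sub>v (v + of_nat k \<cdot>\<^sub>v w)"
      unfolding Suc[symmetric] nat_pow_Suc2[OF s(1)] by (rule hom_GL_act(2)[OF \<rho> v s(1) nat_pow_closed[OF s(1)]])
    also have "\<dots> = \<rho> s *\<^sub>v v + \<rho> s *\<^sub>v (of_nat k \<cdot>\<^sub>v w)" by (rule mult_add_distrib_mat_vec[OF sc v kw])
    also have "\<rho> s *\<^sub>v (of_nat k \<cdot>\<^sub>v w) = of_nat k \<cdot>\<^sub>v w"
      using mult_mat_vec[OF sc wc, of "of_nat k"] sw by simp
    also have "\<rho> s *\<^sub>v v + of_nat k \<cdot>\<^sub>v w = v + of_nat (Suc k) \<cdot>\<^sub>v w"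
      unfolding w using sv v by (auto simp: algebra_simps intro!: eq_vecI)
    finally show ?case .
  qed
  have pw: "v = v + of_nat p \<cdot>\<^sub>v w" using step[of p] hom_GL_act(3)[OF \<rho> v] unfolding s(2) by simp
  have "w = 0\<^sub>v n"
  proof (rule eq_vecI)
    fix i assume "i < dim_vec (0\<^sub>v n :: complex vec)"
    then have i: "i < n" by simp
    have "v $ i = (v + of_nat p \<cdot>\<^sub>v w) $ i" using pw by simp
    then have "v $ i = v $ i + of_nat p * w $ i" using i wc v by simp
    then show "w $ i = 0\<^sub>v n $ i" using p i by simp
  qed (use wc in simp)
  then show ?thesis by (simp add: w_def)
qed

text \<open>
  In the regular representation let \<open>F\<close> be the space of \<open>T\<close>-invariant functions and \<open>U\<close> its image under
  \<open>\<rho> s - 1\<close>. Both are invariant since \<open>T\<close> and \<open>s\<close> are central, and \<open>U\<close> is nonzero since the indicator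
  function of \<open>T\<close> is moved by \<open>s \<notin> T\<close>. On \<open>U\<close> the group \<open>T\<close> acts trivially and \<open>s\<close> without nonzero
  fixed vectors. So the stabiliser of a vector with a small orbit in an irreducible constituent of
  \<open>U\<close> contains \<open>T\<close> but not \<open>s\<close>.
\<close>

lemma (in group) small_index_separating_subgroup:
  assumes p: "prime p" and ord: "Coset.order G = p ^ k"
    and per: "\<And>x. x \<in> carrier G \<Longrightarrow> x [^] p = \<one>"
    and deg: "\<forall>m \<sigma>. irreducible_rep G m \<sigma> \<longrightarrow> m = 1 \<or> m = p"
    and T: "subgroup T G" "T \<subseteq> group_center G" and s: "s \<in> group_center G" "s \<notin> T"
  shows "\<exists>H. subgroup H G \<and> T \<subseteq> H \<and> s \<notin> H \<and> card ((\<lambda>g. g <# H) ` carrier G) \<le> p\<^sup>2"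
proof -
  have p0: "p > 0" using p by (rule prime_gt_0_nat)
  have fin: "finite (carrier G)"
    using ord p0 by (intro card_ge_0_finite) (simp add: Coset.order_def)
  have sG: "s \<in> carrier G" using s(1) by (simp add: group_center_def)
  have TG: "T \<subseteq> carrier G" by (rule subgroup.subset[OF T(1)])
  define n where "n = card (carrier G)"
  obtain e where e: "bij_betw e {..<n} (carrier G)"
    using ex_bij_betw_nat_finite[OF fin] by (auto simp: n_def lessThan_atLeast0)
  have eX: "e i \<in> carrier G" if "i < n" for i using e that by (auto simp: bij_betw_def)
  define \<rho> where "\<rho> = perm_rep n e (\<otimes>)"
  have \<rho>: "\<rho> \<in> hom G (GL n)"
    unfolding \<rho>_def by (rule perm_rep_hom[OF e]) (auto simp: m_assoc)
  note c = hom_GL_D(1)[OF \<rho>]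
  define F where "F = {v \<in> carrier_vec n. \<forall>t\<in>T. \<rho> t *\<^sub>v v = 1 \<cdot>\<^sub>v v}"
  have F: "linear_subset n F"
    unfolding F_def by (rule linear_subset_joint_eigenspace) (use c TG in blast)
  define D where "D = \<rho> s - 1\<^sub>m n"
  have D: "D \<in> carrier_mat n n" unfolding D_def by (rule minus_carrier_mat) simp
  define U where "U = (\<lambda>v. D *\<^sub>v v) ` F"
  have Fc: "F \<subseteq> carrier_vec n" by (auto simp: F_def)
  have F_inv: "\<rho> g *\<^sub>v v \<in> F" if "g \<in> carrier G" "v \<in> F" for g v
    unfolding F_def
    by (rule joint_eigenspace_commuting[OF _ c[OF that(1)] _ that(2)[unfolded F_def]])
       (use c TG center_commutes[OF \<rho>] T(2) that(1) in blast)+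
  have D_comm: "\<rho> g *\<^sub>v (D *\<^sub>v v) = D *\<^sub>v (\<rho> g *\<^sub>v v)" if "g \<in> carrier G" "v \<in> carrier_vec n" for g v
    unfolding D_def by (rule center_difference_equivariant[OF \<rho> s(1) that])
  have U: "linear_subset n U" unfolding U_def by (rule linear_subset_image[OF D F])
  have U_inv: "\<rho> g *\<^sub>v v \<in> U" if g: "g \<in> carrier G" and "v \<in> U" for g v
  proof -
    obtain a where a: "a \<in> F" "v = D *\<^sub>v a" using \<open>v \<in> U\<close> by (auto simp: U_def)
    have "\<rho> g *\<^sub>v v = D *\<^sub>v (\<rho> g *\<^sub>v a)" unfolding a(2) using D_comm[OF g] a(1) Fc by blast
    then show ?thesis using F_inv[OF g a(1)] by (simp add: U_def)
  qed
  have "U \<noteq> {0\<^sub>v n}"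
  proof
    assume U0: "U = {0\<^sub>v n}"
    define f where "f = (\<lambda>x. if x \<in> T then 1 else (0::complex))"
    define v where "v = vec n (\<lambda>i. f (e i))"
    have vc: "v \<in> carrier_vec n" by (simp add: v_def)
    have "v \<in> F" unfolding F_def
    proof (intro CollectI conjI ballI vc)
      fix t assume t: "t \<in> T"
      have tG: "t \<in> carrier G" using t TG by blast
      have "inv t \<otimes> x \<in> T \<longleftrightarrow> x \<in> T" if x: "x \<in> carrier G" for x
      proof
        assume "inv t \<otimes> x \<in> T"
        then have "t \<otimes> (inv t \<otimes> x) \<in> T" by (rule subgroup.m_closed[OF T(1) t])
        then show "x \<in> T" using tG x by (simp add: m_assoc[symmetric])
      next
        assume "x \<in> T"
        then show "inv t \<otimes> x \<in> T" by (rule subgroup.m_closed[OF T(1) subgroup.m_inv_closed[OF T(1) t]])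
      qed
      then have "f (inv t \<otimes> e i) = f (e i)" if "i < n" for i using eX[OF that] by (simp add: f_def)
      then have "vec n (\<lambda>i. f (inv t \<otimes> e i)) = v" by (auto simp: v_def)
      then show "\<rho> t *\<^sub>v v = 1 \<cdot>\<^sub>v v" using regular_rep_apply[OF e tG, of f] by (simp add: \<rho>_def v_def)
    qed
    then have "D *\<^sub>v v = 0\<^sub>v n" using U0 by (auto simp: U_def)
    moreover have "D *\<^sub>v v = \<rho> s *\<^sub>v v - v" unfolding D_def by (rule minus_one_mult_vec[OF c[OF sG] vc])
    ultimately have "\<rho> s *\<^sub>v v = v"
      using vec_minus_eq_0[OF mult_mat_vec_carrier[OF c[OF sG] vc] vc] by simp
    then have eq: "vec n (\<lambda>i. f (inv s \<otimes> e i)) = v"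
      using regular_rep_apply[OF e sG, of f] by (simp add: \<rho>_def v_def)
    have "s \<in> e ` {..<n}" using e sG by (simp add: bij_betw_def)
    then obtain i where i: "i < n" "e i = s" by blast
    have "f (inv s \<otimes> e i) = f (e i)" using arg_cong[OF eq, of "\<lambda>v. v $ i"] i(1) by (simp add: v_def)
    then show False using s(2) sG subgroup.one_closed[OF T(1)] unfolding i(2) f_def by simp
  qed
  then obtain m P \<sigma> where irr: "irreducible_rep G m \<sigma>" and P: "P \<in> carrier_mat n m" "inj_mat P"
    "mat_range P \<subseteq> U" "\<forall>g\<in>carrier G. \<rho> g * P = P * \<sigma> g"
    using irreducible_subrep[OF \<rho> U _ U_inv] by blast
  have \<sigma>: "\<sigma> \<in> hom G (GL m)" using irr by (simp add: irreducible_rep_def)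
  note act = hom_GL_act[OF \<sigma>]
  note intertwine = intertwiner_mult_vec[OF \<rho> \<sigma> P(1,4)]
  have "\<exists>v\<in>carrier_vec m. v \<noteq> 0\<^sub>v m \<and> card ((\<lambda>g. \<sigma> g *\<^sub>v v) ` carrier G) \<le> p\<^sup>2"
  proof (cases "m = 1")
    case True
    have "p \<le> p\<^sup>2" using p0 by (simp add: power2_eq_square)
    then have "card ((\<lambda>g. \<sigma> g *\<^sub>v unit_vec 1 0) ` carrier G) \<le> p\<^sup>2"
      using small_orbit_degree_one[OF _ fin p per] \<sigma> True by (meson le_trans)
    then show ?thesis using True by (intro bexI[of _ "unit_vec 1 0"]) auto
  next
    case False
    then have "m = p" using deg[rule_format, OF irr] by blast
    then show ?thesis using small_orbit_degree_prime[OF p ord per] irr by blast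
  qed
  then obtain v where v: "v \<in> carrier_vec m" "v \<noteq> 0\<^sub>v m" and orb: "card ((\<lambda>g. \<sigma> g *\<^sub>v v) ` carrier G) \<le> p\<^sup>2"
    by blast
  define H where "H = {g \<in> carrier G. \<sigma> g *\<^sub>v v = v}"
  have H: "subgroup H G"
  proof (rule subgroupI)
    show "H \<noteq> {}" using act(3)[OF v(1)] by (auto simp: H_def)
    fix a assume "a \<in> H"
    then have a: "a \<in> carrier G" "\<sigma> a *\<^sub>v v = v" by (auto simp: H_def)
    show "inv a \<in> H" using act(5)[OF v(1) a(1)] a by (simp add: H_def)
    fix b assume "b \<in> H"
    then have b: "b \<in> carrier G" "\<sigma> b *\<^sub>v v = v" by (auto simp: H_def)
    show "a \<otimes> b \<in> H" using act(2)[OF v(1) a(1) b(1)] a b by (simp add: H_def)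
  qed (auto simp: H_def)
  obtain a where a: "a \<in> F" "P *\<^sub>v v = D *\<^sub>v a"
    using mult_mat_vec_in_range[OF P(1) v(1)] P(3) by (auto simp: U_def)
  have ac: "a \<in> carrier_vec n" using a(1) Fc by blast
  have "T \<subseteq> H"
  proof
    fix t assume t: "t \<in> T"
    then have tG: "t \<in> carrier G" using TG by blast
    have ta: "\<rho> t *\<^sub>v a = a" using a(1) t by (simp add: F_def)
    have "P *\<^sub>v (\<sigma> t *\<^sub>v v) = P *\<^sub>v v"
      using intertwine[OF tG v(1)] D_comm[OF tG ac] ta unfolding a(2) by simp
    then have "\<sigma> t *\<^sub>v v = v" by (rule inj_mat_cancel[OF P(2,1) act(1)[OF v(1) tG] v(1)])
    then show "t \<in> H" using tG by (simp add: H_def)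
  qed
  moreover have "s \<notin> H"
  proof
    assume "s \<in> H"
    then have sv: "\<sigma> s *\<^sub>v v = v" by (simp add: H_def)
    have "\<rho> s *\<^sub>v (D *\<^sub>v a) = D *\<^sub>v a" using intertwine[OF sG v(1)] unfolding sv a(2) by (rule sym)
    then have "D *\<^sub>v a = 0\<^sub>v n"
      unfolding D_def by (rule no_fixed_difference[OF \<rho> sG per[OF sG] p0 ac])
    then have "v = 0\<^sub>v m" using inj_matD[OF P(2,1) v(1)] a(2) by simp
    then show False using v(2) by blast
  qed
  moreover have "card ((\<lambda>g. g <# H) ` carrier G) \<le> p\<^sup>2"
  proof -
    \<comment> \<open>left cosets of the stabiliser correspond to points of the orbit\<close>
    have coset: "g <# H = {x \<in> carrier G. \<sigma> x *\<^sub>v v = \<sigma> g *\<^sub>v v}" if g: "g \<in> carrier G" for g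
    proof (intro equalityI subsetI)
      fix x assume "x \<in> g <# H"
      then obtain h where h: "h \<in> carrier G" "\<sigma> h *\<^sub>v v = v" "x = g \<otimes> h" by (auto simp: l_coset_def H_def)
      then show "x \<in> {x \<in> carrier G. \<sigma> x *\<^sub>v v = \<sigma> g *\<^sub>v v}" using g act(2)[OF v(1) g h(1)] by simp
    next
      fix x assume "x \<in> {x \<in> carrier G. \<sigma> x *\<^sub>v v = \<sigma> g *\<^sub>v v}"
      then have x: "x \<in> carrier G" "\<sigma> x *\<^sub>v v = \<sigma> g *\<^sub>v v" by auto
      have "\<sigma> (inv g \<otimes> x) *\<^sub>v v = v"
        using act(2)[OF v(1) inv_closed[OF g] x(1)] act(5)[OF v(1) g] x(2) by simp
      then have "inv g \<otimes> x \<in> H" using g x(1) by (simp add: H_def)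
      moreover have "x = g \<otimes> (inv g \<otimes> x)" using g x(1) by (simp add: m_assoc[symmetric])
      ultimately show "x \<in> g <# H" unfolding l_coset_def by blast
    qed
    have eq: "(\<lambda>g. g <# H) ` carrier G = (\<lambda>w. {x \<in> carrier G. \<sigma> x *\<^sub>v v = w}) ` ((\<lambda>g. \<sigma> g *\<^sub>v v) ` carrier G)"
      unfolding image_image by (rule image_cong[OF refl coset])
    have "card ((\<lambda>g. g <# H) ` carrier G) \<le> card ((\<lambda>g. \<sigma> g *\<^sub>v v) ` carrier G)"
      unfolding eq by (rule card_image_le[OF finite_imageI[OF fin]])
    then show ?thesis using orb by simp
  qed
  ultimately show ?thesis using H by blast
qed

lemma (in group) generating_set_of_min_size:
  assumes fin: "finite (carrier G)" and H: "subgroup H G"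
  obtains S where "S \<subseteq> H" "finite S" "generate G S = H" "card S = min_generators (G\<lparr>carrier := H\<rparr>)"
proof -
  let ?P = "\<lambda>k. \<exists>S. S \<subseteq> carrier (G\<lparr>carrier := H\<rparr>) \<and> finite S \<and> card S = k \<and>
     generate (G\<lparr>carrier := H\<rparr>) S = carrier (G\<lparr>carrier := H\<rparr>)"
  have HG: "H \<subseteq> carrier G" by (rule subgroup.subset[OF H])
  have "generate G H = H" by (rule generateI[OF H order_refl, symmetric]) (auto intro: subgroup.subset)
  then have "?P (card H)"
    using generate_consistent[OF order_refl H] finite_subset[OF HG fin] by (intro exI[of _ H]) simp
  then have "?P (min_generators (G\<lparr>carrier := H\<rparr>))" unfolding min_generators_def by (rule LeastI)
  then obtain S where S: "S \<subseteq> H" "finite S" "card S = min_generators (G\<lparr>carrier := H\<rparr>)"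
    "generate (G\<lparr>carrier := H\<rparr>) S = H" by auto
  then show ?thesis using that generate_consistent[OF S(1) H] by simp
qed

text \<open>
  \<open>G\<close> permutes the disjoint union of the coset spaces of a family of subgroups which meets the centre
  trivially. A nontrivial kernel would contain a central element different from 1; fixing the trivial
  cosets, it would lie in all these subgroups.
\<close>

lemma (in group) faithful_permutation_rep:
  assumes p: "prime p" and ord: "Coset.order G = p ^ k"
    and per: "\<And>x. x \<in> carrier G \<Longrightarrow> x [^] p = \<one>"
    and deg: "\<forall>m \<sigma>. irreducible_rep G m \<sigma> \<longrightarrow> m = 1 \<or> m = p"
  shows "\<exists>n \<le> min_generators (G\<lparr>carrier := group_center G\<rparr>) * p\<^sup>2.
           \<exists>\<rho> \<in> mon G (GL n). \<forall>g \<in> carrier G. quasi_permutation_matrix (\<rho> g)"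
proof -
  have p0: "p > 0" using p by (rule prime_gt_0_nat)
  have fin: "finite (carrier G)"
    using ord p0 by (intro card_ge_0_finite) (simp add: Coset.order_def)
  obtain S where S: "S \<subseteq> group_center G" "finite S" "generate G S = group_center G"
    "card S = min_generators (G\<lparr>carrier := group_center G\<rparr>)"
    using generating_set_of_min_size[OF fin subgroup_group_center] .
  have perZ: "s [^] p = \<one>" if "s \<in> group_center G" for s
    using per that by (simp add: group_center_def)
  define \<H> where "\<H> = {H. card ((\<lambda>g. g <# H) ` carrier G) \<le> p\<^sup>2}"
  have sep: "\<exists>H\<in>\<H>. subgroup H G \<and> T \<subseteq> H \<and> s \<notin> H"
    if "subgroup T G" "T \<subseteq> group_center G" "s \<in> group_center G - T" for T s
  proof -
    have s: "s \<in> group_center G" "s \<notin> T" using that(3) by auto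
    show ?thesis
      using small_index_separating_subgroup[OF p ord per deg that(1,2) s] by (auto simp: \<H>_def)
  qed
  obtain Hs where Hs: "finite Hs" "Hs \<subseteq> \<H>" "\<forall>H\<in>Hs. subgroup H G" "card Hs \<le> card S"
    "generate G S \<inter> \<Inter>Hs \<subseteq> {\<one>}"
  proof -
    have "\<exists>Hs. finite Hs \<and> Hs \<subseteq> \<H> \<and> (\<forall>H\<in>Hs. subgroup H G) \<and> card Hs \<le> card S \<and> generate G S \<inter> \<Inter>Hs \<subseteq> {\<one>}"
      by (rule separating_family[OF p perZ sep S(2,1)])
    then show ?thesis by (elim exE conjE) (rule that)
  qed
  define X where "X = (SIGMA H:Hs. (\<lambda>g. g <# H) ` carrier G)"
  define n where "n = card X"
  have finX: "finite X" unfolding X_def using Hs(1) fin by auto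
  have "n = (\<Sum>H\<in>Hs. card ((\<lambda>g. g <# H) ` carrier G))"
    unfolding n_def X_def using Hs(1) fin by (intro card_SigmaI) auto
  also have "\<dots> \<le> (\<Sum>H\<in>Hs. p\<^sup>2)" using Hs(2) by (intro sum_mono) (auto simp: \<H>_def)
  also have "\<dots> = card Hs * p\<^sup>2" by simp
  also have "\<dots> \<le> card S * p\<^sup>2" using Hs(4) by (rule mult_le_mono1)
  finally have n: "n \<le> min_generators (G\<lparr>carrier := group_center G\<rparr>) * p\<^sup>2" by (simp add: S(4))
  obtain e where e: "bij_betw e {..<n} X"
    using ex_bij_betw_nat_finite[OF finX] by (auto simp: n_def lessThan_atLeast0)
  define act where "act = (\<lambda>(g :: 'a) (H :: 'a set, C :: 'a set). (H, g <# C))"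
  have HG: "H \<subseteq> carrier G" if "H \<in> Hs" for H using subgroup.subset bspec[OF Hs(3) that] by blast
  have act_coset: "act g (H, h <# H) = (H, (g \<otimes> h) <# H)"
    if "g \<in> carrier G" "h \<in> carrier G" "H \<in> Hs" for g h H
    using lcos_m_assoc[OF HG[OF that(3)] that(1,2)] by (simp add: act_def)
  have X_cases: "\<exists>H\<in>Hs. \<exists>h\<in>carrier G. x = (H, h <# H)" if "x \<in> X" for x
    using that unfolding X_def by blast
  have X_intro: "(H, h <# H) \<in> X" if "H \<in> Hs" "h \<in> carrier G" for H h
    using that unfolding X_def by blast
  define \<rho> where "\<rho> = perm_rep n e act"
  have \<rho>: "\<rho> \<in> hom G (GL n)" unfolding \<rho>_def
  proof (rule perm_rep_hom[OF e])
    fix x assume "x \<in> X"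
    then obtain H h where x: "H \<in> Hs" "h \<in> carrier G" "x = (H, h <# H)" using X_cases by blast
    show "act \<one> x = x" unfolding x(3) using act_coset[OF one_closed x(2,1)] x(2) by simp
    fix g assume g: "g \<in> carrier G"
    show "act g x \<in> X" unfolding x(3) act_coset[OF g x(2,1)] using X_intro x(1,2) g by simp
    fix g' assume g': "g' \<in> carrier G"
    show "act (g \<otimes> g') x = act g (act g' x)"
      unfolding x(3) act_coset[OF g' x(2,1)] act_coset[OF m_closed[OF g g'] x(2,1)]
        act_coset[OF g m_closed[OF g' x(2)] x(1)] using g g' x(2) by (simp add: m_assoc)
  qed
  define N where "N = {g \<in> carrier G. \<rho> g = 1\<^sub>m n}"
  note \<rho>c = hom_GL_D(1)[OF \<rho>] and \<rho>m = hom_GL_D(2)[OF \<rho>]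
  have N_fix: "g \<in> H" if g: "g \<in> N" and H: "H \<in> Hs" for g H
  proof -
    have gG: "g \<in> carrier G" using g by (simp add: N_def)
    have "(H, \<one> <# H) \<in> e ` {..<n}" using X_intro[OF H one_closed] e by (simp add: bij_betw_def)
    then obtain j where j: "(H, \<one> <# H) = e j" "j \<in> {..<n}" by (rule imageE)
    have "perm_rep n e act g = 1\<^sub>m n" using g by (simp add: N_def \<rho>_def)
    then have "act g (e j) = e j" by (rule perm_rep_eq_one) (use j(2) in simp)
    then have "g <# H = \<one> <# H" unfolding j(1)[symmetric] act_coset[OF gG one_closed H] using gG by simp
    moreover have "\<one> <# H = H" by (rule lcos_mult_one[OF HG[OF H]])
    moreover have "g \<otimes> \<one> \<in> g <# H"
      using subgroup.one_closed[OF bspec[OF Hs(3) H]] unfolding l_coset_def by blast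
    ultimately show ?thesis using gG by simp
  qed
  have N_inv: "\<rho> (inv g) = 1\<^sub>m n" if g: "g \<in> carrier G" "\<rho> g = 1\<^sub>m n" for g
    using \<rho>m[of "inv g" g] hom_GL_one[OF \<rho>] \<rho>c[of "inv g"] g by simp
  have "subgroup N G"
  proof (rule subgroupI)
    show "N \<noteq> {}" using hom_GL_one[OF \<rho>] by (auto simp: N_def)
    show "inv a \<in> N" if "a \<in> N" for a using that N_inv[of a] by (simp add: N_def)
    show "a \<otimes> b \<in> N" if "a \<in> N" "b \<in> N" for a b using that \<rho>m[of a b] by (simp add: N_def)
  qed (simp add: N_def)
  moreover have "x \<otimes> h \<otimes> inv x \<in> N" if x: "x \<in> carrier G" and h: "h \<in> N" for x h
  proof -
    have hG: "h \<in> carrier G" "\<rho> h = 1\<^sub>m n" using h by (auto simp: N_def)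
    have "\<rho> (x \<otimes> h \<otimes> inv x) = \<rho> x * \<rho> (inv x)"
      using \<rho>m[of "x \<otimes> h" "inv x"] \<rho>m[of x h] \<rho>c[OF x] x hG by simp
    also have "\<dots> = 1\<^sub>m n" using \<rho>m[of x "inv x"] hom_GL_one[OF \<rho>] x by simp
    finally show ?thesis using x hG(1) by (simp add: N_def)
  qed
  ultimately have N: "N \<lhd> G" by (rule normal_invI)
  have "N = {\<one>}"
  proof (rule ccontr)
    assume "N \<noteq> {\<one>}"
    from p_group_normal_meets_center[OF p ord N this]
    obtain z where z: "z \<in> N" "z \<noteq> \<one>" "z \<in> group_center G" by (elim bexE conjE) (rule that)
    then have "z \<in> generate G S \<inter> \<Inter>Hs" using N_fix S(3) by blast
    then show False using Hs(5) z(2) by blast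
  qed
  have "inj_on \<rho> (carrier G)"
  proof (rule inj_onI)
    fix g h assume g: "g \<in> carrier G" and h: "h \<in> carrier G" and eq: "\<rho> g = \<rho> h"
    have "\<rho> (inv h \<otimes> g) = \<rho> (inv h) * \<rho> h" using \<rho>m[of "inv h" g] g h eq by simp
    also have "\<dots> = \<rho> (inv h \<otimes> h)" using \<rho>m[of "inv h" h] h by simp
    also have "\<dots> = 1\<^sub>m n" using hom_GL_one[OF \<rho>] h by simp
    finally have "inv h \<otimes> g \<in> N" using g h by (simp add: N_def)
    then have "inv h \<otimes> g = \<one>" using \<open>N = {\<one>}\<close> by simp
    moreover have "g = h \<otimes> (inv h \<otimes> g)" using g h by (simp add: m_assoc[symmetric])
    ultimately show "g = h" using h by simp
  qed
  then have "\<rho> \<in> mon G (GL n)" using \<rho> by (simp add: mon_def)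
  moreover have "\<forall>g\<in>carrier G. quasi_permutation_matrix (\<rho> g)" unfolding \<rho>_def by (simp add: perm_rep_quasi_permutation)
  ultimately show ?thesis using n by blast
qed

section \<open>The lower bound\<close>

text \<open>
  The vectors on which the centre acts through \<open>\<chi>\<close> form an invariant subspace. A constituent of degree
  1 in it would be a linear character of \<open>G\<close> which is nontrivial on the centre, and this is excluded
  by \<open>linear_character_direct_factor\<close>. So there is a constituent of degree \<open>p\<close>.
\<close>

lemma (in group) center_character_multiplicity:
  assumes p: "prime p" and per: "\<And>x. x \<in> carrier G \<Longrightarrow> x [^] p = \<one>"
    and deg: "\<forall>m \<sigma>. irreducible_rep G m \<sigma> \<longrightarrow> m = 1 \<or> m = p"
    and nc: "\<not> comm_group G" and nofactor: "\<not> has_abelian_direct_factor G"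
    and \<rho>: "\<rho> \<in> hom G (GL n)"
    and v: "v \<in> carrier_vec n" "v \<noteq> 0\<^sub>v n" "\<And>z. z \<in> group_center G \<Longrightarrow> \<rho> z *\<^sub>v v = \<chi> z \<cdot>\<^sub>v v"
    and y: "y \<in> group_center G" "\<chi> y \<noteq> 1"
  shows "\<exists>P \<in> carrier_mat n p. inj_mat P \<and>
           (\<forall>w\<in>carrier_vec p. \<forall>z\<in>group_center G. \<rho> z *\<^sub>v (P *\<^sub>v w) = \<chi> z \<cdot>\<^sub>v (P *\<^sub>v w))"
proof -
  have ZG: "z \<in> carrier G" if "z \<in> group_center G" for z using that by (simp add: group_center_def)
  note c = hom_GL_D(1)[OF \<rho>]
  define V where "V = {v \<in> carrier_vec n. \<forall>z\<in>group_center G. \<rho> z *\<^sub>v v = \<chi> z \<cdot>\<^sub>v v}"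
  have V: "linear_subset n V" unfolding V_def by (rule linear_subset_joint_eigenspace) (rule c[OF ZG])
  have "v \<in> V" using v by (simp add: V_def)
  then have "V \<noteq> {0\<^sub>v n}" using v(2) by blast
  moreover have "\<rho> g *\<^sub>v w \<in> V" if g: "g \<in> carrier G" and w: "w \<in> V" for g w
    unfolding V_def
    by (rule joint_eigenspace_commuting[OF c[OF ZG] c[OF g] center_commutes[OF \<rho> _ g] w[unfolded V_def]])
  ultimately obtain m P \<sigma> where irr: "irreducible_rep G m \<sigma>" and P: "P \<in> carrier_mat n m" "inj_mat P"
    "mat_range P \<subseteq> V" "\<forall>g\<in>carrier G. \<rho> g * P = P * \<sigma> g"
    using irreducible_subrep[OF \<rho> V] by blast
  have eig: "\<rho> z *\<^sub>v (P *\<^sub>v w) = \<chi> z \<cdot>\<^sub>v (P *\<^sub>v w)" if "w \<in> carrier_vec m" "z \<in> group_center G" for w z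
    using mult_mat_vec_in_range[OF P(1) that(1)] P(3) that(2) unfolding V_def by blast
  have "m \<noteq> 1"
  proof
    assume m: "m = 1"
    have \<sigma>: "\<sigma> \<in> hom G (GL 1)" using irr m by (simp add: irreducible_rep_def)
    define lam where "lam = (\<lambda>g. \<sigma> g $$ (0, 0))"
    have "lam (x \<otimes> y) = lam x * lam y" if "x \<in> carrier G" "y \<in> carrier G" for x y
      using hom_GL_D(2)[OF \<sigma> that] hom_GL_D(1)[OF \<sigma> that(1)] hom_GL_D(1)[OF \<sigma> that(2)]
      by (simp add: lam_def scalar_prod_def)
    moreover have "lam \<one> = 1" using hom_GL_one[OF \<sigma>] by (simp add: lam_def)
    moreover have "lam y \<noteq> 1"
    proof
      assume l1: "lam y = 1"
      have yG: "y \<in> carrier G" by (rule ZG[OF y(1)])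
      have "\<sigma> y = 1\<^sub>m 1" using hom_GL_D(1)[OF \<sigma> yG] l1 by (auto simp: lam_def intro!: eq_matI)
      then have "\<rho> y * P = P" using bspec[OF P(4) yG] P(1) m by simp
      define e where "e = (unit_vec m 0 :: complex vec)"
      have e: "e \<in> carrier_vec m" "e \<noteq> 0\<^sub>v m" using m by (auto simp: e_def)
      have Pe: "P *\<^sub>v e \<in> carrier_vec n" "P *\<^sub>v e \<noteq> 0\<^sub>v n"
        using P(1) e inj_matD[OF P(2,1) e(1)] by auto
      have "\<chi> y \<cdot>\<^sub>v (P *\<^sub>v e) = 1 \<cdot>\<^sub>v (P *\<^sub>v e)"
        using eig[OF e(1) y(1)] assoc_mult_mat_vec[OF c[OF yG] P(1) e(1)] \<open>\<rho> y * P = P\<close> by simp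
      then have "\<chi> y = 1" by (rule smult_vec_right_cancel[OF Pe])
      then show False using y(2) by blast
    qed
    ultimately have "has_abelian_direct_factor G"
      using linear_character_direct_factor[OF p per _ _ y(1) _ nc, of lam] by blast
    then show False using nofactor by blast
  qed
  then have "m = p" using deg[rule_format, OF irr] by blast
  then show ?thesis using P(1,2) eig by (intro bexI[of _ P]) auto
qed

text \<open>
  By faithfulness the range of \<open>\<rho> z - 1\<close> is nonzero. The centre acts on an irreducible constituent of
  it through a character \<open>\<chi>\<close> (Schur), and \<open>\<chi> z \<noteq> 1\<close> because this range contains no nonzero vector
  fixed by \<open>z\<close>.
\<close>

lemma (in group) faithful_rep_separates_center:
  fixes p :: nat
  assumes p: "prime p" and per: "\<And>x. x \<in> carrier G \<Longrightarrow> x [^] p = \<one>"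
    and \<rho>: "\<rho> \<in> mon G (GL n)" and z: "z \<in> group_center G" "z \<noteq> \<one>"
  shows "\<exists>\<chi>. \<chi> z \<noteq> 1 \<and> (\<exists>v\<in>carrier_vec n. v \<noteq> 0\<^sub>v n \<and> (\<forall>y\<in>group_center G. \<rho> y *\<^sub>v v = \<chi> y \<cdot>\<^sub>v v))"
proof -
  have hom: "\<rho> \<in> hom G (GL n)" and inj: "inj_on \<rho> (carrier G)" using \<rho> by (auto simp: mon_def)
  note c = hom_GL_D(1)[OF hom]
  have ZG: "z \<in> carrier G" if "z \<in> group_center G" for z using that by (simp add: group_center_def)
  have zG: "z \<in> carrier G" by (rule ZG[OF z(1)])
  define D where "D = \<rho> z - 1\<^sub>m n"
  have D: "D \<in> carrier_mat n n" unfolding D_def by (rule minus_carrier_mat) simp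
  have "mat_range D \<noteq> {0\<^sub>v n}"
  proof
    assume 0: "mat_range D = {0\<^sub>v n}"
    have "\<rho> z = \<rho> \<one>" unfolding hom_GL_one[OF hom]
    proof (rule mat_eqI_mult_vec[OF c[OF zG] one_carrier_mat])
      fix v :: "complex vec" assume v: "v \<in> carrier_vec n"
      have "\<rho> z *\<^sub>v v - v = D *\<^sub>v v" unfolding D_def by (rule minus_one_mult_vec[OF c[OF zG] v, symmetric])
      also have "\<dots> = 0\<^sub>v n" using mult_mat_vec_in_range[OF D v] 0 by simp
      finally have "\<rho> z *\<^sub>v v = v" by (rule vec_minus_eq_0[OF mult_mat_vec_carrier[OF c[OF zG] v] v])
      then show "\<rho> z *\<^sub>v v = 1\<^sub>m n *\<^sub>v v" using v by simp
    qed
    then show False using inj_onD[OF inj _ zG one_closed] z(2) by blast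
  qed
  moreover have "\<rho> g *\<^sub>v v \<in> mat_range D" if g: "g \<in> carrier G" and "v \<in> mat_range D" for g v
  proof -
    obtain a where a: "a \<in> carrier_vec n" "v = D *\<^sub>v a" using \<open>v \<in> mat_range D\<close> D by (auto simp: mat_range_def)
    have "\<rho> g *\<^sub>v v = D *\<^sub>v (\<rho> g *\<^sub>v a)"
      unfolding a(2) D_def by (rule center_difference_equivariant[OF hom z(1) g a(1)])
    then show ?thesis using mult_mat_vec_in_range[OF D mult_mat_vec_carrier[OF c[OF g] a(1)]] by simp
  qed
  ultimately obtain m P \<sigma> where irr: "irreducible_rep G m \<sigma>" and P: "P \<in> carrier_mat n m" "inj_mat P"
    "mat_range P \<subseteq> mat_range D" "\<forall>g\<in>carrier G. \<rho> g * P = P * \<sigma> g"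
    using irreducible_subrep[OF hom linear_subset_mat_range[OF D]] by blast
  have \<sigma>: "\<sigma> \<in> hom G (GL m)" and m0: "m > 0" using irr by (auto simp: irreducible_rep_def)
  note \<sigma>c = hom_GL_D(1)[OF \<sigma>]
  have "\<forall>y\<in>group_center G. \<exists>b. \<forall>v\<in>carrier_vec m. \<sigma> y *\<^sub>v v = b \<cdot>\<^sub>v v"
  proof
    fix y assume y: "y \<in> group_center G"
    show "\<exists>b. \<forall>v\<in>carrier_vec m. \<sigma> y *\<^sub>v v = b \<cdot>\<^sub>v v"
      by (rule schur_scalar[OF irr \<sigma>c[OF ZG[OF y]] center_commutes[OF \<sigma> y]])
  qed
  then obtain \<chi> where \<chi>: "\<forall>y\<in>group_center G. \<forall>v\<in>carrier_vec m. \<sigma> y *\<^sub>v v = \<chi> y \<cdot>\<^sub>v v"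
    by (rule bchoice[THEN exE])
  define e where "e = (unit_vec m 0 :: complex vec)"
  have e: "e \<in> carrier_vec m" "e \<noteq> 0\<^sub>v m" using m0 by (auto simp: e_def)
  have Pe: "P *\<^sub>v e \<in> carrier_vec n" "P *\<^sub>v e \<noteq> 0\<^sub>v n"
    using P(1) e inj_matD[OF P(2,1) e(1)] by auto
  have eig: "\<rho> y *\<^sub>v (P *\<^sub>v e) = \<chi> y \<cdot>\<^sub>v (P *\<^sub>v e)" if y: "y \<in> group_center G" for y
  proof -
    have "\<rho> y *\<^sub>v (P *\<^sub>v e) = P *\<^sub>v (\<sigma> y *\<^sub>v e)"
      by (rule intertwiner_mult_vec[OF hom \<sigma> P(1,4) ZG[OF y] e(1), symmetric])
    also have "\<sigma> y *\<^sub>v e = \<chi> y \<cdot>\<^sub>v e" by (rule bspec[OF bspec[OF \<chi> y] e(1)])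
    also have "P *\<^sub>v (\<chi> y \<cdot>\<^sub>v e) = \<chi> y \<cdot>\<^sub>v (P *\<^sub>v e)" by (rule mult_mat_vec[OF P(1) e(1)])
    finally show ?thesis .
  qed
  have "\<chi> z \<noteq> 1"
  proof
    assume "\<chi> z = 1"
    then have fixed: "\<rho> z *\<^sub>v (P *\<^sub>v e) = P *\<^sub>v e" using eig[OF z(1)] by simp
    have "P *\<^sub>v e \<in> mat_range D" using mult_mat_vec_in_range[OF P(1) e(1)] P(3) by blast
    then obtain a where a: "a \<in> carrier_vec n" "P *\<^sub>v e = D *\<^sub>v a" using D by (auto simp: mat_range_def)
    have "D *\<^sub>v a = 0\<^sub>v n"
      using fixed unfolding a(2) D_def
      by (rule no_fixed_difference[OF hom zG per[OF zG] prime_gt_0_nat[OF p] a(1)])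
    then show False using Pe(2) a(2) by simp
  qed
  then show ?thesis using Pe eig by blast
qed

text \<open>
  Placing the blocks side by side keeps injectivity: the operator \<open>B \<chi>\<close> fixes all blocks except the one
  of \<open>\<chi>\<close>, which it multiplies by \<open>\<zeta> \<noteq> 1\<close>. The clause about \<open>K - L\<close> carries this through the induction.
\<close>

lemma independent_character_blocks:
  fixes A :: "complex mat" and B :: "'c \<Rightarrow> complex mat" and \<zeta> :: complex
  assumes fin: "finite L" and LK: "L \<subseteq> K" and \<zeta>: "\<zeta> \<noteq> 1"
    and A: "A \<in> carrier_mat n n" and B: "\<And>\<chi>. \<chi> \<in> K \<Longrightarrow> B \<chi> \<in> carrier_mat n n"
    and P: "\<And>\<chi>. \<chi> \<in> K \<Longrightarrow> P \<chi> \<in> carrier_mat n m" and inj: "\<And>\<chi>. \<chi> \<in> K \<Longrightarrow> inj_mat (P \<chi>)"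
    and AP: "\<And>\<chi> w. \<chi> \<in> K \<Longrightarrow> w \<in> carrier_vec m \<Longrightarrow> A *\<^sub>v (P \<chi> *\<^sub>v w) = \<zeta> \<cdot>\<^sub>v (P \<chi> *\<^sub>v w)"
    and BP: "\<And>\<chi> \<psi> w. \<chi> \<in> K \<Longrightarrow> \<psi> \<in> K \<Longrightarrow> w \<in> carrier_vec m \<Longrightarrow>
       B \<psi> *\<^sub>v (P \<chi> *\<^sub>v w) = (if \<chi> = \<psi> then \<zeta> else 1) \<cdot>\<^sub>v (P \<chi> *\<^sub>v w)"
  shows "\<exists>Q \<in> carrier_mat n (m * card L). inj_mat Q \<and>
     (\<forall>w\<in>carrier_vec (m * card L). A *\<^sub>v (Q *\<^sub>v w) = \<zeta> \<cdot>\<^sub>v (Q *\<^sub>v w) \<and>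
        (\<forall>\<psi>\<in>K - L. B \<psi> *\<^sub>v (Q *\<^sub>v w) = Q *\<^sub>v w))"
  using fin LK
proof (induction L rule: finite_induct)
  case empty
  have 0: "(0\<^sub>m n 0 :: complex mat) *\<^sub>v w = 0\<^sub>v n" if "w \<in> carrier_vec 0" for w
    using that by (auto simp: scalar_prod_def intro!: eq_vecI)
  have "A *\<^sub>v 0\<^sub>v n = \<zeta> \<cdot>\<^sub>v 0\<^sub>v n" using A by (auto intro!: eq_vecI)
  moreover have "B \<psi> *\<^sub>v 0\<^sub>v n = 0\<^sub>v n" if "\<psi> \<in> K" for \<psi> using B[OF that] by (auto intro!: eq_vecI)
  moreover have "inj_mat (0\<^sub>m n 0 :: complex mat)" by (rule inj_matI[of _ n 0]) auto
  ultimately show ?case using 0 by (intro bexI[of _ "0\<^sub>m n 0"]) auto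
next
  case (insert \<chi> L)
  have LK: "L \<subseteq> K" and \<chi>: "\<chi> \<in> K" using insert.prems by auto
  obtain Q where Q: "Q \<in> carrier_mat n (m * card L)" "inj_mat Q"
    and Qe: "\<forall>w\<in>carrier_vec (m * card L). A *\<^sub>v (Q *\<^sub>v w) = \<zeta> \<cdot>\<^sub>v (Q *\<^sub>v w) \<and>
        (\<forall>\<psi>\<in>K - L. B \<psi> *\<^sub>v (Q *\<^sub>v w) = Q *\<^sub>v w)"
    using insert.IH[OF LK] by (elim bexE conjE) (rule that)
  have AQ: "A *\<^sub>v (Q *\<^sub>v w) = \<zeta> \<cdot>\<^sub>v (Q *\<^sub>v w)" if "w \<in> carrier_vec (m * card L)" for w
    using bspec[OF Qe that] ..
  have BQ: "B \<psi> *\<^sub>v (Q *\<^sub>v w) = Q *\<^sub>v w" if "w \<in> carrier_vec (m * card L)" "\<psi> \<in> K - L" for w \<psi>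
    by (rule bspec[OF conjunct2[OF bspec[OF Qe that(1)]] that(2)])
  have card: "m * card (insert \<chi> L) = m * card L + m" using insert.hyps by simp
  define Q' where "Q' = hcat Q (P \<chi>)"
  have Q': "Q' \<in> carrier_mat n (m * card L + m)" unfolding Q'_def by (rule hcat_carrier[OF Q(1) P[OF \<chi>]])
  have split: "\<exists>a b. a \<in> carrier_vec (m * card L) \<and> b \<in> carrier_vec m \<and> Q' *\<^sub>v w = Q *\<^sub>v a + P \<chi> *\<^sub>v b"
    if w: "w \<in> carrier_vec (m * card L + m)" for w
  proof -
    define a where "a = vec_first w (m * card L)"
    define b where "b = vec_last w m"
    have ab: "a @\<^sub>v b = w" "a \<in> carrier_vec (m * card L)" "b \<in> carrier_vec m"
      using w unfolding a_def b_def by auto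
    have "Q' *\<^sub>v w = Q *\<^sub>v a + P \<chi> *\<^sub>v b"
      using hcat_mult_vec[OF Q(1) P[OF \<chi>] ab(2,3)] unfolding ab(1) Q'_def .
    then show ?thesis using ab by blast
  qed
  have "inj_mat Q'" unfolding Q'_def
  proof (rule inj_mat_hcat[OF Q(1) P[OF \<chi>]])
    fix a b :: "complex vec"
    assume a: "a \<in> carrier_vec (m * card L)" and b: "b \<in> carrier_vec m" and sum0: "Q *\<^sub>v a + P \<chi> *\<^sub>v b = 0\<^sub>v n"
    have Qa: "Q *\<^sub>v a \<in> carrier_vec n" using Q a by simp
    have Pb: "P \<chi> *\<^sub>v b \<in> carrier_vec n" using P[OF \<chi>] b by simp
    \<comment> \<open>subtract the relation from its image under \<open>B \<chi>\<close>; only the new block survives\<close>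
    have "B \<chi> *\<^sub>v (Q *\<^sub>v a + P \<chi> *\<^sub>v b) = B \<chi> *\<^sub>v (Q *\<^sub>v a) + B \<chi> *\<^sub>v (P \<chi> *\<^sub>v b)"
      by (rule mult_add_distrib_mat_vec[OF B[OF \<chi>] Qa Pb])
    also have "B \<chi> *\<^sub>v (Q *\<^sub>v a) = Q *\<^sub>v a" using BQ[OF a] \<chi> insert.hyps(2) by simp
    also have "B \<chi> *\<^sub>v (P \<chi> *\<^sub>v b) = \<zeta> \<cdot>\<^sub>v (P \<chi> *\<^sub>v b)" using BP[OF \<chi> \<chi> b] by simp
    also have "B \<chi> *\<^sub>v (Q *\<^sub>v a + P \<chi> *\<^sub>v b) = 0\<^sub>v n"
      unfolding sum0 using B[OF \<chi>] by (auto intro!: eq_vecI)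
    finally have sum1: "0\<^sub>v n = Q *\<^sub>v a + \<zeta> \<cdot>\<^sub>v (P \<chi> *\<^sub>v b)" .
    have "P \<chi> *\<^sub>v b = 0\<^sub>v n"
    proof (rule eq_vecI)
      fix i assume "i < dim_vec (0\<^sub>v n :: complex vec)"
      then have i: "i < n" by simp
      have 1: "(Q *\<^sub>v a) $ i + (P \<chi> *\<^sub>v b) $ i = 0"
        using arg_cong[OF sum0, of "\<lambda>v. v $ i"] i Q(1) P[OF \<chi>] by simp
      have 2: "(Q *\<^sub>v a) $ i + \<zeta> * (P \<chi> *\<^sub>v b) $ i = 0"
        using arg_cong[OF sum1, of "\<lambda>v. v $ i"] i Q(1) P[OF \<chi>] by simp
      have "(\<zeta> - 1) * (P \<chi> *\<^sub>v b) $ i = 0"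
        using arg_cong2[OF 2 1, of "(-)"] by (simp add: algebra_simps)
      then show "(P \<chi> *\<^sub>v b) $ i = 0\<^sub>v n $ i" using \<zeta> i by simp
    qed (use P[OF \<chi>] in simp)
    then have b0: "b = 0\<^sub>v m" by (rule inj_matD[OF inj[OF \<chi>] P[OF \<chi>] b])
    have "Q *\<^sub>v a = 0\<^sub>v n" using sum0 \<open>P \<chi> *\<^sub>v b = 0\<^sub>v n\<close> right_zero_vec[OF Qa] by simp
    then have "a = 0\<^sub>v (m * card L)" by (rule inj_matD[OF Q(2,1) a])
    then show "a = 0\<^sub>v (m * card L) \<and> b = 0\<^sub>v m" using b0 by blast
  qed
  moreover have "A *\<^sub>v (Q' *\<^sub>v w) = \<zeta> \<cdot>\<^sub>v (Q' *\<^sub>v w) \<and> (\<forall>\<psi>\<in>K - insert \<chi> L. B \<psi> *\<^sub>v (Q' *\<^sub>v w) = Q' *\<^sub>v w)"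
    if w: "w \<in> carrier_vec (m * card L + m)" for w
  proof -
    obtain a b where a: "a \<in> carrier_vec (m * card L)" and b: "b \<in> carrier_vec m"
      and ab: "Q' *\<^sub>v w = Q *\<^sub>v a + P \<chi> *\<^sub>v b" using split[OF w] by blast
    have Qa: "Q *\<^sub>v a \<in> carrier_vec n" using Q a by simp
    have Pb: "P \<chi> *\<^sub>v b \<in> carrier_vec n" using P[OF \<chi>] b by simp
    have "A *\<^sub>v (Q' *\<^sub>v w) = \<zeta> \<cdot>\<^sub>v (Q' *\<^sub>v w)"
      unfolding ab mult_add_distrib_mat_vec[OF A Qa Pb] AQ[OF a] AP[OF \<chi> b]
      by (rule smult_add_distrib_vec[OF Qa Pb, symmetric])
    moreover have "B \<psi> *\<^sub>v (Q' *\<^sub>v w) = Q' *\<^sub>v w" if \<psi>: "\<psi> \<in> K - insert \<chi> L" for \<psi>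
    proof -
      have "\<psi> \<in> K" "\<psi> \<in> K - L" "\<chi> \<noteq> \<psi>" using \<psi> by auto
      then show ?thesis
        unfolding ab mult_add_distrib_mat_vec[OF B[OF \<open>\<psi> \<in> K\<close>] Qa Pb]
        using BQ[OF a \<open>\<psi> \<in> K - L\<close>] BP[OF \<chi> \<open>\<psi> \<in> K\<close> b] by simp
    qed
    ultimately show ?thesis by blast
  qed
  ultimately show ?case unfolding card by (intro bexI[OF _ Q'] conjI[of "inj_mat Q'"] ballI)
qed

text \<open>
  All characters of the dual family take the value \<open>\<zeta>\<close> at the single element \<open>z\<close>, so the blocks of
  \<open>p\<close> columns belonging to them add up inside one eigenspace of \<open>\<rho> z\<close>, and only the trace of
  \<open>\<rho> z\<close> has to be examined.
\<close>

lemma (in group) faithful_quasi_permutation_degree: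
  assumes p: "prime p" and fin: "finite (carrier G)"
    and per: "\<And>x. x \<in> carrier G \<Longrightarrow> x [^] p = \<one>"
    and deg: "\<forall>m \<sigma>. irreducible_rep G m \<sigma> \<longrightarrow> m = 1 \<or> m = p"
    and nc: "\<not> comm_group G" and nofactor: "\<not> has_abelian_direct_factor G"
    and \<rho>: "\<rho> \<in> mon G (GL n)" and qp: "\<forall>g \<in> carrier G. quasi_permutation_matrix (\<rho> g)"
  shows "min_generators (G\<lparr>carrier := group_center G\<rparr>) * p\<^sup>2 \<le> n"
proof -
  have p2: "p \<ge> 2" using p by (rule prime_ge_2_nat)
  have hom: "\<rho> \<in> hom G (GL n)" using \<rho> by (simp add: mon_def)
  note c = hom_GL_D(1)[OF hom]
  define Z where "Z = G\<lparr>carrier := group_center G\<rparr>"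
  have ZG: "z \<in> carrier G" if "z \<in> group_center G" for z using that by (simp add: group_center_def)
  have Zsub: "group_center G \<subseteq> carrier G" using ZG by blast
  have Z_comm: "x \<otimes>\<^bsub>Z\<^esub> y = y \<otimes>\<^bsub>Z\<^esub> x" if "x \<in> carrier Z" "y \<in> carrier Z" for x y
  proof -
    have "x \<in> group_center G" "y \<in> carrier G" using that ZG by (simp_all add: Z_def)
    then have "x \<otimes> y = y \<otimes> x" unfolding group_center_def by blast
    then show ?thesis by (simp add: Z_def)
  qed
  have "group Z" unfolding Z_def by (rule subgroup.subgroup_is_group[OF subgroup_group_center is_group])
  then interpret Z: comm_group Z
    by (rule group.group_comm_groupI) (rule Z_comm)
  define \<Lambda> where "\<Lambda> = {\<chi>. \<exists>v\<in>carrier_vec n. v \<noteq> 0\<^sub>v n \<and> (\<forall>y\<in>group_center G. \<rho> y *\<^sub>v v = \<chi> y \<cdot>\<^sub>v v)}"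
  have "{z::complex. z ^ p = 1} \<noteq> {1}"
    using card_roots_unity_eq[of p] p2 by (intro notI) simp
  moreover have "(1::complex) \<in> {z. z ^ p = 1}" by simp
  ultimately obtain \<zeta> :: complex where \<zeta>: "\<zeta> ^ p = 1" "\<zeta> \<noteq> 1" by blast
  have "\<exists>\<Lambda>' d z. \<Lambda>' \<subseteq> \<Lambda> \<and> finite \<Lambda>' \<and> min_generators Z \<le> card \<Lambda>' \<and>
     (\<forall>\<chi>\<in>\<Lambda>'. d \<chi> \<in> carrier Z) \<and> (\<forall>\<chi>\<in>\<Lambda>'. \<forall>\<psi>\<in>\<Lambda>'. \<chi> (d \<psi>) = (if \<chi> = \<psi> then \<zeta> else 1)) \<and>
     z \<in> carrier Z \<and> (\<forall>\<chi>\<in>\<Lambda>'. \<chi> z = \<zeta>)"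
  proof (rule Z.dual_family[OF p])
    show "finite (carrier Z)" using finite_subset[OF Zsub fin] by (simp add: Z_def)
    show "x [^]\<^bsub>Z\<^esub> p = \<one>\<^bsub>Z\<^esub>" if "x \<in> carrier Z" for x
      using per[of x] ZG[of x] that by (simp add: Z_def nat_pow_consistent[symmetric])
    show "\<chi> \<one>\<^bsub>Z\<^esub> = 1" if chi: "\<chi> \<in> \<Lambda>" for \<chi>
    proof -
      obtain v where v: "v \<in> carrier_vec n" "v \<noteq> 0\<^sub>v n" "\<forall>y\<in>group_center G. \<rho> y *\<^sub>v v = \<chi> y \<cdot>\<^sub>v v"
        using chi unfolding \<Lambda>_def by blast
      have "\<one> \<in> group_center G" by (rule subgroup.one_closed[OF subgroup_group_center])
      then have "\<chi> \<one> \<cdot>\<^sub>v v = 1 \<cdot>\<^sub>v v" using bspec[OF v(3)] hom_GL_act(3)[OF hom v(1)] by simp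
      then show ?thesis using smult_vec_right_cancel[OF v(1,2)] by (simp add: Z_def)
    qed
    show "\<chi> (x \<otimes>\<^bsub>Z\<^esub> y) = \<chi> x * \<chi> y" if chi: "\<chi> \<in> \<Lambda>" and "x \<in> carrier Z" "y \<in> carrier Z" for \<chi> x y
    proof -
      obtain v where v: "v \<in> carrier_vec n" "v \<noteq> 0\<^sub>v n" "\<forall>y\<in>group_center G. \<rho> y *\<^sub>v v = \<chi> y \<cdot>\<^sub>v v"
        using chi unfolding \<Lambda>_def by blast
      have xy: "x \<in> group_center G" "y \<in> group_center G" using that by (auto simp: Z_def)
      have xyZ: "x \<otimes> y \<in> group_center G" by (rule subgroup.m_closed[OF subgroup_group_center xy])
      have "\<chi> (x \<otimes> y) \<cdot>\<^sub>v v = \<rho> x *\<^sub>v (\<rho> y *\<^sub>v v)"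
        using bspec[OF v(3) xyZ] hom_GL_act(2)[OF hom v(1) ZG[OF xy(1)] ZG[OF xy(2)]] by simp
      also have "\<dots> = \<chi> y \<cdot>\<^sub>v (\<chi> x \<cdot>\<^sub>v v)"
        unfolding bspec[OF v(3) xy(2)] bspec[OF v(3) xy(1), symmetric]
        by (rule hom_GL_act(4)[OF hom v(1) ZG[OF xy(1)]])
      also have "\<dots> = (\<chi> x * \<chi> y) \<cdot>\<^sub>v v" by (simp add: smult_smult_assoc mult.commute)
      finally show ?thesis using smult_vec_right_cancel[OF v(1,2)] by (simp add: Z_def)
    qed
    show "\<exists>\<chi>\<in>\<Lambda>. \<chi> z \<noteq> 1" if z: "z \<in> carrier Z" "z \<noteq> \<one>\<^bsub>Z\<^esub>" for z
    proof -
      have zc: "z \<in> group_center G" "z \<noteq> \<one>" using z by (simp_all add: Z_def)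
      have "\<exists>\<chi>. \<chi> z \<noteq> 1 \<and> (\<exists>v\<in>carrier_vec n. v \<noteq> 0\<^sub>v n \<and> (\<forall>y\<in>group_center G. \<rho> y *\<^sub>v v = \<chi> y \<cdot>\<^sub>v v))"
        by (rule faithful_rep_separates_center[OF p per \<rho> zc])
      then obtain \<chi> where \<chi>: "\<chi> z \<noteq> 1"
        and "\<exists>v\<in>carrier_vec n. v \<noteq> 0\<^sub>v n \<and> (\<forall>y\<in>group_center G. \<rho> y *\<^sub>v v = \<chi> y \<cdot>\<^sub>v v)"
        by (elim exE conjE) (rule that)
      then have "\<chi> \<in> \<Lambda>" unfolding \<Lambda>_def by (intro CollectI)
      with \<chi> show ?thesis by (rule bexI)
    qed
  qed (rule \<zeta>)+
  then obtain \<Lambda>' d z where sub: "\<Lambda>' \<subseteq> \<Lambda>" and fin': "finite \<Lambda>'" and gens: "min_generators Z \<le> card \<Lambda>'"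
    and d: "\<forall>\<chi>\<in>\<Lambda>'. d \<chi> \<in> carrier Z" and dual: "\<forall>\<chi>\<in>\<Lambda>'. \<forall>\<psi>\<in>\<Lambda>'. \<chi> (d \<psi>) = (if \<chi> = \<psi> then \<zeta> else 1)"
    and z: "z \<in> carrier Z" and \<chi>z: "\<forall>\<chi>\<in>\<Lambda>'. \<chi> z = \<zeta>"
    by (elim exE conjE) (rule that)
  have dZ: "d \<chi> \<in> group_center G" if "\<chi> \<in> \<Lambda>'" for \<chi> using bspec[OF d that] by (simp add: Z_def)
  have zZ: "z \<in> group_center G" using z by (simp add: Z_def)
  have "\<forall>\<chi>\<in>\<Lambda>'. \<exists>P. P \<in> carrier_mat n p \<and> inj_mat P \<and>
           (\<forall>w\<in>carrier_vec p. \<forall>z\<in>group_center G. \<rho> z *\<^sub>v (P *\<^sub>v w) = \<chi> z \<cdot>\<^sub>v (P *\<^sub>v w))"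
  proof
    fix \<chi> assume \<chi>: "\<chi> \<in> \<Lambda>'"
    then obtain v where v: "v \<in> carrier_vec n" "v \<noteq> 0\<^sub>v n" "\<forall>y\<in>group_center G. \<rho> y *\<^sub>v v = \<chi> y \<cdot>\<^sub>v v"
      using sub unfolding \<Lambda>_def by blast
    have ne: "\<chi> z \<noteq> 1" using bspec[OF \<chi>z \<chi>] \<zeta>(2) by simp
    have "\<exists>P \<in> carrier_mat n p. inj_mat P \<and>
           (\<forall>w\<in>carrier_vec p. \<forall>z\<in>group_center G. \<rho> z *\<^sub>v (P *\<^sub>v w) = \<chi> z \<cdot>\<^sub>v (P *\<^sub>v w))"
      by (rule center_character_multiplicity[OF p per deg nc nofactor hom v(1,2) bspec[OF v(3)] zZ ne])
    then show "\<exists>P. P \<in> carrier_mat n p \<and> inj_mat P \<and>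
           (\<forall>w\<in>carrier_vec p. \<forall>z\<in>group_center G. \<rho> z *\<^sub>v (P *\<^sub>v w) = \<chi> z \<cdot>\<^sub>v (P *\<^sub>v w))" by blast
  qed
  then obtain P where P: "\<forall>\<chi>\<in>\<Lambda>'. P \<chi> \<in> carrier_mat n p \<and> inj_mat (P \<chi>) \<and>
           (\<forall>w\<in>carrier_vec p. \<forall>z\<in>group_center G. \<rho> z *\<^sub>v (P \<chi> *\<^sub>v w) = \<chi> z \<cdot>\<^sub>v (P \<chi> *\<^sub>v w))"
    by (rule bchoice[THEN exE])
  have eig: "\<rho> y *\<^sub>v (P \<chi> *\<^sub>v w) = \<chi> y \<cdot>\<^sub>v (P \<chi> *\<^sub>v w)"
    if "\<chi> \<in> \<Lambda>'" "w \<in> carrier_vec p" "y \<in> group_center G" for \<chi> w y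
    using bspec[OF P that(1)] that(2,3) by blast
  have "\<exists>Q \<in> carrier_mat n (p * card \<Lambda>'). inj_mat Q \<and>
     (\<forall>w\<in>carrier_vec (p * card \<Lambda>'). \<rho> z *\<^sub>v (Q *\<^sub>v w) = \<zeta> \<cdot>\<^sub>v (Q *\<^sub>v w) \<and>
        (\<forall>\<psi>\<in>\<Lambda>' - \<Lambda>'. \<rho> (d \<psi>) *\<^sub>v (Q *\<^sub>v w) = Q *\<^sub>v w))"
  proof (rule independent_character_blocks[OF fin' order_refl \<zeta>(2) c[OF ZG[OF zZ]], where P = P])
    show "\<rho> (d \<chi>) \<in> carrier_mat n n" if "\<chi> \<in> \<Lambda>'" for \<chi> by (rule c[OF ZG[OF dZ[OF that]]])
    show "P \<chi> \<in> carrier_mat n p" "inj_mat (P \<chi>)" if "\<chi> \<in> \<Lambda>'" for \<chi> using bspec[OF P that] by blast+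
    show "\<rho> z *\<^sub>v (P \<chi> *\<^sub>v w) = \<zeta> \<cdot>\<^sub>v (P \<chi> *\<^sub>v w)" if "\<chi> \<in> \<Lambda>'" "w \<in> carrier_vec p" for \<chi> w
      using eig[OF that zZ] bspec[OF \<chi>z that(1)] by simp
    show "\<rho> (d \<psi>) *\<^sub>v (P \<chi> *\<^sub>v w) = (if \<chi> = \<psi> then \<zeta> else 1) \<cdot>\<^sub>v (P \<chi> *\<^sub>v w)"
      if "\<chi> \<in> \<Lambda>'" "\<psi> \<in> \<Lambda>'" "w \<in> carrier_vec p" for \<chi> \<psi> w
      using eig[OF that(1,3) dZ[OF that(2)]] bspec[OF bspec[OF dual that(1)] that(2)] by simp
  qed
  then obtain Q where Q: "Q \<in> carrier_mat n (p * card \<Lambda>')" "inj_mat Q"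
    and zQ: "\<forall>w\<in>carrier_vec (p * card \<Lambda>'). \<rho> z *\<^sub>v (Q *\<^sub>v w) = \<zeta> \<cdot>\<^sub>v (Q *\<^sub>v w)" by blast
  have zG: "z \<in> carrier G" by (rule ZG[OF zZ])
  have "\<rho> z ^\<^sub>m p = 1\<^sub>m n"
    unfolding hom_GL_pow[OF hom zG, symmetric] per[OF zG] by (rule hom_GL_one[OF hom])
  from finite_order_eigenvalues[OF c[OF zG] this]
  obtain \<mu> where tr: "mat_trace (\<rho> z) = (\<Sum>i<n. \<mu> i)" and root: "\<forall>i<n. \<mu> i ^ p = 1"
    and cnt: "\<forall>c m Q. Q \<in> carrier_mat n m \<and> inj_mat Q \<and>
        (\<forall>v\<in>carrier_vec m. \<rho> z *\<^sub>v (Q *\<^sub>v v) = c \<cdot>\<^sub>v (Q *\<^sub>v v)) \<longrightarrow> m \<le> card {i. i < n \<and> \<mu> i = c}"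
    by (elim exE conjE) (rule that)
  have le: "p * card \<Lambda>' \<le> card {i. i < n \<and> \<mu> i = \<zeta>}"
    using cnt[rule_format, of Q "p * card \<Lambda>'" \<zeta>] Q zQ by blast
  have "(\<Sum>i<n. \<mu> i) \<in> \<nat>"
    using bspec[OF qp zG] unfolding quasi_permutation_matrix_def tr[symmetric] ..
  then have "p * card {i. i < n \<and> \<mu> i = \<zeta>} \<le> n"
    using sum_roots_of_unity_nat[OF p _ _ \<zeta>, of n \<mu>] root by blast
  then have "p * (p * card \<Lambda>') \<le> n" using mult_le_mono2[OF le, of p] by linarith
  then have "card \<Lambda>' * p\<^sup>2 \<le> n" by (simp add: power2_eq_square mult.assoc mult.commute mult.left_commute)
  then show ?thesis using mult_le_mono1[OF gens, of "p\<^sup>2"] unfolding Z_def by linarith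
qed

section \<open>The quasi-permutation degree\<close>

theorem corollary4:
  fixes G :: "('a, 'b) monoid_scheme" and p :: nat
  assumes "prime p"
    and "group G" and "finite (carrier G)" and "\<not> comm_group G"
    and "\<exists>n. Coset.order G = p ^ n"
    and "group_exponent G = p"
    and "cd G = {1, of_nat p}"
  shows "quasi_perm_degree G \<le> min_generators (G\<lparr>carrier := group_center G\<rparr>) * p\<^sup>2 \<and>
         (p \<ge> 3 \<and> \<not> has_abelian_direct_factor G \<longrightarrow>
            quasi_perm_degree G = min_generators (G\<lparr>carrier := group_center G\<rparr>) * p\<^sup>2)"
proof -
  interpret group G by fact
  obtain k where ord: "Coset.order G = p ^ k" using assms(5) by blast
  have exp: "group_exponent G > 0 \<and> (\<forall>x\<in>carrier G. x [^]\<^bsub>G\<^esub> group_exponent G = \<one>\<^bsub>G\<^esub>)"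
    unfolding group_exponent_def
  proof (rule LeastI)
    show "0 < Coset.order G \<and> (\<forall>x\<in>carrier G. x [^]\<^bsub>G\<^esub> Coset.order G = \<one>\<^bsub>G\<^esub>)"
      using ord prime_gt_0_nat[OF assms(1)] pow_order_eq_1 by simp
  qed
  have per: "x [^]\<^bsub>G\<^esub> p = \<one>\<^bsub>G\<^esub>" if "x \<in> carrier G" for x using exp that assms(6) by simp
  have deg: "\<forall>m \<sigma>. irreducible_rep G m \<sigma> \<longrightarrow> m = 1 \<or> m = p"
  proof (intro allI impI)
    fix m \<sigma> assume "irreducible_rep G m \<sigma>"
    then have "of_nat m \<in> cd G" by (rule irreducible_rep_degree)
    then show "m = 1 \<or> m = p" unfolding assms(7) by auto
  qed
  define d where "d = min_generators (G\<lparr>carrier := group_center G\<rparr>)"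
  obtain n \<rho> where n: "n \<le> d * p\<^sup>2" and \<rho>: "\<rho> \<in> mon G (GL n)" "\<forall>g \<in> carrier G. quasi_permutation_matrix (\<rho> g)"
  proof -
    have "\<exists>n \<le> d * p\<^sup>2. \<exists>\<rho> \<in> mon G (GL n). \<forall>g \<in> carrier G. quasi_permutation_matrix (\<rho> g)"
      unfolding d_def by (rule faithful_permutation_rep[OF assms(1) ord per deg])
    then show ?thesis by (elim exE bexE conjE) (rule that)
  qed
  have "quasi_perm_degree G \<le> n" unfolding quasi_perm_degree_def using \<rho> by (intro Least_le) blast
  then have upper: "quasi_perm_degree G \<le> d * p\<^sup>2" using n by simp
  moreover have "quasi_perm_degree G = d * p\<^sup>2" if nofactor: "\<not> has_abelian_direct_factor G"
  proof -
    have "\<exists>\<rho> \<in> mon G (GL (quasi_perm_degree G)). \<forall>g \<in> carrier G. quasi_permutation_matrix (\<rho> g)"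
      unfolding quasi_perm_degree_def by (rule LeastI[of _ n]) (use \<rho> in blast)
    then obtain \<tau> where \<tau>: "\<tau> \<in> mon G (GL (quasi_perm_degree G))" "\<forall>g \<in> carrier G. quasi_permutation_matrix (\<tau> g)"
      by blast
    have "d * p\<^sup>2 \<le> quasi_perm_degree G" unfolding d_def
      by (rule faithful_quasi_permutation_degree[OF assms(1,3) per deg assms(4) nofactor \<tau>])
    then show ?thesis using upper by simp
  qed
  ultimately show ?thesis unfolding d_def by blast
qed

end
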